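(* For every positive integer $n$, the expected density of the empirical measure $\mathcal{C}_{p_n}$ of critical values of $p_n$ is given, for $x\in\mathbb{C}$, by $$\mathbb{D}_{p_n}(x)=\frac{n-1}{\pi}\int_1^\infty\frac{n(r-1)+1}{r^{n+2}}\,e^{-\frac{n(r-1)+1}{r^n}|x|^2}\,dr.$$ Thus $\mathbb{D}_{p_n}$ is a function depending only on $|x|$.
   Context: Let $a_0,a_1,a_2,\dots$ be i.i.d. complex random variables with density $\frac1\pi e^{-|z|^2}$ with respect to Lebesgue measure on $\mathbb{C}$. For a positive integer $n$, the Gaussian $SU(2)$ random polynomial is $p_n(z)=\sum_{j=0}^n a_j\sqrt{\binom nj}\,z^j$, $z\in\mathbb{C}$. The empirical measure of critical values of $p_n$ is $\mathcal{C}_{p_n}=\sum_{z\in\mathbb{C}:\,p_n'(z)=0}\delta_{p_n(z)}$. The expected density $\mathbb{D}_{p_n}$ is the (continuous) function on $\mathbb{C}$ such that for every smooth compactly supported $\phi$ on $\mathbb{R}^2\cong\mathbb{C}$, $$\mathbb{E}\sum_{z:\,p_n'(z)=0}\phi(p_n(z))=\int_{\mathbb{C}}\phi(x)\,\mathbb{D}_{p_n}(x)\,d\ell_x,$$ where $d\ell_x$ is Lebesgue measure on $\mathbb{C}$. *)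

theory Defs
  imports
    "HOL-Probability.Probability"
    "HOL-Computational_Algebra.Polynomial"
begin

definition su2_poly :: "nat \<Rightarrow> (nat \<Rightarrow> complex) \<Rightarrow> complex poly" where
  "su2_poly n a = (\<Sum>j\<le>n. monom (a j * complex_of_real (sqrt (real (n choose j)))) j)"

lemma poly_su2_poly:
  "poly (su2_poly n a) z = (\<Sum>j\<le>n. a j * complex_of_real (sqrt (real (n choose j))) * z ^ j)"
  by (simp add: su2_poly_def poly_sum poly_monom)

text \<open>
  The sum of the Dirac masses at \<open>p z\<close> over the set of zeros \<open>z\<close> of \<open>p'\<close>, written as the
  push-forward under \<open>p\<close> of counting measure on that set. Each critical point is counted once;
  distinct critical points with the same critical value each contribute.
\<close>
definition critical_value_measure :: "complex poly \<Rightarrow> complex measure" where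
  "critical_value_measure p =
     distr (count_space {z. poly (pderiv p) z = 0}) borel (poly p)"

text \<open>
  The equation below needs no side condition on \<open>p\<close>: for constant \<open>p\<close> every point is critical
  and both sides are \<open>0\<close> by convention.
\<close>
lemma integral_critical_value_measure:
  fixes \<phi> :: "complex \<Rightarrow> real"
  assumes [measurable]: "\<phi> \<in> borel_measurable borel"
  shows "(LINT x|critical_value_measure p. \<phi> x) =
         (\<Sum>z | poly (pderiv p) z = 0. \<phi> (poly p z))"
proof -
  let ?Z = "{z. poly (pderiv p) z = 0}"
  have eq: "(LINT x|critical_value_measure p. \<phi> x) = (LINT z|count_space ?Z. \<phi> (poly p z))"
    unfolding critical_value_measure_def by (subst integral_distr) auto
  show ?thesis
  proof (cases "finite ?Z")
    case True
    then show ?thesis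
      unfolding eq by (rule lebesgue_integral_count_space_finite)
  next
    case False
    then have "pderiv p = 0"
      using poly_roots_finite by blast
    then obtain c where p: "p = [:c:]"
      by (metis pderiv_eq_0_iff degree_eq_zeroE)
    show ?thesis
      using False unfolding eq by (simp add: p measure_def)
  qed
qed

primrec k_times_differentiable ::
  "nat \<Rightarrow> ('a::real_normed_vector \<Rightarrow> 'b::real_normed_vector) \<Rightarrow> bool" where
  "k_times_differentiable 0 f \<longleftrightarrow> continuous_on UNIV f"
| "k_times_differentiable (Suc k) f \<longleftrightarrow>
     (\<forall>x. f differentiable (at x)) \<and>
     (\<forall>v. k_times_differentiable k (\<lambda>x. frechet_derivative f (at x) v))"

text \<open>
  Smoothness is real (\<open>C\<^sup>\<infinity>\<close>) smoothness: on \<open>complex\<close>, regarded as a real vector space,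
  Frechet derivatives are real-linear, and all iterated directional derivatives
  in all real directions are required to exist and be continuous.
\<close>
definition smooth :: "('a::real_normed_vector \<Rightarrow> 'b::real_normed_vector) \<Rightarrow> bool" where
  "smooth f \<longleftrightarrow> (\<forall>k. k_times_differentiable k f)"

definition test_function :: "(complex \<Rightarrow> real) \<Rightarrow> bool" where
  "test_function \<phi> \<longleftrightarrow> smooth \<phi> \<and> compact (closure {x. \<phi> x \<noteq> 0})"

text \<open>
  The integrability clause ensures that the expectation on the left-hand side is a genuine one,
  rather than the default value of a non-existing integral. On the right-hand side integrability
  is automatic, the integrand being continuous with compact support.
\<close>
definition has_expected_density ::
  "'w measure \<Rightarrow> ('w \<Rightarrow> complex measure) \<Rightarrow> (complex \<Rightarrow> real) \<Rightarrow> bool" where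
  "has_expected_density M \<mu> D \<longleftrightarrow>
     continuous_on UNIV D \<and>
     (\<forall>\<phi>. test_function \<phi> \<longrightarrow>
        integrable M (\<lambda>\<omega>. LINT x|\<mu> \<omega>. \<phi> x) \<and>
        (LINT \<omega>|M. LINT x|\<mu> \<omega>. \<phi> x) = (LINT x|lborel. \<phi> x * D x))"

end

theory Submission
  imports
    Defs
    "HOL-Complex_Analysis.Complex_Analysis"
    "HOL-Real_Asymp.Real_Asymp"
begin

text \<open>
  This is a Kac--Rice argument. With \<open>a\<^sub>0, a\<^sub>2, \<dots>, a\<^sub>n\<close> fixed, \<open>z\<close> is critical exactly when
  \<open>a\<^sub>1 = g z\<close> for a polynomial \<open>g\<close> not involving \<open>a\<^sub>0\<close> or \<open>a\<^sub>1\<close>, so the area formula for \<open>g\<close> turns the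
  integral over \<open>a\<^sub>1\<close> of the sum over critical points into an integral over \<open>z\<close> with weight
  \<open>|g' z|\<^sup>2\<close>. Shifting \<open>a\<^sub>0\<close> to the critical value \<open>x\<close> leaves, for each \<open>z\<close> and \<open>x\<close>, a Gaussian
  integral over \<open>a\<^sub>2, \<dots>, a\<^sub>n\<close> determined by the covariances of \<open>p z\<close>, \<open>p' z\<close> and \<open>p'' z\<close>. It depends
  on \<open>z\<close> only through \<open>r = 1 + |z|\<^sup>2\<close>, and integration by parts in \<open>r\<close> gives the stated formula.
  Since expected densities are continuous, bump functions show that they are unique.
\<close>

section \<open>The area formula for complex polynomials\<close>

text \<open>In \<open>p'\<close> the coefficient of \<open>a\<^sub>1\<close> is the constant
  \<open>sqrt n\<close>. Solving for \<open>a\<^sub>1\<close> therefore never divides by a quantity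
  that may vanish, and an area formula in one complex variable suffices instead of a coarea formula
  in the coefficient space. An obstacle is that the critical points are not given as measurable
  functions of the coefficients; sums over them are recovered as limits of sums over dyadic cells.
  The covariance matrix of the three Gaussian forms is never inverted. The variables are absorbed
  one at a time by unitary rotations that update a triangular factor, and the quantities that matter
  are then read off from the Gram relations. Degenerate coefficients cost nothing: an infinite
  critical set occurs for at most one value of \<open>a\<^sub>1\<close> when the other coefficients
  are fixed. The integrals are first evaluated for nonnegative continuous functions, where Tonelli
  applies without integrability checks; smoothness is not kept because the positive and negative
  parts of a test function lose it.\<close>

definition vec_of :: "complex \<Rightarrow> real^2" where
  "vec_of z = vector [Re z, Im z]"

text \<open>Determinants, and with them the change-of-variables formula, live on
  \<open>real^2\<close>; \<open>vec_of\<close> and \<open>complex_of\<close> carry that formula over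
  to the complex plane.\<close>

definition complex_of :: "real^2 \<Rightarrow> complex" where
  "complex_of v = Complex (v $ 1) (v $ 2)"

lemma complex_of_vec_of [simp]: "complex_of (vec_of z) = z"
  by (simp add: vec_of_def complex_of_def complex_eq_iff)

lemma vec_of_complex_of [simp]: "vec_of (complex_of v) = v"
  by (simp add: vec_of_def complex_of_def vec_eq_iff forall_2)

lemma linear_vec_of: "linear vec_of"
  by (rule linearI) (simp_all add: vec_of_def vec_eq_iff forall_2)

lemma linear_complex_of: "linear complex_of"
  by (rule linearI) (simp_all add: complex_of_def complex_eq_iff)

lemma vec_of_measurable [measurable]: "vec_of \<in> borel_measurable borel"
  using linear_vec_of by (intro borel_measurable_continuous_onI linear_continuous_on)
    (simp add: linear_conv_bounded_linear)

lemma complex_of_measurable [measurable]: "complex_of \<in> borel_measurable borel"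
  using linear_complex_of by (intro borel_measurable_continuous_onI linear_continuous_on)
    (simp add: linear_conv_bounded_linear)

text \<open>Lebesgue measure is characterised by its values on boxes, and \<open>complex_of\<close>
  pulls a box back to a box with the same side lengths.\<close>

lemma distr_complex_of: "distr lborel borel complex_of = lborel"
proof (rule lborel_eqI[symmetric])
  fix l u :: complex assume le: "\<And>b. b \<in> Basis \<Longrightarrow> l \<bullet> b \<le> u \<bullet> b"
  have *: "complex_of -` box l u = box (vec_of l) (vec_of u)"
    by (auto simp: box_def Basis_complex_def Basis_vec_def inner_axis complex_of_def vec_of_def
        exhaust_2 UNIV_2)
  have le': "vec_of l \<bullet> b \<le> vec_of u \<bullet> b" if "b \<in> Basis" for b
    using that le[of 1] le[of \<i>] by (auto simp: Basis_complex_def Basis_vec_def inner_axis vec_of_def UNIV_2)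
  have B: "(Basis :: (real^2) set) = {axis 1 1, axis 2 1}"
    by (auto simp: Basis_vec_def UNIV_2)
  have ne: "axis 1 1 \<noteq> (axis 2 1 :: real^2)" by (simp add: axis_eq_axis)
  have "emeasure (distr lborel borel complex_of) (box l u) = emeasure lborel (box (vec_of l) (vec_of u))"
    by (subst emeasure_distr) (auto simp: *)
  also have "\<dots> = (\<Prod>b\<in>Basis. (vec_of u - vec_of l) \<bullet> b)"
    by (rule emeasure_lborel_box) (rule le')
  also have "(\<Prod>b\<in>Basis. (vec_of u - vec_of l) \<bullet> b) = (\<Prod>b\<in>Basis. (u - l) \<bullet> b)"
    by (simp add: B ne Basis_complex_def inner_axis vec_of_def)
  finally show "emeasure (distr lborel borel complex_of) (box l u) = ennreal (\<Prod>b\<in>Basis. (u - l) \<bullet> b)" .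
qed simp

lemma nn_integral_complex_of:
  fixes f :: "complex \<Rightarrow> ennreal"
  assumes [measurable]: "f \<in> borel_measurable borel"
  shows "(\<integral>\<^sup>+z. f z \<partial>lborel) = (\<integral>\<^sup>+v. f (complex_of v) \<partial>lborel)"
  by (subst distr_complex_of[symmetric]) (simp add: nn_integral_distr)

lemma emeasure_complex_of:
  assumes [measurable]: "A \<in> sets borel"
  shows "emeasure lborel A = emeasure lborel (complex_of -` A)"
  by (subst distr_complex_of[symmetric]) (simp add: emeasure_distr)

lemma vimage_complex_of: "complex_of -` A = vec_of ` A"
  by (force intro: image_eqI[where x="complex_of _"])

text \<open>Multiplication by c = a + ib has the matrix with rows (a, -b) and (b, a). This is the
  source of the weight |g'|^2.\<close>

lemma det_matrix_complex_mult:
  "det (matrix (\<lambda>v. vec_of (c * complex_of v))) = (cmod c)\<^sup>2"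
  by (simp add: det_2 matrix_def vec_of_def complex_of_def axis_def cmod_def power2_eq_square)

text \<open>The formula on \<open>real^2\<close> asks for an integrable Jacobian; the finite measure
  of \<open>S\<close> and the bound \<open>B\<close> provide it. Cutting the plane into bounded
  pieces will later remove both restrictions.\<close>

lemma emeasure_image_complex_derivative:
  fixes g g' :: "complex \<Rightarrow> complex"
  assumes S [measurable]: "S \<in> sets borel" and fin: "emeasure lborel S < \<infinity>"
    and gS [measurable]: "g ` S \<in> sets borel"
    and der: "\<And>z. z \<in> S \<Longrightarrow> (g has_field_derivative g' z) (at z)"
    and inj: "inj_on g S"
    and g'm [measurable]: "g' \<in> borel_measurable borel"
    and bnd: "\<And>z. z \<in> S \<Longrightarrow> cmod (g' z) \<le> B"
  shows "emeasure lborel (g ` S) = (\<integral>\<^sup>+z. ennreal ((cmod (g' z))\<^sup>2) * indicator S z \<partial>lborel)"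
proof -
  define S' where "S' = vec_of ` S"
  define G where "G v = vec_of (g (complex_of v))" for v
  define G' where "G' v = (\<lambda>h. vec_of (g' (complex_of v) * complex_of h))" for v
  have S'_eq: "S' = complex_of -` S" by (simp add: S'_def vimage_complex_of)
  have S'm [measurable]: "S' \<in> sets borel"
    unfolding S'_eq using S measurable_sets[OF complex_of_measurable, of S] by simp
  have GS: "G ` S' = complex_of -` (g ` S)"
    unfolding vimage_complex_of by (auto simp: S'_def G_def image_image)
  have blv: "bounded_linear vec_of" and blc: "bounded_linear complex_of"
    using linear_vec_of linear_complex_of by (simp_all add: linear_conv_bounded_linear)
  have derG: "(G has_derivative G' v) (at v within S')" if "v \<in> S'" for v
  proof -
    have "complex_of v \<in> S" using that by (simp add: S'_eq)
    then have d: "(g has_derivative (\<lambda>h. g' (complex_of v) * h)) (at (complex_of v))"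
      using der by (simp add: has_field_derivative_def)
    have c: "(complex_of has_derivative complex_of) (at v)"
      by (rule bounded_linear_imp_has_derivative[OF blc])
    have "((\<lambda>v. g (complex_of v)) has_derivative (\<lambda>h. g' (complex_of v) * complex_of h)) (at v)"
      using diff_chain_at[OF c d] by (simp add: o_def)
    then have "(G has_derivative G' v) (at v)"
      unfolding G_def G'_def by (rule bounded_linear.has_derivative[OF blv])
    then show ?thesis by (rule has_derivative_at_withinI)
  qed
  have injG: "inj_on G S'"
  proof (rule inj_onI)
    fix x y assume xy: "x \<in> S'" "y \<in> S'" "G x = G y"
    then have "g (complex_of x) = g (complex_of y)"
      unfolding G_def by (metis complex_of_vec_of)
    then have "complex_of x = complex_of y"
      using xy inj by (auto simp: S'_eq inj_on_def)
    then show "x = y" by (metis vec_of_complex_of)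
  qed
  have detG: "\<bar>det (matrix (G' v))\<bar> = (cmod (g' (complex_of v)))\<^sup>2" for v
    unfolding G'_def by (simp add: det_matrix_complex_mult)
  have fin': "emeasure lborel S' < \<infinity>"
    using fin by (simp add: S'_eq emeasure_complex_of)
  have sint: "set_integrable lborel S' (\<lambda>v. (cmod (g' (complex_of v)))\<^sup>2)"
    unfolding set_integrable_def
  proof (rule integrableI_bounded_set[where A=S' and B="B\<^sup>2"])
    show "AE x in lborel. x \<in> S' \<longrightarrow> norm (indicator S' x *\<^sub>R (cmod (g' (complex_of x)))\<^sup>2) \<le> B\<^sup>2"
      using bnd by (intro AE_I2) (auto simp: S'_eq intro!: power_mono)
  qed (use fin' in auto)
  have L: "S' \<in> sets lebesgue" using S'm by simp
  have "G ` S' \<in> sets borel" unfolding GS using gS measurable_sets[OF complex_of_measurable, of "g ` S"] by simp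
  have int: "(\<lambda>v. \<bar>det (matrix (G' v))\<bar>) integrable_on S'"
    unfolding detG by (rule set_borel_integral_eq_integral(1)[OF sint])
  have lm: "G ` S' \<in> lmeasurable"
    by (subst measurable_differentiable_image_eq[OF L derG injG]) (auto intro: int)
  have "measure lebesgue (G ` S') = integral S' (\<lambda>v. \<bar>det (matrix (G' v))\<bar>)"
    by (rule measure_differentiable_image_eq[OF L derG injG int])
  also have "\<dots> = (LINT v:S'|lborel. (cmod (g' (complex_of v)))\<^sup>2)"
    unfolding detG by (rule set_borel_integral_eq_integral(2)[OF sint, symmetric])
  finally have m: "measure lebesgue (G ` S') = (LINT v:S'|lborel. (cmod (g' (complex_of v)))\<^sup>2)" .
  have "emeasure lebesgue (G ` S') = ennreal (LINT v:S'|lborel. (cmod (g' (complex_of v)))\<^sup>2)"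
    unfolding m[symmetric] by (rule emeasure_eq_ennreal_measure[OF fmeasurableD2[OF lm]])
  also have "\<dots> = (\<integral>\<^sup>+v. ennreal (indicator S' v *\<^sub>R (cmod (g' (complex_of v)))\<^sup>2) \<partial>lborel)"
    unfolding set_lebesgue_integral_def
    by (rule nn_integral_eq_integral[symmetric]) (use sint in \<open>simp_all add: set_integrable_def\<close>)
  also have "\<dots> = (\<integral>\<^sup>+v. ennreal ((cmod (g' (complex_of v)))\<^sup>2) * indicator S' v \<partial>lborel)"
    by (intro nn_integral_cong) (simp add: indicator_def)
  also have "\<dots> = (\<integral>\<^sup>+z. ennreal ((cmod (g' z))\<^sup>2) * indicator S z \<partial>lborel)"
    by (rule trans[OF _ nn_integral_complex_of[symmetric]]) (simp_all add: S'_eq indicator_def)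
  also have "emeasure lebesgue (G ` S') = emeasure lborel (g ` S)"
    using \<open>G ` S' \<in> sets borel\<close> by (subst emeasure_complex_of) (simp_all add: GS)
  finally show ?thesis .
qed

text \<open>Both sides integrate \<open>F\<close> against a measure on the target plane, so it is
  enough to compare these measures on Borel sets. Boundedness of \<open>U\<close> gives finite
  measure and a bounded derivative; by the open mapping theorem the image is open, hence
  Borel.\<close>

lemma nn_integral_image_holomorphic:
  fixes g g' :: "complex \<Rightarrow> complex" and F :: "complex \<Rightarrow> ennreal"
  assumes U: "open U" "bounded U"
    and der: "\<And>z. (g has_field_derivative g' z) (at z)"
    and cont: "continuous_on UNIV g'"
    and inj: "inj_on g U"
    and Fm [measurable]: "F \<in> borel_measurable borel"
  shows "(\<integral>\<^sup>+w. F w * indicator (g ` U) w \<partial>lborel) =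
    (\<integral>\<^sup>+z. F (g z) * ennreal ((cmod (g' z))\<^sup>2) * indicator U z \<partial>lborel)"
proof -
  have g'm [measurable]: "g' \<in> borel_measurable borel"
    by (rule borel_measurable_continuous_onI[OF cont])
  have gc: "continuous_on UNIV g"
    using der by (intro continuous_at_imp_continuous_on ballI DERIV_isCont)
  have gm [measurable]: "g \<in> borel_measurable borel"
    by (rule borel_measurable_continuous_onI[OF gc])
  have Um [measurable]: "U \<in> sets borel" using U by simp
  have "g holomorphic_on U"
    using der by (auto simp: holomorphic_on_def field_differentiable_def intro: has_field_derivative_at_within)
  then have "open (g ` U)" using open_mapping_thm3 U inj by blast
  then have gU [measurable]: "g ` U \<in> sets borel" by simp
  have "compact (closure U)" using U by simp
  then have "compact (g' ` closure U)"
    by (rule compact_continuous_image[OF continuous_on_subset[OF cont], rotated]) simp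
  then obtain B where B: "\<And>z. z \<in> closure U \<Longrightarrow> cmod (g' z) \<le> B"
    using compact_imp_bounded bounded_iff by (metis imageI)
  then have B': "\<And>z. z \<in> U \<Longrightarrow> cmod (g' z) \<le> B" using closure_subset by blast
  have finU: "emeasure lborel T < \<infinity>" if "T \<subseteq> U" for T
    using emeasure_bounded_finite[of T] U bounded_subset[OF _ that] by auto
  define M1 where "M1 = distr (density lborel (\<lambda>z. ennreal ((cmod (g' z))\<^sup>2) * indicator U z)) borel g"
  define M2 where "M2 = density lborel (indicator (g ` U) :: complex \<Rightarrow> ennreal)"
  have "M1 = M2"
  proof (rule measure_eqI)
    show "sets M1 = sets M2" by (simp add: M1_def M2_def)
    fix A assume "A \<in> sets M1"
    then have A [measurable]: "A \<in> sets borel" by (simp add: M1_def)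
    define S where "S = U \<inter> g -` A"
    have Sm [measurable]: "S \<in> sets borel"
      unfolding S_def using measurable_sets[OF gm A] by auto
    have gS: "g ` S = g ` U \<inter> A" by (auto simp: S_def)
    have "emeasure M1 A = (\<integral>\<^sup>+z. ennreal ((cmod (g' z))\<^sup>2) * indicator S z \<partial>lborel)"
      unfolding M1_def using measurable_sets[OF gm A]
      by (subst emeasure_distr)
        (auto simp: emeasure_density S_def indicator_def intro!: nn_integral_cong)
    also have "\<dots> = emeasure lborel (g ` S)"
      by (rule emeasure_image_complex_derivative[symmetric, where B=B])
        (use der inj B' finU[of S] gU in \<open>auto simp: S_def inj_on_def gS[unfolded S_def]\<close>)
    also have "\<dots> = emeasure M2 A"
      unfolding M2_def gS by (simp add: emeasure_density flip: indicator_inter_arith)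
    finally show "emeasure M1 A = emeasure M2 A" .
  qed
  have "(\<integral>\<^sup>+w. F w * indicator (g ` U) w \<partial>lborel) = (\<integral>\<^sup>+w. F w \<partial>M2)"
    unfolding M2_def by (subst nn_integral_density) (auto simp: mult.commute)
  also have "\<dots> = (\<integral>\<^sup>+w. F w \<partial>M1)" by (simp add: \<open>M1 = M2\<close>)
  also have "\<dots> = (\<integral>\<^sup>+z. F (g z) * ennreal ((cmod (g' z))\<^sup>2) * indicator U z \<partial>lborel)"
    unfolding M1_def by (subst nn_integral_distr)
      (auto simp: nn_integral_density intro!: nn_integral_cong simp: ac_simps)
  finally show ?thesis .
qed

text \<open>Away from the finitely many zeros of its derivative, a nonconstant \<open>g\<close> is
  locally injective. Countably many such neighbourhoods, made disjoint, meet each fibre in at most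
  one point apiece, so summing the injective formula over the pieces counts every point of a fibre
  over a noncritical value once.\<close>

theorem nn_integral_poly_fibres:
  fixes g :: "complex poly" and G :: "complex \<Rightarrow> ennreal"
  assumes Gm [measurable]: "G \<in> borel_measurable borel"
  shows "(\<integral>\<^sup>+w. (\<integral>\<^sup>+z. G z \<partial>count_space {z. poly g z = w}) \<partial>lborel) =
    (\<integral>\<^sup>+z. G z * ennreal ((cmod (poly (pderiv g) z))\<^sup>2) \<partial>lborel)"
proof (cases "pderiv g = 0")
  case True
  then obtain c where c: "g = [:c:]" by (metis pderiv_eq_0_iff degree_eq_zeroE)
  \<comment> \<open>A constant polynomial has a nonempty fibre only over \<open>c\<close>, so the
    fibre integral vanishes off a null set.\<close>
  have "AE w in lborel. w \<noteq> c"
    by (rule AE_lborel_singleton)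
  then have "(\<integral>\<^sup>+w. (\<integral>\<^sup>+z. G z \<partial>count_space {z. poly g z = w}) \<partial>lborel) = (\<integral>\<^sup>+w. 0 \<partial>(lborel :: complex measure))"
    by (intro nn_integral_cong_AE, elim eventually_mono) (simp add: c nn_integral_empty)
  then show ?thesis by (simp add: True)
next
  case False
  let ?g = "poly g" and ?g' = "poly (pderiv g)"
  have [measurable]: "?g' \<in> borel_measurable borel"
    by (intro borel_measurable_continuous_onI continuous_intros)
  define Z where "Z = {z. ?g' z = 0}"
  have finZ: "finite Z" unfolding Z_def using False by (rule poly_roots_finite)
  define \<U> where "\<U> = {U. open U \<and> bounded U \<and> inj_on ?g U}"
  have cover: "\<exists>U\<in>\<U>. z \<in> U" if "z \<notin> Z" for z
  proof -
    have "?g holomorphic_on UNIV" by (intro holomorphic_intros)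
    moreover have "deriv ?g z \<noteq> 0"
      using that by (simp add: Z_def DERIV_imp_deriv[OF poly_DERIV])
    ultimately obtain r where "r > 0" "inj_on ?g (ball z r)"
      by (metis has_complex_derivative_locally_injective UNIV_I open_UNIV)
    then show ?thesis by (intro bexI[of _ "ball z r"]) (auto simp: \<U>_def)
  qed
  have "\<And>S. S \<in> \<U> \<Longrightarrow> openin (top_of_set UNIV) S" by (auto simp: \<U>_def)
  then obtain \<V> where \<V>: "\<V> \<subseteq> \<U>" "countable \<V>" "\<Union>\<V> = \<Union>\<U>" by (rule Lindelof_openin)
  \<comment> \<open>The empty set is added so that the family is nonempty and can be enumerated by
    the natural numbers.\<close>
  define U where "U = from_nat_into (insert {} \<V>)"
  have rU: "range U = insert {} \<V>" unfolding U_def using \<V>(2) by (intro range_from_nat_into) auto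
  have "{} \<in> \<U>" by (simp add: \<U>_def)
  then have "range U \<subseteq> \<U>" using \<V>(1) by (simp add: rU)
  then have "U i \<in> \<U>" for i by (meson rangeI subsetD)
  then have U: "open (U i)" "bounded (U i)" "inj_on ?g (U i)" for i
    by (simp_all add: \<U>_def)
  have [measurable]: "U i \<in> sets borel" for i using U by simp
  define B where "B = disjointed U"
  have Bm [measurable]: "B i \<in> sets borel" for i
    unfolding B_def by (rule sets.range_disjointed_sets[of U borel, THEN subsetD]) auto
  have BU: "B i \<subseteq> U i" for i unfolding B_def by (rule disjointed_subset)
  have UB: "(\<Union>i. B i) = (\<Union>i. U i)" unfolding B_def by (rule UN_disjointed_eq)
  have disj: "disjoint_family B" unfolding B_def by (rule disjoint_family_disjointed)
  have ind1: "(\<Sum>i. indicator (B i) z :: ennreal) = indicator (\<Union>i. B i) z" for z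
    by (rule suminf_indicator[OF disj])
  have UZ: "z \<in> (\<Union>i. B i)" if "z \<notin> Z" for z
  proof -
    have "z \<in> \<Union>(range U)" unfolding rU using cover[OF that] \<V>(3) by auto
    then show ?thesis by (simp add: UB)
  qed
  have sumB: "(\<Sum>i. c * indicator (B i) z) = c" if "z \<notin> Z" for c :: ennreal and z
  proof -
    have "(\<Sum>i. c * indicator (B i) z) = c * (\<Sum>i. indicator (B i) z)"
      by (rule ennreal_suminf_cmult)
    then show ?thesis unfolding ind1 using UZ[OF that] by (simp only: indicator_simps mult_1_right)
  qed
  \<comment> \<open>For \<open>w\<close> outside the finitely many critical values the whole fibre
    avoids \<open>Z\<close> and is thus covered by the pieces \<open>B i\<close>.\<close>
  have crit: "AE w in lborel. w \<notin> ?g ` Z"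
    using finZ by (intro AE_not_in) (simp add: finite_imp_null_set_lborel)
  have critZ: "AE z in lborel. z \<notin> Z"
    using finZ by (intro AE_not_in) (simp add: finite_imp_null_set_lborel)
  define h where "h i = inv_into (U i) ?g" for i
  have h: "h i (?g z) = z" if "z \<in> U i" for i z
    unfolding h_def using U(3) that by (rule inv_into_f_f)
  have gU: "open (?g ` U i)" for i
    by (rule open_mapping_thm3[OF _ U(1,3)]) (intro holomorphic_intros)
  then have [measurable]: "?g ` U i \<in> sets borel" for i by simp
  have hc: "continuous_on (?g ` U i) (h i)" for i
    by (rule continuous_on_inverse_open[OF U(1)]) (auto intro: continuous_intros h)
  \<comment> \<open>This is \<open>G\<close> at the unique preimage of \<open>w\<close> in
    \<open>U i\<close>, cut down to \<open>B i\<close>. Off the image the dummy point 0 replaces the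
    preimage; there the indicator of the image will remove the term.\<close>
  define F where "F i w = indicator (B i) (if w \<in> ?g ` U i then h i w else 0) * 
      G (if w \<in> ?g ` U i then h i w else 0)" for i w
  have [measurable]: "(\<lambda>w. if w \<in> ?g ` U i then h i w else 0) \<in> borel_measurable borel" for i
    by (rule borel_measurable_continuous_on_if) (use hc in auto)
  have Fm [measurable]: "F i \<in> borel_measurable borel" for i
    unfolding F_def by measurable
  have fib: "(\<integral>\<^sup>+z. G z * indicator (B i) z \<partial>count_space {z. ?g z = w}) = F i w * indicator (?g ` U i) w" for i w
  proof (cases "w \<in> ?g ` U i")
    case True
    then obtain z0 where z0: "z0 \<in> U i" "?g z0 = w" by auto
    have un: "z = z0" if "z \<in> B i" "?g z = w" for z
      using that z0 BU U(3)[of i] by (metis inj_on_def subsetD)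
    have "(\<integral>\<^sup>+z. G z * indicator (B i) z \<partial>count_space {z. ?g z = w}) =
       (\<integral>\<^sup>+z. G z * indicator (B i) z \<partial>count_space {z0})"
      by (rule nn_integral_count_space_eq) (use un z0 in \<open>auto simp: indicator_def\<close>)
    also have "\<dots> = F i w * indicator (?g ` U i) w"
      using True z0 h[of z0 i] by (auto simp: F_def nn_integral_count_space_finite mult.commute indicator_def)
    finally show ?thesis .
  next
    case False
    then have "\<And>z. ?g z = w \<Longrightarrow> z \<notin> B i" using BU by blast
    then have "(\<integral>\<^sup>+z. G z * indicator (B i) z \<partial>count_space {z. ?g z = w}) = (\<integral>\<^sup>+z. 0 \<partial>count_space {z. ?g z = w})"
      by (intro nn_integral_cong) auto
    then show ?thesis using False by simp
  qed
  have "(\<integral>\<^sup>+w. (\<integral>\<^sup>+z. G z \<partial>count_space {z. ?g z = w}) \<partial>lborel) =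
     (\<integral>\<^sup>+w. (\<Sum>i. F i w * indicator (?g ` U i) w) \<partial>lborel)"
  proof (rule nn_integral_cong_AE, use crit in eventually_elim)
    fix w assume w: "w \<notin> ?g ` Z"
    have "(\<integral>\<^sup>+z. G z \<partial>count_space {z. ?g z = w}) =
      (\<integral>\<^sup>+z. (\<Sum>i. G z * indicator (B i) z) \<partial>count_space {z. ?g z = w})"
    proof (rule nn_integral_cong)
      fix z assume "z \<in> space (count_space {z. ?g z = w})"
      then have "z \<notin> Z" using w by auto
      then show "G z = (\<Sum>i. G z * indicator (B i) z)" by (rule sumB[symmetric])
    qed
    also have "\<dots> = (\<Sum>i. \<integral>\<^sup>+z. G z * indicator (B i) z \<partial>count_space {z. ?g z = w})"
      by (rule nn_integral_suminf) simp
    finally show "(\<integral>\<^sup>+z. G z \<partial>count_space {z. ?g z = w}) = (\<Sum>i. F i w * indicator (?g ` U i) w)"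
      by (simp add: fib)
  qed
  also have "\<dots> = (\<Sum>i. \<integral>\<^sup>+w. F i w * indicator (?g ` U i) w \<partial>lborel)"
    by (rule nn_integral_suminf) measurable
  also have "\<dots> = (\<Sum>i. \<integral>\<^sup>+z. F i (?g z) * ennreal ((cmod (?g' z))\<^sup>2) * indicator (U i) z \<partial>lborel)"
    by (intro suminf_cong nn_integral_image_holomorphic U Fm poly_DERIV continuous_intros)
  also have "\<dots> = (\<Sum>i. \<integral>\<^sup>+z. G z * ennreal ((cmod (?g' z))\<^sup>2) * indicator (B i) z \<partial>lborel)"
    by (intro suminf_cong nn_integral_cong) (use h BU in \<open>auto simp: F_def indicator_def\<close>)
  also have "\<dots> = (\<integral>\<^sup>+z. (\<Sum>i. G z * ennreal ((cmod (?g' z))\<^sup>2) * indicator (B i) z) \<partial>lborel)"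
    by (rule nn_integral_suminf[symmetric]) measurable
  also have "\<dots> = (\<integral>\<^sup>+z. G z * ennreal ((cmod (?g' z))\<^sup>2) \<partial>lborel)"
    by (rule nn_integral_cong_AE, use critZ in eventually_elim) (rule sumB)
  finally show ?thesis .
qed

section \<open>Uniqueness of the expected density\<close>

text \<open>The derivative of \<open>exp_bump k\<close> is \<open>exp_bump (k + 2) - k * exp_bump (k + 1)\<close>, so these
  functions are closed under differentiation up to linear combinations.\<close>

definition exp_bump :: "nat \<Rightarrow> real \<Rightarrow> real" where
  "exp_bump k t = (if t > 0 then exp (- (1 / t)) / t ^ k else 0)"

lemma exp_bump_tendsto_0: "(exp_bump k \<longlongrightarrow> 0) (at 0)"
proof -
  have "((\<lambda>t. exp (- (1 / t)) / t ^ k) \<longlongrightarrow> (0::real)) (at_right 0)"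
    by real_asymp
  then have r: "(exp_bump k \<longlongrightarrow> 0) (at_right 0)"
    by (rule Lim_transform_eventually)
      (auto simp: exp_bump_def eventually_at_filter)
  have l: "(exp_bump k \<longlongrightarrow> 0) (at_left 0)"
    by (rule Lim_transform_eventually[OF tendsto_const])
      (auto simp: exp_bump_def eventually_at_filter)
  from l r show ?thesis by (simp add: filterlim_split_at)
qed

lemma DERIV_exp_bump:
  "(exp_bump k has_real_derivative (exp_bump (k + 2) t - real k * exp_bump (k + 1) t)) (at t)"
proof (cases t "0::real" rule: linorder_cases)
  case less
  have "((\<lambda>_. 0) has_real_derivative 0) (at t)" by simp
  then have "(exp_bump k has_real_derivative 0) (at t)"
    by (rule has_field_derivative_transform_within_open[where S="{..<0}"])
      (use less in \<open>auto simp: exp_bump_def\<close>)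
  then show ?thesis using less by (simp add: exp_bump_def)
next
  case equal
  \<comment> \<open>Dividing \<open>exp_bump k h\<close> by \<open>h\<close> gives
    \<open>exp_bump (k + 1) h\<close>, so the difference quotient at 0 is again a member of the
    family and tends to 0.\<close>
  have "((\<lambda>h. (exp_bump k (0 + h) - exp_bump k 0) / h) \<longlongrightarrow> 0) (at 0)"
    by (rule Lim_transform_eventually[OF exp_bump_tendsto_0[of "k+1"]])
      (auto simp: exp_bump_def eventually_at_filter)
  then show ?thesis by (simp add: equal DERIV_def exp_bump_def)
next
  case greater
  have "((\<lambda>t. exp (- (1 / t)) / t ^ k) has_real_derivative
      (exp (- (1 / t)) / t ^ (k + 2) - real k * (exp (- (1 / t)) / t ^ (k + 1)))) (at t)"
    using greater
    by (auto intro!: derivative_eq_intros) (cases k; auto simp: field_simps power2_eq_square)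
  then have "(exp_bump k has_real_derivative
      (exp (- (1 / t)) / t ^ (k + 2) - real k * (exp (- (1 / t)) / t ^ (k + 1)))) (at t)"
    by (rule has_field_derivative_transform_within_open[where S="{0<..}"])
      (use greater in \<open>auto simp: exp_bump_def\<close>)
  then show ?thesis using greater by (simp add: exp_bump_def)
qed

text \<open>Smoothness is obtained from closure alone: the gradient of the squared distance is
  affine in the real coordinates, so this algebra is stable under directional derivatives and no
  formula for higher derivatives is required. The parameter \<open>r\<close> is the square of the
  radius.\<close>

inductive bump_algebra :: "complex \<Rightarrow> real \<Rightarrow> (complex \<Rightarrow> real) \<Rightarrow> bool" for c r where
  const: "bump_algebra c r (\<lambda>_. a)"
| Re: "bump_algebra c r Re"
| Im: "bump_algebra c r Im"
| bump: "bump_algebra c r (\<lambda>z. exp_bump k (r - (cmod (z - c))\<^sup>2))"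
| add: "bump_algebra c r f \<Longrightarrow> bump_algebra c r g \<Longrightarrow> bump_algebra c r (\<lambda>z. f z + g z)"
| mult: "bump_algebra c r f \<Longrightarrow> bump_algebra c r g \<Longrightarrow> bump_algebra c r (\<lambda>z. f z * g z)"

lemma bump_algebra_derivative:
  assumes "bump_algebra c r f"
  shows "\<exists>f'. (\<forall>z. (f has_derivative f' z) (at z)) \<and> (\<forall>v. bump_algebra c r (\<lambda>z. f' z v))"
  using assms
proof induction
  case (const a)
  show ?case by (intro exI[of _ "\<lambda>_ _. 0"]) (auto intro: bump_algebra.const)
next
  case Re
  have "(Re has_derivative Re) (at z)" for z
    by (rule bounded_linear_imp_has_derivative[OF bounded_linear_Re])
  then show ?case by (intro exI[of _ "\<lambda>_. Re"]) (auto intro: bump_algebra.const)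
next
  case Im
  have "(Im has_derivative Im) (at z)" for z
    by (rule bounded_linear_imp_has_derivative[OF bounded_linear_Im])
  then show ?case by (intro exI[of _ "\<lambda>_. Im"]) (auto intro: bump_algebra.const)
next
  case (bump k)
  let ?u = "\<lambda>z. r - (cmod (z - c))\<^sup>2"
  \<comment> \<open>Only sums and products occur, with negative constants in place of subtraction,
    so that the introduction rules of the algebra match.\<close>
  define q where "q z v = - 2 * (Re z + - Re c) * Re v + - 2 * (Im z + - Im c) * Im v" for z v
  have u: "(?u has_derivative q z) (at z)" for z
    unfolding cmod_power2 q_def by (auto intro!: derivative_eq_intros simp: algebra_simps)
  have "((\<lambda>z. exp_bump k (?u z)) has_derivative
      (\<lambda>v. (exp_bump (k + 2) (?u z) + - real k * exp_bump (k + 1) (?u z)) * q z v)) (at z)" for z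
    using diff_chain_at[OF u DERIV_exp_bump[unfolded has_field_derivative_def]]
    by (simp add: o_def)
  moreover have "bump_algebra c r
      (\<lambda>z. (exp_bump (k + 2) (?u z) + - real k * exp_bump (k + 1) (?u z)) * q z v)" for v
    unfolding q_def by (intro bump_algebra.intros)
  ultimately show ?case
    by (intro exI[of _ "\<lambda>z v. (exp_bump (k + 2) (?u z) + - real k * exp_bump (k + 1) (?u z)) * q z v"]) simp
next
  case (add f g)
  then obtain f' g' where "\<And>z. (f has_derivative f' z) (at z)" "\<And>v. bump_algebra c r (\<lambda>z. f' z v)"
    "\<And>z. (g has_derivative g' z) (at z)" "\<And>v. bump_algebra c r (\<lambda>z. g' z v)" by blast
  then show ?case
    by (intro exI[of _ "\<lambda>z v. f' z v + g' z v"]) (auto intro: has_derivative_add bump_algebra.add)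
next
  case (mult f g)
  then obtain f' g' where "\<And>z. (f has_derivative f' z) (at z)" "\<And>v. bump_algebra c r (\<lambda>z. f' z v)"
    "\<And>z. (g has_derivative g' z) (at z)" "\<And>v. bump_algebra c r (\<lambda>z. g' z v)" by blast
  with mult.hyps show ?case
    by (intro exI[of _ "\<lambda>z v. f z * g' z v + f' z v * g z"])
      (auto intro!: has_derivative_mult bump_algebra.add bump_algebra.mult)
qed

lemma smooth_bump_algebra:
  assumes "bump_algebra c r f"
  shows "smooth f"
  unfolding smooth_def
proof
  fix k from assms show "k_times_differentiable k f"
  proof (induction k arbitrary: f)
    case 0
    then obtain f' where "\<And>z. (f has_derivative f' z) (at z)"
      using bump_algebra_derivative by blast
    then show ?case
      by (auto intro!: continuous_at_imp_continuous_on has_derivative_continuous)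
  next
    case (Suc k)
    then obtain f' where f': "\<And>z. (f has_derivative f' z) (at z)" "\<And>v. bump_algebra c r (\<lambda>z. f' z v)"
      using bump_algebra_derivative by blast
    have "frechet_derivative f (at z) = f' z" for z
      using frechet_derivative_at[OF f'(1)] by simp
    with f' Suc.IH show ?case by (auto simp: differentiable_def)
  qed
qed

lemma ex_test_function_ball:
  assumes "e > 0"
  obtains \<phi> where "test_function \<phi>" "\<And>z. \<phi> z \<ge> 0" "\<And>z. \<phi> z > 0 \<longleftrightarrow> z \<in> ball c e"
proof
  let ?\<phi> = "\<lambda>z. exp_bump 0 (e\<^sup>2 - (cmod (z - c))\<^sup>2)"
  show pos: "?\<phi> z > 0 \<longleftrightarrow> z \<in> ball c e" for z
    using assms by (auto simp: exp_bump_def dist_norm norm_minus_commute power_strict_mono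
        dest: power_less_imp_less_base)
  show nn: "?\<phi> z \<ge> 0" for z by (simp add: exp_bump_def)
  have "{z. ?\<phi> z \<noteq> 0} = ball c e" using pos nn by (auto simp: less_le)
  then show "test_function ?\<phi>"
    unfolding test_function_def using smooth_bump_algebra[OF bump_algebra.bump] by simp
qed

section \<open>Test functions against continuous densities\<close>

lemma smooth_imp_continuous: "smooth f \<Longrightarrow> continuous_on UNIV f"
  unfolding smooth_def by (metis k_times_differentiable.simps(1))

lemma test_function_bounded:
  assumes "test_function \<phi>"
  obtains B where "\<And>z. \<bar>\<phi> z\<bar> \<le> B"
proof -
  let ?K = "closure {x. \<phi> x \<noteq> 0}"
  have "compact (\<phi> ` ?K)"
    using assms continuous_on_subset[OF smooth_imp_continuous]
    by (auto simp: test_function_def intro!: compact_continuous_image)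
  then obtain B where B: "\<And>z. z \<in> ?K \<Longrightarrow> \<bar>\<phi> z\<bar> \<le> B"
    using compact_imp_bounded bounded_iff by (metis imageI real_norm_def)
  have "\<bar>\<phi> z\<bar> \<le> max B 0" for z
    using B[of z] closure_subset[of "{x. \<phi> x \<noteq> 0}"] by (cases "\<phi> z = 0") (auto simp: max_def)
  then show ?thesis by (rule that)
qed

lemma integrable_test_function_mult:
  assumes \<phi>: "test_function \<phi>" and D: "continuous_on UNIV D"
  shows "integrable lborel (\<lambda>x. \<phi> x * D x)"
proof -
  let ?K = "closure {x. \<phi> x \<noteq> 0}"
  have "continuous_on ?K (\<lambda>x. \<phi> x * D x)"
    using \<phi> D by (intro continuous_intros) (auto simp: test_function_def intro: continuous_on_subset smooth_imp_continuous)
  moreover have "compact ?K" using \<phi> by (simp add: test_function_def)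
  ultimately have "integrable lborel (\<lambda>x. indicator ?K x *\<^sub>R (\<phi> x * D x))"
    using borel_integrable_compact by blast
  moreover have "(\<lambda>x. indicator ?K x *\<^sub>R (\<phi> x * D x)) = (\<lambda>x. \<phi> x * D x)"
  proof
    fix x show "indicator ?K x *\<^sub>R (\<phi> x * D x) = \<phi> x * D x"
      using closure_subset[of "{x. \<phi> x \<noteq> 0}"] by (cases "\<phi> x = 0") (auto simp: indicator_def)
  qed
  ultimately show ?thesis by (simp only:)
qed

text \<open>If \<open>D\<close> exceeds \<open>E\<close> at a point, it does so on a ball by
  continuity, and a test function positive exactly on that ball separates the two integrals. One
  inequality is proved for arbitrary densities and then used in both directions.\<close>

lemma has_expected_density_unique:
  assumes D: "has_expected_density M \<mu> D" and E: "has_expected_density M \<mu> E"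
  shows "D = E"
proof -
  have le: "D x \<le> E x" if D: "has_expected_density M \<mu> D" and E: "has_expected_density M \<mu> E" for D E x
  proof (rule ccontr)
    assume "\<not> D x \<le> E x"
    have cont: "continuous_on UNIV D" "continuous_on UNIV E"
      using D E by (auto simp: has_expected_density_def)
    then have "open {y. E y < D y}"
      by (rule open_Collect_less[rotated])
    then obtain e where e: "e > 0" "ball x e \<subseteq> {y. E y < D y}"
      using \<open>\<not> D x \<le> E x\<close> by (metis mem_Collect_eq not_le open_contains_ball)
    obtain \<phi> where \<phi>: "test_function \<phi>" "\<And>z. \<phi> z \<ge> 0" "\<And>z. \<phi> z > 0 \<longleftrightarrow> z \<in> ball x e"
      using ex_test_function_ball[OF e(1)] by metis
    have i: "integrable lborel (\<lambda>x. \<phi> x * D x)" "integrable lborel (\<lambda>x. \<phi> x * E x)"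
      using \<phi>(1) cont integrable_test_function_mult by blast+
    have "(LINT x|lborel. \<phi> x * D x) = (LINT x|lborel. \<phi> x * E x)"
      using D E \<phi>(1) by (auto simp: has_expected_density_def)
    then have "(LINT x|lborel. \<phi> x * D x - \<phi> x * E x) = 0"
      using i by simp
    moreover have nn: "\<phi> y * D y - \<phi> y * E y \<ge> 0" for y
    proof (cases "y \<in> ball x e")
      case True
      then show ?thesis using e(2) \<phi>(2)[of y] by (auto intro!: mult_left_mono)
    next
      case False
      then have "\<phi> y = 0" using \<phi>(2,3)[of y] by auto
      then show ?thesis by simp
    qed
    ultimately have "AE y in lborel. \<phi> y * D y - \<phi> y * E y = 0"
      using i by (subst (asm) integral_nonneg_eq_0_iff_AE) auto
    then have "AE y in lborel. y \<notin> ball x e"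
    proof eventually_elim
      case (elim y)
      show ?case
      proof
        assume y: "y \<in> ball x e"
        then have "\<phi> y * E y < \<phi> y * D y" using e(2) \<phi>(3)[of y] by (auto intro!: mult_strict_left_mono)
        with elim show False by linarith
      qed
    qed
    then have "emeasure lborel (ball x e) = 0"
      by (subst (asm) AE_iff_measurable[where N="ball x e"]) auto
    then show False using open_not_negligible[of "ball x e"] e(1)
      by (simp add: negligible_iff_null_sets null_sets_completion_iff null_sets_def)
  qed
  show ?thesis using le[OF D E] le[OF E D] by (intro ext antisym)
qed

section \<open>Measurability of sums over zeros\<close>

text \<open>The quantifier over the uncountable set \<open>K\<close> becomes countable: a zero
  exists iff |q| takes arbitrarily small values on a countable dense subset, because |q| attains its
  infimum on a compact set.\<close>

lemma sets_Collect_ex_zero_compact: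
  fixes q :: "'a \<Rightarrow> complex \<Rightarrow> complex"
  assumes K: "compact K"
    and cont: "\<And>x. x \<in> space N \<Longrightarrow> continuous_on K (q x)"
    and meas [measurable]: "\<And>z. (\<lambda>x. q x z) \<in> borel_measurable N"
  shows "{x \<in> space N. \<exists>z\<in>K. q x z = 0} \<in> sets N"
proof -
  obtain T where T: "countable T" "T \<subseteq> K" "K \<subseteq> closure T" by (rule separable)
  have "(\<exists>z\<in>K. q x z = 0) \<longleftrightarrow> (\<forall>i::nat. \<exists>d\<in>T. cmod (q x d) < inverse (Suc i))" if x: "x \<in> space N" for x
  proof
    assume "\<exists>z\<in>K. q x z = 0"
    then obtain z where z: "z \<in> K" "q x z = 0" by blast
    show "\<forall>i::nat. \<exists>d\<in>T. cmod (q x d) < inverse (Suc i)"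
    proof
      fix i
      obtain r where r: "r > 0" "\<And>y. y \<in> K \<Longrightarrow> dist y z < r \<Longrightarrow> dist (q x y) (q x z) < inverse (Suc i)"
        using cont[OF x] z(1) unfolding continuous_on_iff by (metis inverse_positive_iff_positive of_nat_0_less_iff zero_less_Suc)
      obtain d where "d \<in> T" "dist d z < r"
        using z(1) T(3) r(1) by (meson closure_approachable subsetD)
      then show "\<exists>d\<in>T. cmod (q x d) < inverse (Suc i)"
        using r(2)[of d] T(2) z(2) by (intro bexI[of _ d]) auto
    qed
  next
    assume *: "\<forall>i::nat. \<exists>d\<in>T. cmod (q x d) < inverse (Suc i)"
    then have "K \<noteq> {}" using T(2) by blast
    moreover have "continuous_on K (\<lambda>z. cmod (q x z))" using cont[OF x] by (intro continuous_intros)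
    ultimately obtain z where z: "z \<in> K" "\<And>y. y \<in> K \<Longrightarrow> cmod (q x z) \<le> cmod (q x y)"
      using continuous_attains_inf[OF K] by metis
    have "q x z = 0"
    proof (rule ccontr)
      assume "q x z \<noteq> 0"
      then obtain i where "inverse (real (Suc i)) < cmod (q x z)" using reals_Archimedean by (metis zero_less_norm_iff)
      moreover obtain d where "d \<in> T" "cmod (q x d) < inverse (Suc i)" using * by blast
      ultimately show False using z(2)[of d] T(2) by force
    qed
    then show "\<exists>z\<in>K. q x z = 0" using z(1) by blast
  qed
  then have eq: "{x \<in> space N. \<exists>z\<in>K. q x z = 0} =
    {x \<in> space N. \<forall>i::nat. \<exists>d\<in>T. cmod (q x d) < inverse (Suc i)}" by blast
  show ?thesis unfolding eq using T(1) by measurable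
qed

section \<open>Dyadic cells: half-open squares of side 1/2^m\<close>

definition cell_index :: "nat \<Rightarrow> complex \<Rightarrow> int \<times> int" where
  "cell_index m z = (\<lfloor>2 ^ m * Re z\<rfloor>, \<lfloor>2 ^ m * Im z\<rfloor>)"

definition cell_corner :: "nat \<Rightarrow> int \<times> int \<Rightarrow> complex" where
  "cell_corner m k = Complex (of_int (fst k) / 2 ^ m) (of_int (snd k) / 2 ^ m)"

text \<open>Half-open cells partition the plane but are not compact; exhausting a cell by closed
  boxes brings the criterion for zeros in compact sets to bear.\<close>

lemma cell_eq_UN_cbox:
  "{z. cell_index m z = k} = (\<Union>i::nat. cbox (cell_corner m k)
    (Complex ((of_int (fst k) + 1 - inverse (Suc i)) / 2 ^ m) ((of_int (snd k) + 1 - inverse (Suc i)) / 2 ^ m)))"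
  (is "?L = (\<Union>i. ?C i)")
proof (intro equalityI subsetI)
  fix z assume "z \<in> ?L"
  then have *: "of_int (fst k) \<le> 2 ^ m * Re z" "2 ^ m * Re z < of_int (fst k) + 1"
      "of_int (snd k) \<le> 2 ^ m * Im z" "2 ^ m * Im z < of_int (snd k) + 1"
    by (auto simp: cell_index_def)
  \<comment> \<open>The smaller of the distances to the two excluded edges, in units of the cell
    side.\<close>
  define d where "d = min (of_int (fst k) + 1 - 2 ^ m * Re z) (of_int (snd k) + 1 - 2 ^ m * Im z)"
  have "d > 0" using * by (simp add: d_def)
  then obtain i where "inverse (real (Suc i)) < d" using reals_Archimedean by blast
  define e where "e = inverse (real (Suc i))"
  have i: "e < d" unfolding e_def by fact
  have "z \<in> ?C i"
    unfolding e_def[symmetric] using * i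
    by (auto simp: in_cbox_complex_iff cell_corner_def d_def pos_le_divide_eq pos_divide_le_eq mult.commute)
  then show "z \<in> (\<Union>i. ?C i)" by blast
next
  fix z assume "z \<in> (\<Union>i. ?C i)"
  then obtain i where i: "z \<in> ?C i" by blast
  define e where "e = inverse (real (Suc i))"
  have "e > 0" by (simp add: e_def)
  with i show "z \<in> ?L"
    unfolding e_def[symmetric]
    by (auto simp: in_cbox_complex_iff cell_corner_def cell_index_def pos_le_divide_eq pos_divide_le_eq
        mult.commute floor_eq_iff prod_eq_iff)
qed

lemma cell_corner_index_tendsto: "(\<lambda>m. cell_corner m (cell_index m z)) \<longlonglongrightarrow> z"
proof -
  have "(\<lambda>m. of_int \<lfloor>2 ^ m * x\<rfloor> / 2 ^ m) \<longlonglongrightarrow> x" for x :: real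
  proof (rule real_tendsto_sandwich)
    show "\<forall>\<^sub>F m in sequentially. x - (1/2) ^ m \<le> of_int \<lfloor>2 ^ m * x\<rfloor> / 2 ^ m"
    proof (intro always_eventually allI)
      fix m show "x - (1/2) ^ m \<le> of_int \<lfloor>2 ^ m * x\<rfloor> / 2 ^ m"
        using divide_right_mono[OF less_imp_le[OF real_of_int_floor_gt_diff_one[of "2 ^ m * x"]], of "2 ^ m"]
        by (simp add: diff_divide_distrib power_one_over)
    qed
    show "\<forall>\<^sub>F m in sequentially. of_int \<lfloor>2 ^ m * x\<rfloor> / 2 ^ m \<le> x"
      by (intro always_eventually allI) (simp add: field_simps)
    have "(\<lambda>m. x - (1/2) ^ m) \<longlonglongrightarrow> x - 0" by (intro tendsto_intros) simp
    then show "(\<lambda>m. x - (1/2) ^ m) \<longlonglongrightarrow> x" by simp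
  qed simp
  from tendsto_Complex[OF this[of "Re z"] this[of "Im z"]] show ?thesis
    by (simp add: cell_corner_def cell_index_def)
qed

text \<open>No measurable choice of zeros is made. The sum is approximated by summing
  \<open>f\<close> at the corners of those cells that contain a zero. If the zero set is finite,
  each zero eventually has a cell of its own and the corners converge to the zeros.\<close>

lemma borel_measurable_sum_zeros:
  fixes q :: "'a \<Rightarrow> complex \<Rightarrow> complex" and f :: "'a \<Rightarrow> complex \<Rightarrow> real"
  assumes cont: "\<And>x. x \<in> space N \<Longrightarrow> continuous_on UNIV (q x)"
    and meas [measurable]: "\<And>z. (\<lambda>x. q x z) \<in> borel_measurable N"
    and fcont: "\<And>x. x \<in> space N \<Longrightarrow> continuous_on UNIV (f x)"
    and fmeas [measurable]: "\<And>z. (\<lambda>x. f x z) \<in> borel_measurable N"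
    and fin [measurable]: "Measurable.pred N (\<lambda>x. finite {z. q x z = 0})"
  shows "(\<lambda>x. \<Sum>z | q x z = 0. f x z) \<in> borel_measurable N"
proof -
  have "{x \<in> space N. \<exists>z. cell_index m z = k \<and> q x z = 0} \<in> sets N" for m k
  proof -
    have "{x \<in> space N. \<exists>z\<in>cbox a b. q x z = 0} \<in> sets N" for a b
      by (rule sets_Collect_ex_zero_compact) (use cont in \<open>auto intro: continuous_on_subset\<close>)
    then have "(\<Union>i. {x \<in> space N. \<exists>z\<in>cbox a (b i). q x z = 0}) \<in> sets N" for a and b :: "nat \<Rightarrow> complex"
      by blast
    moreover have "{x \<in> space N. \<exists>z. cell_index m z = k \<and> q x z = 0} =
      {x \<in> space N. \<exists>z\<in>{z. cell_index m z = k}. q x z = 0}" by auto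
    moreover have "{x \<in> space N. \<exists>z\<in>(\<Union>i. C i). q x z = 0} = (\<Union>i. {x \<in> space N. \<exists>z\<in>C i. q x z = 0})"
      for C :: "nat \<Rightarrow> complex set" by auto
    ultimately show ?thesis unfolding cell_eq_UN_cbox by simp
  qed
  then have [measurable]: "Measurable.pred N (\<lambda>x. \<exists>z. cell_index m z = k \<and> q x z = 0)" for m k
    by (simp add: pred_def)
  \<comment> \<open>A coordinate \<open>y\<close> with |y| <= 2^m has cell index at most 4^m in
    absolute value, so each fixed zero eventually falls into this finite window of cells.\<close>
  define R where "R m = {- (4 ^ m)..(4::int) ^ m} \<times> {- (4 ^ m)..(4::int) ^ m}" for m :: nat
  \<comment> \<open>The value 0 for infinite zero sets agrees with the default value of the limiting
    sum.\<close>
  define S where "S m x = (if finite {z. q x z = 0} then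
    (\<Sum>k\<in>R m. if \<exists>z. cell_index m z = k \<and> q x z = 0 then f x (cell_corner m k) else 0) else 0)" for m x
  show ?thesis
  proof (rule borel_measurable_LIMSEQ_real)
    show "S m \<in> borel_measurable N" for m unfolding S_def by measurable
    fix x assume x: "x \<in> space N"
    let ?Z = "{z. q x z = 0}"
    show "(\<lambda>m. S m x) \<longlonglongrightarrow> (\<Sum>z\<in>?Z. f x z)"
    proof (cases "finite ?Z")
      case False
      then show ?thesis by (simp add: S_def)
    next
      case True
      have "\<forall>\<^sub>F m in sequentially. cell_index m z \<noteq> cell_index m z'" if "z \<noteq> z'" for z z'
      proof -
        have "(\<lambda>m. cell_corner m (cell_index m z) - cell_corner m (cell_index m z')) \<longlonglongrightarrow> z - z'"
          by (intro tendsto_intros cell_corner_index_tendsto)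
        then have "\<forall>\<^sub>F m in sequentially. cell_corner m (cell_index m z) - cell_corner m (cell_index m z') \<noteq> 0"
          by (rule tendsto_imp_eventually_ne) (use that in simp)
        then show ?thesis by (rule eventually_mono) auto
      qed
      then have "\<forall>\<^sub>F m in sequentially. \<forall>z\<in>?Z. \<forall>z'\<in>?Z. z \<noteq> z' \<longrightarrow> cell_index m z \<noteq> cell_index m z'"
        using True by (intro eventually_ball_finite ballI) (auto simp: eventually_mono)
      then have inj: "\<forall>\<^sub>F m in sequentially. inj_on (cell_index m) ?Z"
        by (rule eventually_mono) (auto simp: inj_on_def)
      have bound: "\<forall>\<^sub>F m in sequentially. \<lfloor>2 ^ m * y\<rfloor> \<in> {- (4 ^ m)..4 ^ m}" for y :: real
      proof -
        have "\<forall>\<^sub>F m in sequentially. \<bar>y\<bar> \<le> 2 ^ m"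
          using filterlim_realpow_sequentially_gt1[of "2::real"]
          by (auto simp: filterlim_at_infinity[OF order_refl] eventually_at_top_dense elim: allE[of _ "\<bar>y\<bar>"])
        then show ?thesis
        proof (rule eventually_mono)
          fix m :: nat assume "\<bar>y\<bar> \<le> 2 ^ m"
          then have "\<bar>2 ^ m * y\<bar> \<le> 2 ^ m * 2 ^ m" by (simp add: abs_mult)
          then have "\<bar>2 ^ m * y\<bar> \<le> 4 ^ m" by (simp flip: power_mult_distrib)
          then show "\<lfloor>2 ^ m * y\<rfloor> \<in> {- (4 ^ m)..4 ^ m}"
            by (auto simp: le_floor_iff floor_le_iff abs_le_iff)
        qed
      qed
      have "\<forall>\<^sub>F m in sequentially. cell_index m z \<in> R m" for z
        using eventually_conj[OF bound[of "Re z"] bound[of "Im z"]]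
        by (rule eventually_mono) (auto simp: R_def cell_index_def)
      then have "\<forall>\<^sub>F m in sequentially. \<forall>z\<in>?Z. cell_index m z \<in> R m"
        using True by (intro eventually_ball_finite) auto
      with inj have ev: "\<forall>\<^sub>F m in sequentially. (\<Sum>z\<in>?Z. f x (cell_corner m (cell_index m z))) = S m x"
      proof eventually_elim
        case (elim m)
        have "S m x = (\<Sum>k\<in>cell_index m ` ?Z. f x (cell_corner m k))"
          unfolding S_def using True
        proof (simp, intro sum.mono_neutral_cong_right ballI)
          show "finite (R m)" by (simp add: R_def)
          show "cell_index m ` ?Z \<subseteq> R m" using elim(2) by blast
          fix k assume "k \<in> R m - cell_index m ` ?Z"
          then have "\<not> (\<exists>z. cell_index m z = k \<and> q x z = 0)" by blast
          then show "(if \<exists>z. cell_index m z = k \<and> q x z = 0 then f x (cell_corner m k) else 0) = 0" by (rule if_not_P)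
        qed auto
        also have "\<dots> = (\<Sum>z\<in>?Z. f x (cell_corner m (cell_index m z)))"
          using elim(1) by (simp add: sum.reindex)
        finally show ?case by simp
      qed
      have "(\<lambda>m. \<Sum>z\<in>?Z. f x (cell_corner m (cell_index m z))) \<longlonglongrightarrow> (\<Sum>z\<in>?Z. f x z)"
        using fcont[OF x] by (intro tendsto_sum continuous_on_tendsto_compose[OF _ cell_corner_index_tendsto]) auto
      then show ?thesis by (rule Lim_transform_eventually[OF _ ev])
    qed
  qed
qed

section \<open>Linear forms in complex Gaussian variables\<close>

definition cgauss :: "complex \<Rightarrow> real" where
  "cgauss z = 1 / pi * exp (- (cmod z)\<^sup>2)"

definition cgauss_measure :: "complex measure" where
  "cgauss_measure = density lborel (\<lambda>z. ennreal (cgauss z))"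

lemma cgauss_nonneg [simp]: "cgauss z \<ge> 0" by (simp add: cgauss_def)

lemma cgauss_measurable [measurable]: "cgauss \<in> borel_measurable borel"
  unfolding cgauss_def by measurable

lemma sets_cgauss_measure [simp, measurable_cong]: "sets cgauss_measure = sets borel"
  by (simp add: cgauss_measure_def)

lemma nn_integral_cgauss_measure:
  assumes [measurable]: "F \<in> borel_measurable borel"
  shows "(\<integral>\<^sup>+b. F b \<partial>cgauss_measure) = (\<integral>\<^sup>+b. ennreal (cgauss b) * F b \<partial>lborel)"
  unfolding cgauss_measure_def by (subst nn_integral_density) auto

lemma nn_integral_complex_affine:
  fixes F :: "complex \<Rightarrow> ennreal"
  assumes [measurable]: "F \<in> borel_measurable borel" and c: "c > 0"
  shows "(\<integral>\<^sup>+b. F b \<partial>lborel) = ennreal (c\<^sup>2) * (\<integral>\<^sup>+b. F (t + c *\<^sub>R b) \<partial>lborel)"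
proof -
  have "(\<Sum>j\<in>Basis. (c * (x \<bullet> j)) *\<^sub>R j) = c *\<^sub>R x" for x :: complex
    by (simp add: Basis_complex_def complex_eq_iff)
  then have L: "lborel = density (distr lborel borel (\<lambda>x::complex. t + c *\<^sub>R x)) (\<lambda>_. ennreal (c\<^sup>2))"
    using lborel_affine_euclidean[of "\<lambda>_::complex. c" t] c by (simp add: power2_eq_square)
  have "(\<integral>\<^sup>+b. F b \<partial>lborel) = (\<integral>\<^sup>+b. F b \<partial>density (distr lborel borel (\<lambda>x::complex. t + c *\<^sub>R x)) (\<lambda>_. ennreal (c\<^sup>2)))"
    by (subst L) (rule refl)
  then show ?thesis
    by (simp add: nn_integral_density nn_integral_distr nn_integral_cmult)
qed

lemma nn_integral_complex_translate:
  fixes F :: "complex \<Rightarrow> ennreal"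
  assumes [measurable]: "F \<in> borel_measurable borel"
  shows "(\<integral>\<^sup>+b. F b \<partial>lborel) = (\<integral>\<^sup>+b. F (t + b) \<partial>lborel)"
  using nn_integral_complex_affine[of F 1 t] by simp

text \<open>The disc of radius \<open>sqrt a\<close> has area \<open>pi * a\<close>, so |z|^2 pushes
  planar Lebesgue measure forward to \<open>pi\<close> times Lebesgue measure on the half-line. This
  replaces polar coordinates, both for Gaussian moments and for the final radial integral.\<close>

lemma nn_integral_cmod_power2:
  fixes f :: "real \<Rightarrow> ennreal"
  assumes [measurable]: "f \<in> borel_measurable borel"
  shows "(\<integral>\<^sup>+z. f ((cmod z)\<^sup>2) \<partial>lborel) = ennreal pi * (\<integral>\<^sup>+t. f t * indicator {0..} t \<partial>lborel)"
proof -
  let ?M = "distr lborel borel (\<lambda>z::complex. (cmod z)\<^sup>2)"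
  let ?N = "density lborel (\<lambda>t::real. ennreal pi * indicator {0..} t)"
  have M: "emeasure ?M {..a} = ennreal pi * ennreal a" for a
  proof (cases "a \<ge> 0")
    case True
    have "(\<lambda>z. (cmod z)\<^sup>2) -` {..a} = cball 0 (sqrt a)"
      using True by (auto simp: real_le_rsqrt dest: sqrt_ge_absD)
        (metis norm_ge_zero power_mono real_sqrt_pow2)
    then have "emeasure ?M {..a} = emeasure lborel (cball (0::complex) (sqrt a))"
      by (subst emeasure_distr) auto
    also have "\<dots> = ennreal pi * ennreal a"
      using True by (subst emeasure_cball) (auto simp: unit_ball_vol_2 ennreal_mult)
    finally show ?thesis .
  next
    case False
    then have "(\<lambda>z. (cmod z)\<^sup>2) -` {..a} = {}"
      by (auto simp: not_le) (metis less_le_trans not_less zero_le_power2)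
    then show ?thesis using False by (subst emeasure_distr) (auto simp: ennreal_neg)
  qed
  have N: "emeasure ?N {..a} = ennreal pi * ennreal a" for a
  proof -
    have "emeasure ?N {..a} = (\<integral>\<^sup>+t. ennreal pi * indicator {0..a} t \<partial>lborel)"
      by (subst emeasure_density) (auto intro!: nn_integral_cong simp: indicator_def)
    then show ?thesis by (cases "a \<ge> 0") (auto simp: nn_integral_cmult ennreal_neg)
  qed
  have "?M = ?N"
  proof (rule measure_eqI_generator_eq[where E="range atMost" and \<Omega>=UNIV and A="\<lambda>i. {..real i}"])
    show "Int_stable (range (atMost :: real \<Rightarrow> _))"
      by (auto simp: Int_stable_def Int_atMost)
    show "sets ?M = sigma_sets UNIV (range atMost)" "sets ?N = sigma_sets UNIV (range atMost)"
      by (simp_all add: borel_eq_atMost)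
    show "(\<Union>i. {..real i}) = UNIV" by (auto intro: real_arch_simple)
    show "emeasure ?M {..real i} \<noteq> \<infinity>" for i by (simp add: M flip: ennreal_mult)
  qed (auto simp: M N)
  have "(\<integral>\<^sup>+z. f ((cmod z)\<^sup>2) \<partial>lborel) = (\<integral>\<^sup>+t. f t \<partial>?M)"
    by (subst nn_integral_distr) auto
  also have "\<dots> = (\<integral>\<^sup>+t. ennreal pi * (f t * indicator {0..} t) \<partial>lborel)"
    unfolding \<open>?M = ?N\<close> by (subst nn_integral_density) (auto simp: ac_simps)
  finally show ?thesis by (simp add: nn_integral_cmult)
qed

text \<open>Under this measure |b|^2 has the standard exponential law, whose moments are Gamma
  integrals. The cases \<open>k = 0\<close> and \<open>k = 1\<close> give the total mass and the
  variance.\<close>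

lemma nn_integral_cgauss_cmod_power:
  "(\<integral>\<^sup>+b. ennreal ((cmod b)\<^sup>2 ^ k) \<partial>cgauss_measure) = ennreal (fact k)"
proof -
  have "(\<integral>\<^sup>+b. ennreal ((cmod b)\<^sup>2 ^ k) \<partial>cgauss_measure) =
     (\<integral>\<^sup>+b. ennreal (1 / pi * exp (- (cmod b)\<^sup>2)) * ennreal ((cmod b)\<^sup>2 ^ k) \<partial>lborel)"
    by (subst nn_integral_cgauss_measure) (auto simp: cgauss_def)
  also have "\<dots> = ennreal pi * (\<integral>\<^sup>+t. ennreal (1 / pi * exp (- t)) * ennreal (t ^ k) * indicator {0..} t \<partial>lborel)"
    by (rule nn_integral_cmod_power2) measurable
  also have "\<dots> = (\<integral>\<^sup>+t. ennreal pi * (ennreal (1 / pi * exp (- t)) * ennreal (t ^ k) * indicator {0..} t) \<partial>lborel)"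
    by (rule nn_integral_cmult[symmetric]) measurable
  also have "\<dots> = (\<integral>\<^sup>+t. ennreal (t ^ k * exp (- t)) * indicator {0..} t \<partial>lborel)"
    by (intro nn_integral_cong) (auto simp: indicator_def simp flip: ennreal_mult)
  also have "\<dots> = ennreal (fact k)"
    by (simp add: nn_intergal_power_times_exp_Ici)
  finally show ?thesis .
qed

lemma prob_space_cgauss_measure: "prob_space cgauss_measure"
  using nn_integral_cgauss_cmod_power[of 0] by (intro prob_spaceI) simp

text \<open>The cross term is removed by symmetry under b -> -b: adding the integrals for
  \<open>B\<close> and \<open>- B\<close> and applying the parallelogram law leaves only the two
  squared moduli.\<close>

lemma nn_integral_cgauss_cmod_affine:
  "(\<integral>\<^sup>+b. ennreal ((cmod (A + B * b))\<^sup>2 + \<delta>) \<partial>cgauss_measure) = ennreal ((cmod A)\<^sup>2 + (cmod B)\<^sup>2 + \<delta>)"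
  if "\<delta> \<ge> 0"
proof -
  interpret prob_space cgauss_measure by (rule prob_space_cgauss_measure)
  have uminus: "distr cgauss_measure borel uminus = cgauss_measure"
  proof -
    have "distr (lborel :: complex measure) borel uminus = lborel"
    proof -
      have "(\<Sum>j\<in>Basis. (- (x \<bullet> j)) *\<^sub>R j) = - x" for x :: complex
        by (simp add: Basis_complex_def complex_eq_iff)
      then show ?thesis
        using lborel_affine_euclidean[of "\<lambda>_::complex. - 1" 0] by (simp add: density_1)
    qed
    then show ?thesis
      unfolding cgauss_measure_def
      by (subst (2) \<open>distr lborel borel uminus = lborel\<close>[symmetric], subst density_distr)
        (auto simp: cgauss_def)
  qed
  let ?I = "\<lambda>B. \<integral>\<^sup>+b. ennreal ((cmod (A + B * b))\<^sup>2 + \<delta>) \<partial>cgauss_measure"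
  have "?I (- B) = (\<integral>\<^sup>+b. ennreal ((cmod (A + B * b))\<^sup>2 + \<delta>) \<partial>distr cgauss_measure borel uminus)"
    by (subst nn_integral_distr) auto
  then have "?I (- B) = ?I B" unfolding uminus .
  then have "2 * ?I B = ?I B + ?I (- B)" by (simp add: mult_2)
  also have "\<dots> = (\<integral>\<^sup>+b. ennreal ((cmod (A + B * b))\<^sup>2 + \<delta>) + ennreal ((cmod (A + - B * b))\<^sup>2 + \<delta>) \<partial>cgauss_measure)"
    by (rule nn_integral_add[symmetric]) measurable
  also have "\<dots> = (\<integral>\<^sup>+b. ennreal (2 * ((cmod A)\<^sup>2 + \<delta>)) + ennreal (2 * (cmod B)\<^sup>2) * ennreal ((cmod b)\<^sup>2 ^ 1) \<partial>cgauss_measure)"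
  proof (rule nn_integral_cong)
    fix b
    have "(cmod (A + B * b))\<^sup>2 + (cmod (A + - B * b))\<^sup>2 = 2 * (cmod A)\<^sup>2 + 2 * (cmod B)\<^sup>2 * (cmod b)\<^sup>2"
      unfolding cmod_power2 by (simp, algebra)
    then show "ennreal ((cmod (A + B * b))\<^sup>2 + \<delta>) + ennreal ((cmod (A + - B * b))\<^sup>2 + \<delta>) =
      ennreal (2 * ((cmod A)\<^sup>2 + \<delta>)) + ennreal (2 * (cmod B)\<^sup>2) * ennreal ((cmod b)\<^sup>2 ^ 1)"
      using that by (simp add: algebra_simps flip: ennreal_plus ennreal_mult)
  qed
  also have "\<dots> = (\<integral>\<^sup>+b. ennreal (2 * ((cmod A)\<^sup>2 + \<delta>)) \<partial>cgauss_measure) +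
     (\<integral>\<^sup>+b. ennreal (2 * (cmod B)\<^sup>2) * ennreal ((cmod b)\<^sup>2 ^ 1) \<partial>cgauss_measure)"
    by (rule nn_integral_add) measurable
  also have "\<dots> = ennreal (2 * ((cmod A)\<^sup>2 + \<delta>)) + ennreal (2 * (cmod B)\<^sup>2)"
    using nn_integral_cgauss_cmod_power[of 1]
    by (subst nn_integral_cmult) (simp_all add: emeasure_space_1)
  also have "\<dots> = ennreal (2 * ((cmod A)\<^sup>2 + (cmod B)\<^sup>2 + \<delta>))"
    using that by (simp add: algebra_simps flip: ennreal_plus)
  also have "\<dots> = 2 * ennreal ((cmod A)\<^sup>2 + (cmod B)\<^sup>2 + \<delta>)"
    using that by (simp add: ennreal_mult)
  finally show ?thesis by (simp add: ennreal_mult_cancel_left)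
qed

text \<open>The matrix with rows (c, -s) and (cnj s, c) is unitary. Applied to (\<zeta>, b), its
  first component is the rescaled residual (x - b' u) / \<alpha>, where b' is its second
  component.\<close>

lemma unitary_rotation:
  fixes \<alpha> \<alpha>' :: real and u x b :: complex
  assumes \<alpha>: "\<alpha> > 0" and \<alpha>': "\<alpha>' > 0" "\<alpha>'\<^sup>2 = \<alpha>\<^sup>2 + (cmod u)\<^sup>2"
  defines "c \<equiv> complex_of_real (\<alpha> / \<alpha>')" and "s \<equiv> u / of_real \<alpha>'" and "\<zeta> \<equiv> x / of_real \<alpha>'"
  shows "(x - (cnj s * \<zeta> + c * b) * u) / of_real \<alpha> = c * \<zeta> - s * b" (is ?rot)
    and "c * c + s * cnj s = 1" (is ?unit)
    and "(cmod (c * \<zeta> - s * b))\<^sup>2 + (cmod (cnj s * \<zeta> + c * b))\<^sup>2 = (cmod \<zeta>)\<^sup>2 + (cmod b)\<^sup>2" (is ?norm)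
proof -
  have cc: "cnj c = c" by (simp add: c_def)
  have "(\<alpha> / \<alpha>')\<^sup>2 + (cmod s)\<^sup>2 = 1"
  proof -
    have "(\<alpha> / \<alpha>')\<^sup>2 + (cmod s)\<^sup>2 = (\<alpha>\<^sup>2 + (cmod u)\<^sup>2) / \<alpha>'\<^sup>2"
      by (simp add: s_def norm_divide power_divide add_divide_distrib)
    also have "\<dots> = 1" unfolding \<alpha>'(2)[symmetric] using \<alpha>'(1) by simp
    finally show ?thesis .
  qed
  then have "complex_of_real ((\<alpha> / \<alpha>')\<^sup>2 + (cmod s)\<^sup>2) = 1" by simp
  then show cs: ?unit
    unfolding of_real_add complex_norm_square by (simp add: c_def power2_eq_square)
  show ?rot
  proof -
    have x: "x = of_real \<alpha>' * \<zeta>" "u = of_real \<alpha>' * s" and a: "of_real \<alpha> = of_real \<alpha>' * c"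
      using \<alpha>' by (simp_all add: \<zeta>_def s_def c_def)
    have "x - (cnj s * \<zeta> + c * b) * u = of_real \<alpha>' * ((1 - s * cnj s) * \<zeta> - c * b * s)"
      unfolding x by (simp add: algebra_simps)
    also have "1 - s * cnj s = c * c" using cs by (metis add_diff_cancel_right')
    finally have "x - (cnj s * \<zeta> + c * b) * u = of_real \<alpha> * (c * \<zeta> - s * b)"
      unfolding a by (simp add: algebra_simps)
    then show ?thesis using \<alpha> by simp
  qed
  have "complex_of_real ((cmod (c * \<zeta> - s * b))\<^sup>2 + (cmod (cnj s * \<zeta> + c * b))\<^sup>2) =
    (c * c + s * cnj s) * (\<zeta> * cnj \<zeta> + b * cnj b)"
    unfolding of_real_add complex_norm_square by (simp add: algebra_simps cc)
  also have "\<dots> = complex_of_real ((cmod \<zeta>)\<^sup>2 + (cmod b)\<^sup>2)"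
    unfolding cs of_real_add complex_norm_square by simp
  finally show ?norm using of_real_eq_iff by blast
qed

text \<open>One Gaussian variable is absorbed by a unitary rotation of the pair \<open>((x - b * u) / \<alpha>, b)\<close>
  that makes the first component independent of the second.\<close>

lemma cgauss_absorb:
  fixes F :: "complex \<Rightarrow> ennreal" and \<alpha> \<alpha>' :: real and u x :: complex
  assumes [measurable]: "F \<in> borel_measurable borel"
    and \<alpha>: "\<alpha> > 0" and \<alpha>': "\<alpha>' > 0" "\<alpha>'\<^sup>2 = \<alpha>\<^sup>2 + (cmod u)\<^sup>2"
  shows "(\<integral>\<^sup>+b. ennreal (cgauss ((x - b * u) / of_real \<alpha>) / \<alpha>\<^sup>2) * F b \<partial>cgauss_measure) =
    ennreal (cgauss (x / of_real \<alpha>') / \<alpha>'\<^sup>2) *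
    (\<integral>\<^sup>+b. F (cnj u / of_real \<alpha>' * (x / of_real \<alpha>') + of_real (\<alpha> / \<alpha>') * b) \<partial>cgauss_measure)"
proof -
  define c where "c = \<alpha> / \<alpha>'"
  define s where "s = u / of_real \<alpha>'"
  define \<zeta> where "\<zeta> = x / of_real \<alpha>'"
  have c: "c > 0" using \<alpha> \<alpha>' by (simp add: c_def)
  note rot = unitary_rotation(1)[OF \<alpha> \<alpha>', of x, folded c_def s_def \<zeta>_def]
  note nrm = unitary_rotation(3)[OF \<alpha> \<alpha>', of x, folded c_def s_def \<zeta>_def]
  have g2: "cgauss (of_real c * \<zeta> - s * b) * cgauss (cnj s * \<zeta> + of_real c * b) = cgauss \<zeta> * cgauss b" for b
    unfolding cgauss_def using nrm[of b] by (simp add: field_simps flip: exp_add)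
  have "(\<integral>\<^sup>+b. ennreal (cgauss ((x - b * u) / of_real \<alpha>) / \<alpha>\<^sup>2) * F b \<partial>cgauss_measure) =
    (\<integral>\<^sup>+b. ennreal (cgauss b) * (ennreal (cgauss ((x - b * u) / of_real \<alpha>) / \<alpha>\<^sup>2) * F b) \<partial>lborel)"
    by (rule nn_integral_cgauss_measure) measurable
  \<comment> \<open>This completes the square: the shift by \<open>cnj s * \<zeta>\<close> and the
    scaling by \<open>c\<close> put the pair into rotated coordinates. The Jacobian c^2 turns the
    factor 1/\<alpha>^2 into 1/\<alpha>'^2.\<close>
  also have "\<dots> = ennreal (c\<^sup>2) * (\<integral>\<^sup>+b. ennreal (cgauss (cnj s * \<zeta> + of_real c * b)) *
     (ennreal (cgauss (of_real c * \<zeta> - s * b) / \<alpha>\<^sup>2) * F (cnj s * \<zeta> + of_real c * b)) \<partial>lborel)"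
    by (subst nn_integral_complex_affine[OF _ c, where t="cnj s * \<zeta>"])
      (simp_all add: rot[unfolded scaleR_conv_of_real] scaleR_conv_of_real)
  also have "\<dots> = (\<integral>\<^sup>+b. ennreal (c\<^sup>2) * (ennreal (cgauss (cnj s * \<zeta> + of_real c * b)) *
     (ennreal (cgauss (of_real c * \<zeta> - s * b) / \<alpha>\<^sup>2) * F (cnj s * \<zeta> + of_real c * b))) \<partial>lborel)"
    by (rule nn_integral_cmult[symmetric]) measurable
  also have "\<dots> = (\<integral>\<^sup>+b. ennreal (cgauss \<zeta> / \<alpha>'\<^sup>2) * (ennreal (cgauss b) * F (cnj s * \<zeta> + of_real c * b)) \<partial>lborel)"
  proof (rule nn_integral_cong)
    fix b
    have "c\<^sup>2 * (cgauss (cnj s * \<zeta> + of_real c * b) * (cgauss (of_real c * \<zeta> - s * b) / \<alpha>\<^sup>2)) =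
      c\<^sup>2 / \<alpha>\<^sup>2 * (cgauss (of_real c * \<zeta> - s * b) * cgauss (cnj s * \<zeta> + of_real c * b))"
      by simp
    also have "\<dots> = cgauss \<zeta> / \<alpha>'\<^sup>2 * cgauss b"
      unfolding g2 using \<alpha> \<alpha>'(1) by (simp add: c_def power_divide)
    finally show "ennreal (c\<^sup>2) * (ennreal (cgauss (cnj s * \<zeta> + of_real c * b)) *
     (ennreal (cgauss (of_real c * \<zeta> - s * b) / \<alpha>\<^sup>2) * F (cnj s * \<zeta> + of_real c * b))) = 
     ennreal (cgauss \<zeta> / \<alpha>'\<^sup>2) * (ennreal (cgauss b) * F (cnj s * \<zeta> + of_real c * b))"
      by (simp add: mult.assoc[symmetric] flip: ennreal_mult)
  qed
  also have "\<dots> = ennreal (cgauss \<zeta> / \<alpha>'\<^sup>2) * (\<integral>\<^sup>+b. ennreal (cgauss b) * F (cnj s * \<zeta> + of_real c * b) \<partial>lborel)"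
    by (rule nn_integral_cmult) measurable
  also have "(\<integral>\<^sup>+b. ennreal (cgauss b) * F (cnj s * \<zeta> + of_real c * b) \<partial>lborel) =
     (\<integral>\<^sup>+b. F (cnj s * \<zeta> + of_real c * b) \<partial>cgauss_measure)"
    by (rule nn_integral_cgauss_measure[symmetric]) measurable
  finally show ?thesis by (simp add: \<zeta>_def s_def c_def)
qed

text \<open>The coefficients \<open>\<alpha>, \<beta>, \<omega>, \<gamma>0, \<gamma>1\<close> are those of a triangular (Cholesky) factor of the joint
  covariance matrix of the three forms, where the first two carry an additional independent
  Gaussian each; \<open>\<delta>\<close> is the conditional variance of the third form given the others.\<close>

lemma cgauss_three_forms:
  fixes v u w :: "'i \<Rightarrow> complex"
  assumes "finite J"
  shows "\<exists>\<alpha> \<beta> \<omega> \<gamma>0 \<gamma>1 \<delta>. \<alpha> > 0 \<and> \<omega> > 0 \<and> \<delta> \<ge> 0 \<and>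
    \<alpha>\<^sup>2 = 1 + (\<Sum>j\<in>J. (cmod (v j))\<^sup>2) \<and>
    of_real \<alpha> * \<beta> = (\<Sum>j\<in>J. u j * cnj (v j)) \<and>
    (cmod \<beta>)\<^sup>2 + \<omega>\<^sup>2 = 1 + (\<Sum>j\<in>J. (cmod (u j))\<^sup>2) \<and>
    of_real \<alpha> * \<gamma>0 = (\<Sum>j\<in>J. w j * cnj (v j)) \<and>
    \<gamma>0 * cnj \<beta> + of_real \<omega> * \<gamma>1 = (\<Sum>j\<in>J. w j * cnj (u j)) \<and>
    (cmod \<gamma>0)\<^sup>2 + (cmod \<gamma>1)\<^sup>2 + \<delta> = (\<Sum>j\<in>J. (cmod (w j))\<^sup>2) \<and>
    (\<forall>y x \<kappa>. (\<integral>\<^sup>+b. ennreal (cgauss (y - (\<Sum>j\<in>J. b j * v j)) * cgauss (x - (\<Sum>j\<in>J. b j * u j)) *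
        (cmod (\<kappa> + (\<Sum>j\<in>J. b j * w j)))\<^sup>2) \<partial>PiM J (\<lambda>_. cgauss_measure)) =
      ennreal (cgauss (y / of_real \<alpha>) / \<alpha>\<^sup>2 * (cgauss ((x - \<beta> * (y / of_real \<alpha>)) / of_real \<omega>) / \<omega>\<^sup>2 *
        ((cmod (\<kappa> + \<gamma>0 * (y / of_real \<alpha>) + \<gamma>1 * ((x - \<beta> * (y / of_real \<alpha>)) / of_real \<omega>)))\<^sup>2 + \<delta>))))"
  using assms
proof induction
  case empty
  show ?case
    \<comment> \<open>With no variables only the two additional independent Gaussians remain: unit
      variances, zero correlations, and a vanishing third form.\<close>
    by (rule exI[of _ 1], rule exI[of _ 0], rule exI[of _ 1], rule exI[of _ 0], rule exI[of _ 0], rule exI[of _ 0])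
      (simp add: PiM_empty nn_integral_count_space_finite)
next
  case (insert i J)
  interpret prob_space cgauss_measure by (rule prob_space_cgauss_measure)
  interpret product_sigma_finite "\<lambda>_. cgauss_measure" by unfold_locales
  obtain \<alpha> \<omega> \<delta> :: real and \<beta> \<gamma>0 \<gamma>1 :: complex where pos: "\<alpha> > 0" "\<omega> > 0" "\<delta> \<ge> 0"
    and gram: "\<alpha>\<^sup>2 = 1 + (\<Sum>j\<in>J. (cmod (v j))\<^sup>2)"
      "of_real \<alpha> * \<beta> = (\<Sum>j\<in>J. u j * cnj (v j))"
      "(cmod \<beta>)\<^sup>2 + \<omega>\<^sup>2 = 1 + (\<Sum>j\<in>J. (cmod (u j))\<^sup>2)"
      "of_real \<alpha> * \<gamma>0 = (\<Sum>j\<in>J. w j * cnj (v j))"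
      "\<gamma>0 * cnj \<beta> + of_real \<omega> * \<gamma>1 = (\<Sum>j\<in>J. w j * cnj (u j))"
      "(cmod \<gamma>0)\<^sup>2 + (cmod \<gamma>1)\<^sup>2 + \<delta> = (\<Sum>j\<in>J. (cmod (w j))\<^sup>2)"
    and T: "\<And>y x \<kappa>. (\<integral>\<^sup>+b. ennreal (cgauss (y - (\<Sum>j\<in>J. b j * v j)) * cgauss (x - (\<Sum>j\<in>J. b j * u j)) *
        (cmod (\<kappa> + (\<Sum>j\<in>J. b j * w j)))\<^sup>2) \<partial>PiM J (\<lambda>_. cgauss_measure)) =
      ennreal (cgauss (y / of_real \<alpha>) / \<alpha>\<^sup>2 * (cgauss ((x - \<beta> * (y / of_real \<alpha>)) / of_real \<omega>) / \<omega>\<^sup>2 *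
        ((cmod (\<kappa> + \<gamma>0 * (y / of_real \<alpha>) + \<gamma>1 * ((x - \<beta> * (y / of_real \<alpha>)) / of_real \<omega>)))\<^sup>2 + \<delta>)))"
    using insert.IH by blast
  \<comment> \<open>A rank-one update of the triangular factor by the column (\<open>v i\<close>,
    \<open>u i\<close>, \<open>w i\<close>). The first rotation merges \<open>v i\<close> into
    \<alpha> and leaves remainders \<open>u'\<close>, \<open>w'\<close>; the second merges
    \<open>u'\<close> into \<omega> and leaves \<open>w''\<close>, whose squared modulus is added to
    \<delta>.\<close>
  define \<alpha>' where "\<alpha>' = sqrt (\<alpha>\<^sup>2 + (cmod (v i))\<^sup>2)"
  have \<alpha>': "\<alpha>' > 0" "\<alpha>'\<^sup>2 = \<alpha>\<^sup>2 + (cmod (v i))\<^sup>2"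
    using pos by (auto simp: \<alpha>'_def add_pos_nonneg)
  define c where "c = complex_of_real (\<alpha> / \<alpha>')"
  define s where "s = v i / of_real \<alpha>'"
  define \<beta>' where "\<beta>' = c * \<beta> + u i * cnj s"
  define u' where "u' = c * u i - \<beta> * s"
  define \<gamma>0' where "\<gamma>0' = c * \<gamma>0 + w i * cnj s"
  define w' where "w' = c * w i - \<gamma>0 * s"
  define \<omega>' where "\<omega>' = sqrt (\<omega>\<^sup>2 + (cmod u')\<^sup>2)"
  have \<omega>': "\<omega>' > 0" "\<omega>'\<^sup>2 = \<omega>\<^sup>2 + (cmod u')\<^sup>2"
    using pos by (auto simp: \<omega>'_def add_pos_nonneg)
  define d where "d = complex_of_real (\<omega> / \<omega>')"
  define t where "t = u' / of_real \<omega>'"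
  define \<gamma>1' where "\<gamma>1' = d * \<gamma>1 + w' * cnj t"
  define w'' where "w'' = d * w' - \<gamma>1 * t"
  note rot1 = unitary_rotation(1)[OF pos(1) \<alpha>', folded c_def s_def]
  note rot2 = unitary_rotation(1)[OF pos(2) \<omega>', folded d_def t_def]
  have cs: "c * c + s * cnj s = 1" by (rule unitary_rotation(2)[OF pos(1) \<alpha>', folded c_def s_def])
  have dt: "d * d + t * cnj t = 1" by (rule unitary_rotation(2)[OF pos(2) \<omega>', folded d_def t_def])
  have cnjc: "cnj c = c" "cnj d = d" by (simp_all add: c_def d_def)
  have \<alpha>'c: "of_real \<alpha>' * c = of_real \<alpha>" "of_real \<alpha>' * s = v i" "of_real \<alpha>' * cnj s = cnj (v i)"
    using \<alpha>'(1) by (simp_all add: c_def s_def)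
  have \<omega>'d: "of_real \<omega>' * d = of_real \<omega>" "of_real \<omega>' * t = u'" "of_real \<omega>' * cnj t = cnj u'"
    using \<omega>'(1) by (simp_all add: d_def t_def)
  \<comment> \<open>Unitary rotations preserve norms and inner products of the rows, which is what
    carries the Gram relations through the update.\<close>
  have norm_rot: "(cmod (c * p + q * cnj s))\<^sup>2 + (cmod (c * q - p * s))\<^sup>2 = (cmod p)\<^sup>2 + (cmod q)\<^sup>2" for p q
  proof -
    have "complex_of_real ((cmod (c * p + q * cnj s))\<^sup>2 + (cmod (c * q - p * s))\<^sup>2) =
      (c * c + s * cnj s) * (p * cnj p + q * cnj q)"
      unfolding of_real_add complex_norm_square by (simp add: algebra_simps cnjc)
    also have "\<dots> = complex_of_real ((cmod p)\<^sup>2 + (cmod q)\<^sup>2)"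
      unfolding cs of_real_add complex_norm_square by simp
    finally show ?thesis using of_real_eq_iff by blast
  qed
  have norm_rot': "(cmod (d * p + q * cnj t))\<^sup>2 + (cmod (d * q - p * t))\<^sup>2 = (cmod p)\<^sup>2 + (cmod q)\<^sup>2" for p q
  proof -
    have "complex_of_real ((cmod (d * p + q * cnj t))\<^sup>2 + (cmod (d * q - p * t))\<^sup>2) =
      (d * d + t * cnj t) * (p * cnj p + q * cnj q)"
      unfolding of_real_add complex_norm_square by (simp add: algebra_simps cnjc)
    also have "\<dots> = complex_of_real ((cmod p)\<^sup>2 + (cmod q)\<^sup>2)"
      unfolding dt of_real_add complex_norm_square by simp
    finally show ?thesis using of_real_eq_iff by blast
  qed
  have cross_rot: "(c * p + q * cnj s) * cnj (c * p' + q' * cnj s) + (c * q - p * s) * cnj (c * q' - p' * s) =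
      p * cnj p' + q * cnj q'" for p q p' q'
  proof -
    have "(c * p + q * cnj s) * cnj (c * p' + q' * cnj s) + (c * q - p * s) * cnj (c * q' - p' * s) =
      (c * c + s * cnj s) * (p * cnj p' + q * cnj q')"
      by (simp add: algebra_simps cnjc)
    then show ?thesis by (simp add: cs)
  qed
  have G1: "\<alpha>'\<^sup>2 = 1 + (\<Sum>j\<in>insert i J. (cmod (v j))\<^sup>2)"
    using insert.hyps gram(1) \<alpha>'(2) by simp
  have G2: "of_real \<alpha>' * \<beta>' = (\<Sum>j\<in>insert i J. u j * cnj (v j))"
  proof -
    have "of_real \<alpha>' * \<beta>' = (of_real \<alpha>' * c) * \<beta> + u i * (of_real \<alpha>' * cnj s)"
      by (simp add: \<beta>'_def algebra_simps)
    then show ?thesis unfolding \<alpha>'c using insert.hyps gram(2) by simp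
  qed
  have G3: "(cmod \<beta>')\<^sup>2 + \<omega>'\<^sup>2 = 1 + (\<Sum>j\<in>insert i J. (cmod (u j))\<^sup>2)"
    using insert.hyps gram(3) \<omega>'(2) norm_rot[of \<beta> "u i"] by (simp add: \<beta>'_def u'_def)
  have G4: "of_real \<alpha>' * \<gamma>0' = (\<Sum>j\<in>insert i J. w j * cnj (v j))"
  proof -
    have "of_real \<alpha>' * \<gamma>0' = (of_real \<alpha>' * c) * \<gamma>0 + w i * (of_real \<alpha>' * cnj s)"
      by (simp add: \<gamma>0'_def algebra_simps)
    then show ?thesis unfolding \<alpha>'c using insert.hyps gram(4) by simp
  qed
  have G5: "\<gamma>0' * cnj \<beta>' + of_real \<omega>' * \<gamma>1' = (\<Sum>j\<in>insert i J. w j * cnj (u j))"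
  proof -
    have "of_real \<omega>' * \<gamma>1' = (of_real \<omega>' * d) * \<gamma>1 + w' * (of_real \<omega>' * cnj t)"
      by (simp add: \<gamma>1'_def algebra_simps)
    then have "\<gamma>0' * cnj \<beta>' + of_real \<omega>' * \<gamma>1' = (\<gamma>0' * cnj \<beta>' + w' * cnj u') + of_real \<omega> * \<gamma>1"
      unfolding \<omega>'d by simp
    also have "\<gamma>0' * cnj \<beta>' + w' * cnj u' = \<gamma>0 * cnj \<beta> + w i * cnj (u i)"
      unfolding \<gamma>0'_def \<beta>'_def w'_def u'_def by (rule cross_rot)
    finally show ?thesis using insert.hyps gram(5) by (simp add: algebra_simps)
  qed
  have G6: "(cmod \<gamma>0')\<^sup>2 + (cmod \<gamma>1')\<^sup>2 + ((cmod w'')\<^sup>2 + \<delta>) = (\<Sum>j\<in>insert i J. (cmod (w j))\<^sup>2)"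
    using insert.hyps gram(6) norm_rot[of \<gamma>0 "w i"] norm_rot'[of \<gamma>1 w']
    by (simp add: \<gamma>0'_def \<gamma>1'_def w'_def w''_def)
  have TT: "(\<integral>\<^sup>+b. ennreal (cgauss (y - (\<Sum>j\<in>insert i J. b j * v j)) * cgauss (x - (\<Sum>j\<in>insert i J. b j * u j)) *
        (cmod (\<kappa> + (\<Sum>j\<in>insert i J. b j * w j)))\<^sup>2) \<partial>PiM (insert i J) (\<lambda>_. cgauss_measure)) =
      ennreal (cgauss (y / of_real \<alpha>') / \<alpha>'\<^sup>2 * (cgauss ((x - \<beta>' * (y / of_real \<alpha>')) / of_real \<omega>') / \<omega>'\<^sup>2 *
        ((cmod (\<kappa> + \<gamma>0' * (y / of_real \<alpha>') + \<gamma>1' * ((x - \<beta>' * (y / of_real \<alpha>')) / of_real \<omega>')))\<^sup>2 + ((cmod w'')\<^sup>2 + \<delta>))))"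
    (is "?I = _") for y x \<kappa>
  proof -
    define \<zeta> where "\<zeta> = y / of_real \<alpha>'"
    define \<xi> where "\<xi> = (x - \<beta>' * \<zeta>) / of_real \<omega>'"
    define F where "F b = ennreal (cgauss ((x - b * u i - \<beta> * ((y - b * v i) / of_real \<alpha>)) / of_real \<omega>) / \<omega>\<^sup>2 *
        ((cmod (\<kappa> + b * w i + \<gamma>0 * ((y - b * v i) / of_real \<alpha>) +
            \<gamma>1 * ((x - b * u i - \<beta> * ((y - b * v i) / of_real \<alpha>)) / of_real \<omega>)))\<^sup>2 + \<delta>))" for b
    define G where "G b = ennreal ((cmod (\<kappa> + \<gamma>0' * \<zeta> + b * w' + \<gamma>1 * ((x - \<beta>' * \<zeta> - b * u') / of_real \<omega>)))\<^sup>2 + \<delta>)" for b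
    have [measurable]: "F \<in> borel_measurable borel" unfolding F_def by measurable
    have [measurable]: "G \<in> borel_measurable borel" unfolding G_def by measurable
    \<comment> \<open>With the new variable outermost, its contributions merely shift
      \<open>y\<close>, \<open>x\<close> and \<kappa> in the inner integral. Hence the induction
      hypothesis is needed for all values of these three.\<close>
    have "?I = (\<integral>\<^sup>+b. (\<integral>\<^sup>+f. ennreal (cgauss (y - b * v i - (\<Sum>j\<in>J. f j * v j)) * cgauss (x - b * u i - (\<Sum>j\<in>J. f j * u j)) *
        (cmod (\<kappa> + b * w i + (\<Sum>j\<in>J. f j * w j)))\<^sup>2) \<partial>PiM J (\<lambda>_. cgauss_measure)) \<partial>cgauss_measure)"
    proof (subst product_nn_integral_insert_rev[OF insert.hyps])
      show "(\<lambda>b. ennreal (cgauss (y - (\<Sum>j\<in>insert i J. b j * v j)) * cgauss (x - (\<Sum>j\<in>insert i J. b j * u j)) *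
        (cmod (\<kappa> + (\<Sum>j\<in>insert i J. b j * w j)))\<^sup>2)) \<in> borel_measurable (PiM (insert i J) (\<lambda>_. cgauss_measure))"
        by measurable
      have "(\<Sum>j\<in>insert i J. (f(i := b)) j * g j) = b * g i + (\<Sum>j\<in>J. f j * g j)" for f b and g :: "'i \<Rightarrow> complex"
        using insert.hyps by (simp, intro sum.cong) auto
      then show "(\<integral>\<^sup>+ y'. \<integral>\<^sup>+ xa. ennreal (cgauss (y - (\<Sum>j\<in>insert i J. (xa(i := y')) j * v j)) *
           cgauss (x - (\<Sum>j\<in>insert i J. (xa(i := y')) j * u j)) *
           (cmod (\<kappa> + (\<Sum>j\<in>insert i J. (xa(i := y')) j * w j)))\<^sup>2)
         \<partial>PiM J (\<lambda>_. cgauss_measure) \<partial>cgauss_measure) =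
        (\<integral>\<^sup>+b. (\<integral>\<^sup>+f. ennreal (cgauss (y - b * v i - (\<Sum>j\<in>J. f j * v j)) * cgauss (x - b * u i - (\<Sum>j\<in>J. f j * u j)) *
        (cmod (\<kappa> + b * w i + (\<Sum>j\<in>J. f j * w j)))\<^sup>2) \<partial>PiM J (\<lambda>_. cgauss_measure)) \<partial>cgauss_measure)"
        by (simp only: diff_diff_eq add.assoc)
    qed
    also have "\<dots> = (\<integral>\<^sup>+b. ennreal (cgauss ((y - b * v i) / of_real \<alpha>) / \<alpha>\<^sup>2) * F b \<partial>cgauss_measure)"
      unfolding T F_def by (intro nn_integral_cong ennreal_mult) (use pos in auto)
    also have "\<dots> = ennreal (cgauss \<zeta> / \<alpha>'\<^sup>2) * (\<integral>\<^sup>+b. F (cnj s * \<zeta> + c * b) \<partial>cgauss_measure)"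
      unfolding \<zeta>_def s_def c_def by (subst cgauss_absorb[OF _ pos(1) \<alpha>']) simp_all
    also have "(\<integral>\<^sup>+b. F (cnj s * \<zeta> + c * b) \<partial>cgauss_measure) =
      (\<integral>\<^sup>+b. ennreal (cgauss ((x - \<beta>' * \<zeta> - b * u') / of_real \<omega>) / \<omega>\<^sup>2) * G b \<partial>cgauss_measure)"
    proof (rule nn_integral_cong)
      fix b
      let ?b = "cnj s * \<zeta> + c * b"
      have e1: "(y - ?b * v i) / of_real \<alpha> = c * \<zeta> - s * b"
        unfolding \<zeta>_def by (rule rot1)
      have e2: "x - ?b * u i - \<beta> * (c * \<zeta> - s * b) = x - \<beta>' * \<zeta> - b * u'"
        by (simp add: \<beta>'_def u'_def algebra_simps)
      have e3: "\<kappa> + ?b * w i + \<gamma>0 * (c * \<zeta> - s * b) = \<kappa> + \<gamma>0' * \<zeta> + b * w'"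
        by (simp add: \<gamma>0'_def w'_def algebra_simps)
      show "F ?b = ennreal (cgauss ((x - \<beta>' * \<zeta> - b * u') / of_real \<omega>) / \<omega>\<^sup>2) * G b"
        unfolding F_def G_def e1 e2 e3 by (intro ennreal_mult) (use pos in auto)
    qed
    also have "\<dots> = ennreal (cgauss \<xi> / \<omega>'\<^sup>2) * (\<integral>\<^sup>+b. G (cnj t * \<xi> + d * b) \<partial>cgauss_measure)"
      unfolding \<xi>_def t_def d_def by (subst cgauss_absorb[OF _ pos(2) \<omega>']) simp_all
    also have "(\<integral>\<^sup>+b. G (cnj t * \<xi> + d * b) \<partial>cgauss_measure) =
      (\<integral>\<^sup>+b. ennreal ((cmod (\<kappa> + \<gamma>0' * \<zeta> + \<gamma>1' * \<xi> + w'' * b))\<^sup>2 + \<delta>) \<partial>cgauss_measure)"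
    proof (rule nn_integral_cong)
      fix b
      let ?b = "cnj t * \<xi> + d * b"
      have e1: "(x - \<beta>' * \<zeta> - ?b * u') / of_real \<omega> = d * \<xi> - t * b"
        unfolding \<xi>_def by (rule rot2)
      have e2: "\<kappa> + \<gamma>0' * \<zeta> + ?b * w' + \<gamma>1 * (d * \<xi> - t * b) = \<kappa> + \<gamma>0' * \<zeta> + \<gamma>1' * \<xi> + w'' * b"
        by (simp add: \<gamma>1'_def w''_def algebra_simps)
      show "G ?b = ennreal ((cmod (\<kappa> + \<gamma>0' * \<zeta> + \<gamma>1' * \<xi> + w'' * b))\<^sup>2 + \<delta>)"
        unfolding G_def e1 e2 ..
    qed
    \<comment> \<open>Both Gaussian factors have been pulled out, so what is left of the new
      variable is independent noise with coefficient \<open>w''\<close> in the third form.\<close>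
    also have "\<dots> = ennreal ((cmod (\<kappa> + \<gamma>0' * \<zeta> + \<gamma>1' * \<xi>))\<^sup>2 + (cmod w'')\<^sup>2 + \<delta>)"
      using pos by (intro nn_integral_cgauss_cmod_affine)
    finally have "?I = ennreal (cgauss \<zeta> / \<alpha>'\<^sup>2) * (ennreal (cgauss \<xi> / \<omega>'\<^sup>2) *
      ennreal ((cmod (\<kappa> + \<gamma>0' * \<zeta> + \<gamma>1' * \<xi>))\<^sup>2 + ((cmod w'')\<^sup>2 + \<delta>)))"
      by (simp only: add.assoc)
    also have "\<dots> = ennreal (cgauss \<zeta> / \<alpha>'\<^sup>2 * (cgauss \<xi> / \<omega>'\<^sup>2 *
      ((cmod (\<kappa> + \<gamma>0' * \<zeta> + \<gamma>1' * \<xi>))\<^sup>2 + ((cmod w'')\<^sup>2 + \<delta>))))"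
    proof -
      have "(cmod (\<kappa> + \<gamma>0' * \<zeta> + \<gamma>1' * \<xi>))\<^sup>2 + ((cmod w'')\<^sup>2 + \<delta>) \<ge> 0" using pos by simp
      then show ?thesis by (simp only: ennreal_mult cgauss_nonneg divide_nonneg_nonneg zero_le_power2 mult_nonneg_nonneg)
    qed
    finally show ?thesis unfolding \<zeta>_def[symmetric] \<xi>_def[symmetric] .
  qed
  have "(cmod w'')\<^sup>2 + \<delta> \<ge> 0" using pos by simp
  with \<alpha>'(1) \<omega>'(1) G1 G2 G3 G4 G5 G6 TT show ?case
    by (intro exI[of _ \<alpha>'] exI[of _ \<beta>'] exI[of _ \<omega>'] exI[of _ \<gamma>0'] exI[of _ \<gamma>1'] exI[of _ "(cmod w'')\<^sup>2 + \<delta>"] conjI allI)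
qed

section \<open>Covariances of the polynomial and its derivatives\<close>

text \<open>These are t^k times the k-th derivatives of (1 + t)^n. The induction uses j * C(n,j) = n
  * C(n-1,j-1). Dividing by (1 + t)^k avoids a truncated exponent n - k; for k > n both sides vanish
  through the falling factorial.\<close>

lemma sum_choose_falling:
  fixes t :: real
  assumes "1 + t \<noteq> 0"
  shows "(\<Sum>j\<le>n. real (n choose j) * (\<Prod>i<k. real j - real i) * t ^ j) =
    (\<Prod>i<k. real n - real i) * t ^ k * (1 + t) ^ n / (1 + t) ^ k"
proof (induction k arbitrary: n)
  case 0
  show ?case using binomial_ring[of t 1 n] by (simp add: add.commute)
next
  case (Suc k)
  have shift: "(\<Prod>i<Suc k. real (Suc j) - real i) = real (Suc j) * (\<Prod>i<k. real j - real i)" for j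
    by (subst prod.lessThan_Suc_shift) simp
  have zero: "(\<Prod>i<Suc k. real 0 - real i) = 0"
    by (subst prod.lessThan_Suc_shift) simp
  show ?case
  proof (cases n)
    case 0
    show ?thesis unfolding 0 zero using zero by simp
  next
    case (Suc m)
    have "(\<Sum>j\<le>n. real (n choose j) * (\<Prod>i<Suc k. real j - real i) * t ^ j) =
      (\<Sum>j\<le>m. real (Suc m choose Suc j) * (\<Prod>i<Suc k. real (Suc j) - real i) * t ^ Suc j)"
      unfolding Suc sum.atMost_Suc_shift zero by simp
    also have "\<dots> = (\<Sum>j\<le>m. real n * t * (real (m choose j) * (\<Prod>i<k. real j - real i) * t ^ j))"
    proof (rule sum.cong)
      fix j
      have "real (Suc m choose Suc j) * real (Suc j) = real n * real (m choose j)"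
        unfolding Suc by (metis Suc_times_binomial mult.commute of_nat_mult)
      then have "real (Suc m choose Suc j) * real (Suc j) * (\<Prod>i<k. real j - real i) * t ^ Suc j =
        real n * t * (real (m choose j) * (\<Prod>i<k. real j - real i) * t ^ j)"
        by (simp only: power_Suc) (simp add: algebra_simps)
      then show "real (Suc m choose Suc j) * (\<Prod>i<Suc k. real (Suc j) - real i) * t ^ Suc j =
        real n * t * (real (m choose j) * (\<Prod>i<k. real j - real i) * t ^ j)"
        unfolding shift by (simp only: mult.assoc)
    qed simp
    also have "\<dots> = real n * t * ((\<Prod>i<k. real m - real i) * t ^ k * (1 + t) ^ m / (1 + t) ^ k)"
      unfolding sum_distrib_left[symmetric] Suc.IH ..
    also have "\<dots> = (\<Prod>i<Suc k. real n - real i) * t ^ Suc k * ((1 + t) ^ m / (1 + t) ^ k)"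
      unfolding Suc shift by simp
    also have "(1 + t) ^ m / (1 + t) ^ k = (1 + t) ^ n / (1 + t) ^ Suc k"
      using assms by (simp add: Suc)
    also have "(\<Prod>i<Suc k. real n - real i) * t ^ Suc k * ((1 + t) ^ n / (1 + t) ^ Suc k) =
      (\<Prod>i<Suc k. real n - real i) * t ^ Suc k * (1 + t) ^ n / (1 + t) ^ Suc k"
      by (rule times_divide_eq_right)
    finally show ?thesis .
  qed
qed

text \<open>Every weight is a combination of falling factorials of order at most 4; for instance j^2
  (j-1)^2 has coefficients 2, 4, 1 in orders 2, 3, 4. In order, the weights belong to the Gram
  entries uu, vv, uv, wv, wu and ww of the three forms introduced below.\<close>

lemma sum_choose_poly:
  fixes t :: real and n :: nat
  assumes t: "1 + t \<noteq> 0"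
  defines "N \<equiv> (1 + t) ^ n" and "m \<equiv> real n"
  shows "(\<Sum>j\<le>n. real (n choose j) * (1 - real j)\<^sup>2 * t ^ j) =
      N - m * t * N / (1 + t) + m * (m - 1) * t\<^sup>2 * N / (1 + t)\<^sup>2"
    and "(\<Sum>j\<le>n. real (n choose j) * (real j)\<^sup>2 * t ^ j) =
      m * t * N / (1 + t) + m * (m - 1) * t\<^sup>2 * N / (1 + t)\<^sup>2"
    and "(\<Sum>j\<le>n. real (n choose j) * (real j * (real j - 1)) * t ^ j) =
      m * (m - 1) * t\<^sup>2 * N / (1 + t)\<^sup>2"
    and "(\<Sum>j\<le>n. real (n choose j) * ((real j)\<^sup>2 * (real j - 1)) * t ^ j) =
      m * (m - 1) * (m - 2) * t ^ 3 * N / (1 + t) ^ 3 + 2 * (m * (m - 1) * t\<^sup>2 * N / (1 + t)\<^sup>2)"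
    and "(\<Sum>j\<le>n. real (n choose j) * (real j * (real j - 1)\<^sup>2) * t ^ j) =
      m * (m - 1) * (m - 2) * t ^ 3 * N / (1 + t) ^ 3 + m * (m - 1) * t\<^sup>2 * N / (1 + t)\<^sup>2"
    and "(\<Sum>j\<le>n. real (n choose j) * ((real j)\<^sup>2 * (real j - 1)\<^sup>2) * t ^ j) =
      m * (m - 1) * (m - 2) * (m - 3) * t ^ 4 * N / (1 + t) ^ 4
      + 4 * (m * (m - 1) * (m - 2) * t ^ 3 * N / (1 + t) ^ 3) + 2 * (m * (m - 1) * t\<^sup>2 * N / (1 + t)\<^sup>2)"
proof -
  define P where "P k = (\<Sum>j\<le>n. real (n choose j) * (\<Prod>i<k. real j - real i) * t ^ j)" for k
  have P: "P 0 = N" "P 1 = m * t * N / (1 + t)" "P 2 = m * (m - 1) * t\<^sup>2 * N / (1 + t)\<^sup>2"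
    "P 3 = m * (m - 1) * (m - 2) * t ^ 3 * N / (1 + t) ^ 3"
    "P 4 = m * (m - 1) * (m - 2) * (m - 3) * t ^ 4 * N / (1 + t) ^ 4"
    unfolding P_def sum_choose_falling[OF t] by (simp_all add: N_def m_def eval_nat_numeral)
  have lin: "(\<Sum>j\<le>n. real (n choose j) * f j * t ^ j) = a * P 0 + b * P 1 + c * P 2 + d * P 3 + e * P 4"
    if "\<And>j. f j = a + b * real j + c * (real j * (real j - 1)) + d * (real j * (real j - 1) * (real j - 2))
      + e * (real j * (real j - 1) * (real j - 2) * (real j - 3))" for f a b c d e
    unfolding P_def that sum_distrib_left sum.distrib[symmetric]
    by (intro sum.cong) (simp_all add: eval_nat_numeral algebra_simps)
  show "(\<Sum>j\<le>n. real (n choose j) * (1 - real j)\<^sup>2 * t ^ j) =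
      N - m * t * N / (1 + t) + m * (m - 1) * t\<^sup>2 * N / (1 + t)\<^sup>2"
    by (subst lin[of _ 1 "-1" 1 0 0]) (simp_all only: P, simp_all add: algebra_simps power2_eq_square)
  show "(\<Sum>j\<le>n. real (n choose j) * (real j)\<^sup>2 * t ^ j) =
      m * t * N / (1 + t) + m * (m - 1) * t\<^sup>2 * N / (1 + t)\<^sup>2"
    by (subst lin[of _ 0 1 1 0 0]) (simp_all only: P, simp_all add: algebra_simps power2_eq_square)
  show "(\<Sum>j\<le>n. real (n choose j) * (real j * (real j - 1)) * t ^ j) =
      m * (m - 1) * t\<^sup>2 * N / (1 + t)\<^sup>2"
    by (subst lin[of _ 0 0 1 0 0]) (simp_all add: P del: One_nat_def)
  show "(\<Sum>j\<le>n. real (n choose j) * ((real j)\<^sup>2 * (real j - 1)) * t ^ j) =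
      m * (m - 1) * (m - 2) * t ^ 3 * N / (1 + t) ^ 3 + 2 * (m * (m - 1) * t\<^sup>2 * N / (1 + t)\<^sup>2)"
    by (subst lin[of _ 0 0 2 1 0]) (simp_all only: P, simp_all add: algebra_simps power2_eq_square)
  show "(\<Sum>j\<le>n. real (n choose j) * (real j * (real j - 1)\<^sup>2) * t ^ j) =
      m * (m - 1) * (m - 2) * t ^ 3 * N / (1 + t) ^ 3 + m * (m - 1) * t\<^sup>2 * N / (1 + t)\<^sup>2"
    by (subst lin[of _ 0 0 1 1 0]) (simp_all only: P, simp_all add: algebra_simps power2_eq_square)
  show "(\<Sum>j\<le>n. real (n choose j) * ((real j)\<^sup>2 * (real j - 1)\<^sup>2) * t ^ j) =
      m * (m - 1) * (m - 2) * (m - 3) * t ^ 4 * N / (1 + t) ^ 4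
      + 4 * (m * (m - 1) * (m - 2) * t ^ 3 * N / (1 + t) ^ 3) + 2 * (m * (m - 1) * t\<^sup>2 * N / (1 + t)\<^sup>2)"
    by (subst lin[of _ 0 0 2 4 1]) (simp_all only: P, simp_all add: algebra_simps power2_eq_square)
qed

text \<open>These are Schur complements with denominators cleared. For the triangular factor used
  below, the right-hand sides are C = \<alpha>^2, then C \<omega>^2, then C \<omega> \<gamma>1 up to
  the factor -1 / (z^2 sqrt m), and finally C \<delta>.\<close>

lemma gram_identities:
  fixes s t m N :: real
  assumes s: "s = 1 + t" "s > 0" and t: "t > 0" and m: "m > 0" and N: "N > 0"
  defines "P1 \<equiv> m * t * N / s" and "P2 \<equiv> m * (m - 1) * t\<^sup>2 * N / s\<^sup>2"
    and "P3 \<equiv> m * (m - 1) * (m - 2) * t ^ 3 * N / s ^ 3"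
    and "P4 \<equiv> m * (m - 1) * (m - 2) * (m - 3) * t ^ 4 * N / s ^ 4"
  shows "(P1 + P2) / (m * t) = N * (1 + m * t) / s\<^sup>2"
    and "(N - P1 + P2) * (N * (1 + m * t) / s\<^sup>2) - P2\<^sup>2 / (m * t) = (N / s)\<^sup>2"
    and "(P3 + P2) * (N * (1 + m * t) / s\<^sup>2) - (P3 + 2 * P2) * P2 / (m * t) = m * (m - 1) * t\<^sup>2 * N\<^sup>2 / s ^ 4"
    and "(P4 + 4 * P3 + 2 * P2) / (m * t\<^sup>2) * (N * (1 + m * t) / s\<^sup>2) - (P3 + 2 * P2)\<^sup>2 / (m\<^sup>2 * t ^ 3)
      - m * (m - 1)\<^sup>2 * t\<^sup>2 / s ^ 4 * (N / s)\<^sup>2 = 2 * (m - 1) * N / s ^ 4 * (N * (1 + m * t) / s\<^sup>2)"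
proof -
  have sne: "s \<noteq> 0" using s by simp
  show "(P1 + P2) / (m * t) = N * (1 + m * t) / s\<^sup>2"
    unfolding P1_def P2_def using t m sne by (simp add: divide_simps) (simp add: s(1), algebra)
  show "(N - P1 + P2) * (N * (1 + m * t) / s\<^sup>2) - P2\<^sup>2 / (m * t) = (N / s)\<^sup>2"
    unfolding P1_def P2_def using t m sne by (simp add: divide_simps) (simp add: s(1), algebra)
  show "(P3 + P2) * (N * (1 + m * t) / s\<^sup>2) - (P3 + 2 * P2) * P2 / (m * t) = m * (m - 1) * t\<^sup>2 * N\<^sup>2 / s ^ 4"
    unfolding P3_def P2_def using t m sne by (simp add: divide_simps) (simp add: s(1), algebra)
  show "(P4 + 4 * P3 + 2 * P2) / (m * t\<^sup>2) * (N * (1 + m * t) / s\<^sup>2) - (P3 + 2 * P2)\<^sup>2 / (m\<^sup>2 * t ^ 3)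
      - m * (m - 1)\<^sup>2 * t\<^sup>2 / s ^ 4 * (N / s)\<^sup>2 = 2 * (m - 1) * N / s ^ 4 * (N * (1 + m * t) / s\<^sup>2)"
    unfolding P4_def P3_def P2_def using t m sne by (simp add: divide_simps) (simp add: s(1), algebra)
qed

text \<open>\<open>v j\<close>, \<open>u j\<close> and \<open>w j\<close> are the coefficients of \<open>a\<^sub>j\<close> in \<open>p' z / sqrt n\<close>, \<open>p z - z p' z\<close> and
  \<open>p'' z / sqrt n\<close>; in the first two forms \<open>a\<^sub>1\<close> and \<open>a\<^sub>0\<close>, respectively, play the role of the
  additional Gaussian.\<close>

lemma nn_integral_critical_density:
  fixes z x :: complex and n :: nat
  assumes n: "n \<ge> 1" and z: "z \<noteq> 0"
  defines "v \<equiv> \<lambda>j. of_real (sqrt (n choose j)) * of_nat j * z ^ (j - 1) / of_real (sqrt n)"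
    and "u \<equiv> \<lambda>j. of_real (sqrt (n choose j)) * (1 - of_nat j) * z ^ j"
    and "w \<equiv> \<lambda>j. of_real (sqrt (n choose j)) * of_nat (j * (j - 1)) * z ^ (j - 2) / of_real (sqrt n)"
    and "t \<equiv> (cmod z)\<^sup>2" and "m \<equiv> real n"
  shows "(\<integral>\<^sup>+b. ennreal (cgauss (- (\<Sum>j=2..n. b j * v j)) * cgauss (x - (\<Sum>j=2..n. b j * u j)) *
        (cmod (\<Sum>j=2..n. b j * w j))\<^sup>2) \<partial>PiM {2..n} (\<lambda>_. cgauss_measure)) =
    ennreal (1 / pi\<^sup>2 * (m * (m - 1)\<^sup>2 * t\<^sup>2 * (cmod x)\<^sup>2 / (1 + t) ^ (2 * n + 2) + 2 * (m - 1) / (1 + t) ^ (n + 2)) *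
      exp (- ((1 + m * t) / (1 + t) ^ n) * (cmod x)\<^sup>2))"
proof -
  define s where "s = 1 + t"
  define N where "N = s ^ n"
  have t: "t > 0" and s: "s > 0" and m: "m > 0" "m \<ge> 1" and N: "N > 0"
    using n z by (simp_all add: t_def s_def m_def N_def add_pos_nonneg)
  define P1 where "P1 = m * t * N / s"
  define P2 where "P2 = m * (m - 1) * t\<^sup>2 * N / s\<^sup>2"
  define P3 where "P3 = m * (m - 1) * (m - 2) * t ^ 3 * N / s ^ 3"
  define P4 where "P4 = m * (m - 1) * (m - 2) * (m - 3) * t ^ 4 * N / s ^ 4"
  define C where "C = N * (1 + m * t) / s\<^sup>2"
  have C: "C > 0" using N m t s by (simp add: C_def add_pos_nonneg)
  have s1: "1 + t \<noteq> 0" using t by simp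
  note sums = sum_choose_poly[OF s1, of n, folded m_def s_def, folded N_def, folded P1_def P2_def P3_def P4_def]
  note ids = gram_identities[OF s_def s t m(1) N, folded P1_def P2_def P3_def P4_def, folded C_def]
  define r where "r = complex_of_real (sqrt m)"
  have r: "r * r = of_real m" "cnj r = r" "r \<noteq> 0" using m
    by (simp_all add: r_def flip: of_real_mult)
  have tz: "of_real t = z * cnj z" unfolding t_def by (rule complex_norm_square)
  \<comment> \<open>Writing z^(j-1) and z^(j-2) as z^j over a power of \<open>z\<close> makes every
    product of coefficients a multiple of t^j with a common denominator, ready for the binomial
    sums.\<close>
  define k where "k j = complex_of_real (sqrt (n choose j))" for j
  have k: "k j * k j = of_nat (n choose j)" "cnj (k j) = k j" for j
    by (simp_all add: k_def flip: of_real_mult)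
  have zt: "z ^ j * cnj z ^ j = of_real (t ^ j)" for j
    by (simp add: tz power_mult_distrib)
  have v: "v j = k j * of_nat j * z ^ j / (z * r)" for j
    using z by (cases j) (simp_all add: v_def k_def r_def m_def)
  have u: "u j = k j * (1 - of_nat j) * z ^ j" for j
    by (simp add: u_def k_def)
  have w: "w j = k j * (of_nat j * (of_nat j - 1)) * z ^ j / (z\<^sup>2 * r)" for j
  proof (cases "j < 2")
    case True
    then show ?thesis by (cases j) (auto simp: w_def)
  next
    case False
    then obtain i where j: "j = i + 2" by (metis add.commute le_Suc_ex not_less)
    have c: "of_nat (j * (j - 1)) = (of_nat j * (of_nat j - 1) :: complex)"
      by (simp add: j algebra_simps)
    have "z ^ (j - 2) / r = z ^ j / (z\<^sup>2 * r)" using z by (simp add: j power_add power2_eq_square)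
    moreover have "w j = k j * of_nat (j * (j - 1)) * (z ^ (j - 2) / r)"
      by (simp add: w_def k_def r_def m_def)
    ultimately have "w j = k j * (of_nat j * (of_nat j - 1)) * (z ^ j / (z\<^sup>2 * r))" by (simp only: c)
    then show ?thesis by simp
  qed
  \<comment> \<open>The binomial sums start at 0, the Gaussian forms at 2. The omitted terms |v 1|^2
    = 1 and |u 0|^2 = 1 are exactly the unit variances of the two additional Gaussians; all other
    omitted products vanish.\<close>
  have S: "(\<Sum>j\<le>n. g j) = g 0 + g 1 + (\<Sum>j=2..n. g j)" for g :: "nat \<Rightarrow> complex"
  proof -
    have "{..n} = insert 0 (insert 1 {2..n})" using n by auto
    then show ?thesis by (simp add: add.assoc)
  qed
  have kk: "k j * a * z ^ j * cnj (k j * b * z ^ j) = of_nat (n choose j) * (a * cnj b) * of_real (t ^ j)" for j a b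
  proof -
    have "k j * a * z ^ j * cnj (k j * b * z ^ j) = (k j * k j) * (a * cnj b) * (z ^ j * cnj z ^ j)"
      by (simp add: k(2))
    then show ?thesis unfolding k(1) zt .
  qed
  have V: "complex_of_real (1 + (\<Sum>j=2..n. (cmod (v j))\<^sup>2)) = of_real C"
  proof -
    have "v j * cnj (v j) = of_real (real (n choose j) * (real j)\<^sup>2 * t ^ j) / of_real (m * t)" for j
    proof -
      have "v j * cnj (v j) = (k j * of_nat j * z ^ j * cnj (k j * of_nat j * z ^ j)) / ((z * cnj z) * (r * r))"
        unfolding v by (simp add: r(2))
      then show ?thesis unfolding kk r(1) tz[symmetric] by (simp add: power2_eq_square mult.commute)
    qed
    then have "(\<Sum>j\<le>n. v j * cnj (v j)) = of_real ((P1 + P2) / (m * t))"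
      by (simp flip: sums(2) sum_divide_distrib)
    moreover have "v 0 = 0" "v 1 * cnj (v 1) = 1"
      using r z by (simp_all add: v_def r_def m_def flip: of_real_mult)
    ultimately show ?thesis
      unfolding S ids(1) by (simp add: complex_norm_square del: of_real_power)
  qed
  have U: "complex_of_real (1 + (\<Sum>j=2..n. (cmod (u j))\<^sup>2)) = of_real (N - P1 + P2)"
  proof -
    have "u j * cnj (u j) = of_real (real (n choose j) * (1 - real j)\<^sup>2 * t ^ j)" for j
      unfolding u kk by (simp add: power2_eq_square)
    then have "(\<Sum>j\<le>n. u j * cnj (u j)) = of_real (N - P1 + P2)"
      by (simp flip: sums(1))
    moreover have "u 0 = 1" "u 1 = 0"
      by (simp_all add: u_def)
    ultimately show ?thesis
      unfolding S by (simp add: complex_norm_square del: of_real_power)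
  qed
  have W: "complex_of_real (\<Sum>j=2..n. (cmod (w j))\<^sup>2) = of_real ((P4 + 4 * P3 + 2 * P2) / (m * t\<^sup>2))"
  proof -
    have "w j * cnj (w j) = of_real (real (n choose j) * ((real j)\<^sup>2 * (real j - 1)\<^sup>2) * t ^ j) / of_real (m * t\<^sup>2)" for j
    proof -
      have "w j * cnj (w j) = (k j * (of_nat j * (of_nat j - 1)) * z ^ j * cnj (k j * (of_nat j * (of_nat j - 1)) * z ^ j)) / ((z * cnj z)\<^sup>2 * (r * r))"
        unfolding w by (simp add: r(2) power_mult_distrib)
      then show ?thesis unfolding kk r(1) tz[symmetric] by (simp add: power2_eq_square mult_ac)
    qed
    then have "(\<Sum>j\<le>n. w j * cnj (w j)) = of_real ((P4 + 4 * P3 + 2 * P2) / (m * t\<^sup>2))"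
      by (simp flip: sums(6) sum_divide_distrib)
    moreover have "w 0 = 0" "w 1 = 0" by (simp_all add: w_def)
    ultimately show ?thesis
      unfolding S by (simp add: complex_norm_square del: of_real_power)
  qed
  have UV: "(\<Sum>j=2..n. u j * cnj (v j)) = - of_real P2 / (cnj z * r)"
  proof -
    have "u j * cnj (v j) = - of_real (real (n choose j) * (real j * (real j - 1)) * t ^ j) / (cnj z * r)" for j
    proof -
      have "u j * cnj (v j) = (k j * (1 - of_nat j) * z ^ j * cnj (k j * of_nat j * z ^ j)) / (cnj z * r)"
        unfolding v u by (simp add: r(2))
      then show ?thesis unfolding kk by (simp add: algebra_simps flip: minus_divide_left)
    qed
    then have "(\<Sum>j\<le>n. u j * cnj (v j)) = - of_real P2 / (cnj z * r)"
      by (simp add: sum_negf flip: sums(3) sum_divide_distrib)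
    moreover have "v 0 = 0" "u 1 = 0" by (simp_all add: v_def u_def)
    ultimately show ?thesis unfolding S by simp
  qed
  have WV: "(\<Sum>j=2..n. w j * cnj (v j)) = of_real (P3 + 2 * P2) / (z * of_real (m * t))"
  proof -
    have "w j * cnj (v j) = of_real (real (n choose j) * ((real j)\<^sup>2 * (real j - 1)) * t ^ j) / (z * of_real (m * t))" for j
    proof -
      have "w j * cnj (v j) = (k j * (of_nat j * (of_nat j - 1)) * z ^ j * cnj (k j * of_nat j * z ^ j)) / (z * ((r * r) * (z * cnj z)))"
        unfolding v w by (simp add: r(2) power2_eq_square mult_ac)
      then show ?thesis unfolding kk r(1) tz[symmetric] by (simp add: power2_eq_square mult_ac)
    qed
    then have "(\<Sum>j\<le>n. w j * cnj (v j)) = of_real (P3 + 2 * P2) / (z * of_real (m * t))"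
      by (simp flip: sums(4) sum_divide_distrib)
    moreover have "v 0 = 0" "w 1 = 0" by (simp_all add: v_def w_def)
    ultimately show ?thesis unfolding S by simp
  qed
  have WU: "(\<Sum>j=2..n. w j * cnj (u j)) = - of_real (P3 + P2) / (z\<^sup>2 * r)"
  proof -
    have "w j * cnj (u j) = - of_real (real (n choose j) * (real j * (real j - 1)\<^sup>2) * t ^ j) / (z\<^sup>2 * r)" for j
    proof -
      have "w j * cnj (u j) = (k j * (of_nat j * (of_nat j - 1)) * z ^ j * cnj (k j * (1 - of_nat j) * z ^ j)) / (z\<^sup>2 * r)"
        unfolding u w by simp
      then show ?thesis unfolding kk by (simp add: algebra_simps power2_eq_square flip: minus_divide_left)
    qed
    then have "(\<Sum>j\<le>n. w j * cnj (u j)) = - of_real (P3 + P2) / (z\<^sup>2 * r)"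
      by (simp add: sum_negf flip: sums(5) sum_divide_distrib)
    moreover have "w 0 = 0" "w 1 = 0" by (simp_all add: w_def)
    ultimately show ?thesis unfolding S by simp
  qed
  obtain \<alpha> \<omega> \<delta> :: real and \<beta> \<gamma>0 \<gamma>1 :: complex where pos: "\<alpha> > 0" "\<omega> > 0" "\<delta> \<ge> 0"
    and gram: "\<alpha>\<^sup>2 = 1 + (\<Sum>j=2..n. (cmod (v j))\<^sup>2)"
      "of_real \<alpha> * \<beta> = (\<Sum>j=2..n. u j * cnj (v j))"
      "(cmod \<beta>)\<^sup>2 + \<omega>\<^sup>2 = 1 + (\<Sum>j=2..n. (cmod (u j))\<^sup>2)"
      "of_real \<alpha> * \<gamma>0 = (\<Sum>j=2..n. w j * cnj (v j))"
      "\<gamma>0 * cnj \<beta> + of_real \<omega> * \<gamma>1 = (\<Sum>j=2..n. w j * cnj (u j))"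
      "(cmod \<gamma>0)\<^sup>2 + (cmod \<gamma>1)\<^sup>2 + \<delta> = (\<Sum>j=2..n. (cmod (w j))\<^sup>2)"
    and T: "\<And>y x \<kappa>. (\<integral>\<^sup>+b. ennreal (cgauss (y - (\<Sum>j=2..n. b j * v j)) * cgauss (x - (\<Sum>j=2..n. b j * u j)) *
        (cmod (\<kappa> + (\<Sum>j=2..n. b j * w j)))\<^sup>2) \<partial>PiM {2..n} (\<lambda>_. cgauss_measure)) =
      ennreal (cgauss (y / of_real \<alpha>) / \<alpha>\<^sup>2 * (cgauss ((x - \<beta> * (y / of_real \<alpha>)) / of_real \<omega>) / \<omega>\<^sup>2 *
        ((cmod (\<kappa> + \<gamma>0 * (y / of_real \<alpha>) + \<gamma>1 * ((x - \<beta> * (y / of_real \<alpha>)) / of_real \<omega>)))\<^sup>2 + \<delta>)))"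
    using cgauss_three_forms[of "{2..n}" v u w] by (auto simp del: of_real_divide)
  have \<alpha>2: "\<alpha>\<^sup>2 = C" using V gram(1) of_real_eq_iff by metis
  \<comment> \<open>Squared moduli are computed with the factor \<open>C\<close> attached, so that
    the square root \<alpha> never enters the rational algebra.\<close>
  have "\<alpha>\<^sup>2 * (cmod \<beta>)\<^sup>2 = (cmod (of_real \<alpha> * \<beta>))\<^sup>2" by (simp add: norm_mult power_mult_distrib)
  also have "\<dots> = P2\<^sup>2 / (m * t)"
    unfolding gram(2) UV using m by (simp add: norm_mult norm_divide power_divide power_mult_distrib t_def r_def mult.commute)
  finally have \<beta>2: "C * (cmod \<beta>)\<^sup>2 = P2\<^sup>2 / (m * t)" unfolding \<alpha>2 .
  have "(cmod \<beta>)\<^sup>2 + \<omega>\<^sup>2 = N - P1 + P2" using U gram(3) of_real_eq_iff by metis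
  then have "C * (cmod \<beta>)\<^sup>2 + C * \<omega>\<^sup>2 = (N - P1 + P2) * C" by (metis distrib_left mult.commute)
  then have \<omega>2: "C * \<omega>\<^sup>2 = (N / s)\<^sup>2" using \<beta>2 ids(2) by simp
  have "\<alpha>\<^sup>2 * (cmod \<gamma>0)\<^sup>2 = (cmod (of_real \<alpha> * \<gamma>0))\<^sup>2" by (simp add: norm_mult power_mult_distrib)
  also have "\<dots> = (P3 + 2 * P2)\<^sup>2 / (m\<^sup>2 * t ^ 3)"
    unfolding gram(4) WV norm_divide norm_mult norm_of_real power_divide power_mult_distrib t_def[symmetric]
    using m t by (simp add: power2_eq_square eval_nat_numeral mult_ac)
  finally have \<gamma>02: "C * (cmod \<gamma>0)\<^sup>2 = (P3 + 2 * P2)\<^sup>2 / (m\<^sup>2 * t ^ 3)" unfolding \<alpha>2 .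
  define K where "K = m * (m - 1) * t\<^sup>2 * N\<^sup>2 / s ^ 4"
  \<comment> \<open>The unknown product of \<gamma>0 and the conjugate of \<beta> is eliminated by
    multiplying the Gram relation for \<gamma>0 by the conjugate of the one for \<beta>.\<close>
  have "of_real C * (of_real \<omega> * \<gamma>1) = of_real C * (\<gamma>0 * cnj \<beta> + of_real \<omega> * \<gamma>1) - (of_real \<alpha> * \<gamma>0) * cnj (of_real \<alpha> * \<beta>)"
    unfolding \<alpha>2[symmetric] by (simp add: algebra_simps power2_eq_square)
  also have "\<dots> = of_real C * (- of_real (P3 + P2) / (z\<^sup>2 * r)) - of_real (P3 + 2 * P2) / (z * of_real (m * t)) * (- of_real P2 / (z * r))"
    unfolding gram(2,4,5) UV WV WU by (simp add: r(2))
  also have "\<dots> = - of_real ((P3 + P2) * C - (P3 + 2 * P2) * P2 / (m * t)) / (z\<^sup>2 * r)"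
    using z r(3) m t by (simp add: field_simps power2_eq_square)
  also have "\<dots> = - of_real K / (z\<^sup>2 * r)" unfolding ids(3) K_def ..
  finally have "(cmod (of_real C * (of_real \<omega> * \<gamma>1)))\<^sup>2 = (cmod (- of_real K / (z\<^sup>2 * r)))\<^sup>2" by simp
  then have "C\<^sup>2 * \<omega>\<^sup>2 * (cmod \<gamma>1)\<^sup>2 = K\<^sup>2 / (t\<^sup>2 * m)"
    using m by (simp add: norm_mult norm_divide norm_power power_mult_distrib power_divide r_def t_def)
  then have "C * (N / s)\<^sup>2 * (cmod \<gamma>1)\<^sup>2 = K\<^sup>2 / (t\<^sup>2 * m)"
    unfolding \<omega>2[symmetric] by (simp add: power2_eq_square mult_ac)
  then have "C * (cmod \<gamma>1)\<^sup>2 * (N / s)\<^sup>2 = K\<^sup>2 / (t\<^sup>2 * m)"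
    by (metis mult.assoc mult.commute)
  moreover have "(N / s)\<^sup>2 \<noteq> 0" using N s by simp
  ultimately have g1: "C * (cmod \<gamma>1)\<^sup>2 = K\<^sup>2 / (t\<^sup>2 * m) / (N / s)\<^sup>2"
    using nonzero_eq_divide_eq by metis
  have \<gamma>12: "C * (cmod \<gamma>1)\<^sup>2 = m * (m - 1)\<^sup>2 * t\<^sup>2 / s ^ 4 * (N / s)\<^sup>2"
    unfolding g1 K_def using N s t m by (simp add: divide_simps) algebra
  have "(cmod \<gamma>0)\<^sup>2 + (cmod \<gamma>1)\<^sup>2 + \<delta> = (P4 + 4 * P3 + 2 * P2) / (m * t\<^sup>2)"
    using W gram(6) of_real_eq_iff by metis
  then have "C * (cmod \<gamma>0)\<^sup>2 + C * (cmod \<gamma>1)\<^sup>2 + C * \<delta> = (P4 + 4 * P3 + 2 * P2) / (m * t\<^sup>2) * C"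
    by (metis distrib_left mult.commute)
  then have "C * \<delta> = 2 * (m - 1) * N / s ^ 4 * C"
    using ids(4) unfolding \<gamma>02 \<gamma>12 by simp
  then have \<delta>: "\<delta> = 2 * (m - 1) * N / s ^ 4"
    using C by (metis less_irrefl mult.commute mult_right_cancel)
  \<comment> \<open>\<omega>^2 is the variance of the value at \<open>z\<close> given that
    \<open>z\<close> is critical; its reciprocal is the rate in the exponential.\<close>
  have \<omega>2': "1 / \<omega>\<^sup>2 = (1 + m * t) / N"
  proof -
    have "1 / \<omega>\<^sup>2 = C / (N / s)\<^sup>2" unfolding \<omega>2[symmetric] using C by simp
    also have "\<dots> = (1 + m * t) / N" using N s by (simp add: C_def divide_simps power2_eq_square)
    finally show ?thesis .
  qed
  have \<gamma>\<omega>: "(cmod \<gamma>1)\<^sup>2 / \<omega>\<^sup>2 = m * (m - 1)\<^sup>2 * t\<^sup>2 / s ^ 4"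
  proof -
    have "(cmod \<gamma>1)\<^sup>2 / \<omega>\<^sup>2 = (C * (cmod \<gamma>1)\<^sup>2) / (C * \<omega>\<^sup>2)" using C by simp
    then show ?thesis unfolding \<gamma>12 \<omega>2 using N s by simp
  qed
  \<comment> \<open>The critical condition is \<open>y = 0\<close>, where \<beta> and \<gamma>0 drop
    out and only \<omega>, \<gamma>1 and \<delta> are left.\<close>
  have E: "cgauss (0 / of_real \<alpha>) / \<alpha>\<^sup>2 * (cgauss ((x - \<beta> * (0 / of_real \<alpha>)) / of_real \<omega>) / \<omega>\<^sup>2 *
        ((cmod (0 + \<gamma>0 * (0 / of_real \<alpha>) + \<gamma>1 * ((x - \<beta> * (0 / of_real \<alpha>)) / of_real \<omega>)))\<^sup>2 + \<delta>)) =
     1 / pi\<^sup>2 * (m * (m - 1)\<^sup>2 * t\<^sup>2 * (cmod x)\<^sup>2 / (1 + t) ^ (2 * n + 2) + 2 * (m - 1) / (1 + t) ^ (n + 2)) *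
      exp (- ((1 + m * t) / (1 + t) ^ n) * (cmod x)\<^sup>2)" (is "?L = ?R")
  proof -
    have x: "(cmod (x / of_real \<omega>))\<^sup>2 = (1 + m * t) / N * (cmod x)\<^sup>2"
      unfolding \<omega>2'[symmetric] by (simp add: norm_divide power_divide)
    have gx: "(cmod (\<gamma>1 * (x / of_real \<omega>)))\<^sup>2 = m * (m - 1)\<^sup>2 * t\<^sup>2 / s ^ 4 * (cmod x)\<^sup>2"
      unfolding \<gamma>\<omega>[symmetric] by (simp add: norm_divide norm_mult power_divide power_mult_distrib)
    have "?L = 1 / (C * \<omega>\<^sup>2) * (1 / pi\<^sup>2) * ((cmod (\<gamma>1 * (x / of_real \<omega>)))\<^sup>2 + \<delta>) * exp (- (cmod (x / of_real \<omega>))\<^sup>2)"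
      unfolding \<alpha>2[symmetric] by (simp add: cgauss_def power2_eq_square mult_ac)
    also have "\<dots> = 1 / pi\<^sup>2 * ((s / N)\<^sup>2 * (m * (m - 1)\<^sup>2 * t\<^sup>2 / s ^ 4 * (cmod x)\<^sup>2 + 2 * (m - 1) * N / s ^ 4)) *
      exp (- ((1 + m * t) / N) * (cmod x)\<^sup>2)"
      unfolding \<omega>2 gx x \<delta> by (simp add: power_divide)
    also have "(s / N)\<^sup>2 * (m * (m - 1)\<^sup>2 * t\<^sup>2 / s ^ 4 * (cmod x)\<^sup>2 + 2 * (m - 1) * N / s ^ 4) =
      m * (m - 1)\<^sup>2 * t\<^sup>2 * (cmod x)\<^sup>2 / (N\<^sup>2 * s\<^sup>2) + 2 * (m - 1) / (N * s\<^sup>2)"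
      using N s by (simp add: divide_simps) algebra
    also have "N\<^sup>2 * s\<^sup>2 = s ^ (2 * n + 2)" by (simp add: N_def power_add power_even_eq power2_eq_square)
    also have "N * s\<^sup>2 = s ^ (n + 2)" by (simp add: N_def power_add power2_eq_square)
    finally show ?thesis unfolding s_def N_def .
  qed
  show ?thesis
    using T[of 0 x 0] unfolding E by simp
qed

section \<open>The radial integral\<close>

lemma set_integrable_inverse_square: "set_integrable lborel {1..} (\<lambda>r::real. 1 / r\<^sup>2)"
proof -
  have lim: "((\<lambda>r::real. - 1 / r) \<longlongrightarrow> 0) at_top" by real_asymp
  have "((\<lambda>r. - 1 / r) has_real_derivative 1 / r\<^sup>2) (at r)" if "1 \<le> r" for r :: real
    using that by (auto intro!: derivative_eq_intros simp: power2_eq_square)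
  then have "(\<integral>\<^sup>+r. ennreal (1 / r\<^sup>2) * indicator {1..} r \<partial>lborel) = ennreal (0 - - 1 / 1)"
    by (intro nn_integral_FTC_atLeast[where F="\<lambda>r. - 1 / r"] lim) auto
  moreover have "(\<integral>\<^sup>+r. ennreal (indicator {1..} r *\<^sub>R (1 / r\<^sup>2)) \<partial>lborel) =
    (\<integral>\<^sup>+r. ennreal (1 / r\<^sup>2) * indicator {1..} r \<partial>(lborel :: real measure))"
    by (intro nn_integral_cong) (simp add: indicator_def)
  ultimately have "(\<integral>\<^sup>+r. ennreal (indicator {1..} r *\<^sub>R (1 / r\<^sup>2)) \<partial>(lborel :: real measure)) = ennreal 1"
    by simp
  then show ?thesis
    unfolding set_integrable_def by (intro integrableI_nn_integral_finite) auto
qed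

lemma set_integrable_atLeast_1_bound:
  fixes f :: "real \<Rightarrow> real"
  assumes [measurable]: "f \<in> borel_measurable borel" and "\<And>r. r \<ge> 1 \<Longrightarrow> \<bar>f r\<bar> \<le> B / r\<^sup>2"
  shows "set_integrable lborel {1..} f"
  by (rule set_integrable_bound[OF set_integrable_mult_right[OF set_integrable_inverse_square, of B]])
    (use assms in \<open>auto simp: set_borel_measurable_def intro!: AE_I2 order.trans[OF assms(2)] divide_right_mono\<close>)

text \<open>The reciprocal of the conditional variance of \<open>p z\<close> given
  \<open>p' z = 0\<close>, at \<open>r\<close> = 1 + |z|^2.\<close>

definition density_rate :: "nat \<Rightarrow> real \<Rightarrow> real" where
  "density_rate n r = (real n * (r - 1) + 1) / r ^ n"

text \<open>The upper bound is Bernoulli's inequality for (1 + (r - 1))^n. It makes 1/r^2 a majorant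
  of the stated integrand that is uniform in \<open>X\<close>.\<close>

lemma density_rate_bounds:
  assumes "r \<ge> 1"
  shows "density_rate n r > 0" "density_rate n r \<le> 1"
proof -
  show "density_rate n r > 0" using assms by (simp add: density_rate_def add_nonneg_pos)
  have "1 + real n * (r - 1) \<le> (1 + (r - 1)) ^ n"
    by (rule Bernoulli_inequality) (use assms in simp)
  then show "density_rate n r \<le> 1" using assms by (simp add: density_rate_def)
qed

lemma density_rate_measurable [measurable]: "density_rate n \<in> borel_measurable borel"
  unfolding density_rate_def by measurable

definition density_integrand :: "nat \<Rightarrow> real \<Rightarrow> real \<Rightarrow> real" where
  "density_integrand n X r = density_rate n r / r\<^sup>2 * exp (- density_rate n r * X)"

lemma density_integrand_measurable [measurable]: "density_integrand n X \<in> borel_measurable borel"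
  unfolding density_integrand_def by measurable

lemma density_integrand_eq:
  "(real n * (r - 1) + 1) / r ^ (n + 2) * exp (- ((real n * (r - 1) + 1) / r ^ n) * X) = density_integrand n X r"
  by (simp add: density_integrand_def density_rate_def power_add power2_eq_square)

lemma density_integrand_bound:
  assumes "r \<ge> 1" "X \<ge> 0"
  shows "0 \<le> density_integrand n X r" "density_integrand n X r \<le> 1 / r\<^sup>2"
proof -
  note b = density_rate_bounds[OF assms(1), of n]
  show "0 \<le> density_integrand n X r" using b assms by (simp add: density_integrand_def)
  have "exp (- density_rate n r * X) \<le> 1" using b assms by simp
  then have "density_rate n r / r\<^sup>2 * exp (- density_rate n r * X) \<le> 1 / r\<^sup>2 * 1"
    using b assms by (intro mult_mono divide_right_mono) auto
  then show "density_integrand n X r \<le> 1 / r\<^sup>2" by (simp add: density_integrand_def)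
qed

lemma set_integrable_density_integrand:
  "X \<ge> 0 \<Longrightarrow> set_integrable lborel {1..} (density_integrand n X)"
  by (rule set_integrable_atLeast_1_bound[where B=1]) (use density_integrand_bound[of _ X n] in auto)

text \<open>The Kac-Rice integrand at |z|^2 = r - 1 and |x|^2 = X, without its factor
  1/pi^2.\<close>

definition critical_density_integrand :: "nat \<Rightarrow> real \<Rightarrow> real \<Rightarrow> real" where
  "critical_density_integrand n X r =
    (real n * (real n - 1)\<^sup>2 * (r - 1)\<^sup>2 * X / r ^ (2 * n + 2) + 2 * (real n - 1) / r ^ (n + 2)) *
    exp (- density_rate n r * X)"

lemma critical_density_integrand_measurable [measurable]:
  "critical_density_integrand n X \<in> borel_measurable borel"
  unfolding critical_density_integrand_def by measurable

lemma critical_density_integrand_bound: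
  assumes r: "r \<ge> 1" and X: "X \<ge> 0" and n: "n \<ge> 1"
  shows "0 \<le> critical_density_integrand n X r"
    "critical_density_integrand n X r \<le> (real n * (real n - 1)\<^sup>2 * X + 2 * (real n - 1)) / r\<^sup>2"
proof -
  note b = density_rate_bounds[OF r, of n]
  show "0 \<le> critical_density_integrand n X r"
    using r X n by (auto simp: critical_density_integrand_def intro!: mult_nonneg_nonneg add_nonneg_nonneg divide_nonneg_nonneg)
  have "exp (- density_rate n r * X) \<le> 1" using b X by simp
  moreover have "(r - 1)\<^sup>2 / r ^ (2 * n + 2) \<le> 1 / r\<^sup>2"
  proof -
    have "(r - 1)\<^sup>2 \<le> r ^ (2 * n)"
      using r n by (intro order.trans[OF power_mono[of "r - 1" r 2] power_increasing]) auto
    then have "(r - 1)\<^sup>2 / r ^ (2 * n) * (1 / r\<^sup>2) \<le> 1 * (1 / r\<^sup>2)"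
      using r by (intro mult_right_mono) auto
    then show ?thesis by (simp add: power_add power2_eq_square mult_ac)
  qed
  then have "real n * (real n - 1)\<^sup>2 * X * ((r - 1)\<^sup>2 / r ^ (2 * n + 2)) \<le> real n * (real n - 1)\<^sup>2 * X * (1 / r\<^sup>2)"
    using X by (intro mult_left_mono) auto
  moreover have "2 * (real n - 1) / r ^ (n + 2) \<le> 2 * (real n - 1) / r\<^sup>2"
    using r n by (intro divide_left_mono power_increasing) auto
  ultimately have "critical_density_integrand n X r \<le> (real n * (real n - 1)\<^sup>2 * X * (1 / r\<^sup>2) + 2 * (real n - 1) / r\<^sup>2) * 1"
    unfolding critical_density_integrand_def using r X n
    by (intro mult_mono add_mono) (auto simp: mult_ac intro!: add_nonneg_nonneg divide_nonneg_nonneg mult_nonneg_nonneg)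
  then show "critical_density_integrand n X r \<le> (real n * (real n - 1)\<^sup>2 * X + 2 * (real n - 1)) / r\<^sup>2"
    by (simp add: add_divide_distrib)
qed

lemma set_integrable_critical_density_integrand:
  assumes "X \<ge> 0" "n \<ge> 1"
  shows "set_integrable lborel {1..} (critical_density_integrand n X)"
  by (rule set_integrable_atLeast_1_bound)
    (use critical_density_integrand_bound[OF _ assms] in \<open>auto simp del: One_nat_def\<close>)

text \<open>The two integrands differ by the derivative of \<open>(n - 1) (r - 1) r\<^sup>-\<^sup>n\<^sup>-\<^sup>1 exp (- q X)\<close> with
  \<open>q = density_rate n r\<close>, which vanishes at both ends.\<close>

lemma integral_critical_density_integrand:
  assumes X: "X \<ge> 0" and n: "n \<ge> 1"
  shows "(LINT r:{1..}|lborel. critical_density_integrand n X r) =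
    (real n - 1) * (LINT r:{1..}|lborel. density_integrand n X r)"
proof -
  define m where "m = real n"
  define H where "H r = (m - 1) * (r - 1) / r ^ (n + 1) * exp (- density_rate n r * X)" for r
  define h where "h r = critical_density_integrand n X r - (m - 1) * density_integrand n X r" for r
  have pw: "((\<lambda>r. r ^ k) has_real_derivative real k * r ^ k / r) (at r)" if "r > 0" for k and r :: real
    using DERIV_pow[of k r] that by (cases k) simp_all
  have dq: "(density_rate n has_real_derivative - m * (m - 1) * (r - 1) / r ^ (n + 1)) (at r)" if "r \<ge> 1" for r
  proof -
    have "r > 0" using that by simp
    have "((\<lambda>r. m * (r - 1) + 1) has_real_derivative m) (at r)"
      by (auto intro!: derivative_eq_intros)
    from DERIV_divide[OF this pw[OF \<open>r > 0\<close>, of n], folded m_def]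
    have "((\<lambda>r. (m * (r - 1) + 1) / r ^ n) has_real_derivative
        (m * r ^ n - (m * (r - 1) + 1) * (m * r ^ n / r)) / (r ^ n * r ^ n)) (at r)"
      using \<open>r > 0\<close> by simp
    also have "(m * r ^ n - (m * (r - 1) + 1) * (m * r ^ n / r)) / (r ^ n * r ^ n) = - m * (m - 1) * (r - 1) / r ^ (n + 1)"
      using \<open>r > 0\<close> by (simp add: divide_simps) (simp add: algebra_simps)
    finally have "((\<lambda>r. (m * (r - 1) + 1) / r ^ n) has_real_derivative - m * (m - 1) * (r - 1) / r ^ (n + 1)) (at r)" .
    then show ?thesis by (simp add: density_rate_def[abs_def] m_def)
  qed
  have dH: "(H has_real_derivative h r) (at r)" if r: "r \<ge> 1" for r
  proof -
    let ?e = "exp (- density_rate n r * X)"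
    have e: "((\<lambda>r. exp (- density_rate n r * X)) has_real_derivative
        ?e * (m * (m - 1) * (r - 1) / r ^ (n + 1) * X)) (at r)"
      by (rule derivative_eq_intros dq[OF r] refl)+ simp
    have p: "((\<lambda>r. (m - 1) * (r - 1) / r ^ (n + 1)) has_real_derivative
        (m - 1) * (m + 1 - m * r) / r ^ (n + 2)) (at r)"
    proof -
      have "r > 0" using r by simp
      have "((\<lambda>r. (m - 1) * (r - 1)) has_real_derivative m - 1) (at r)"
        by (auto intro!: derivative_eq_intros)
      from DERIV_divide[OF this pw[OF \<open>r > 0\<close>, of "n + 1"]]
      have "((\<lambda>r. (m - 1) * (r - 1) / r ^ (n + 1)) has_real_derivative
          ((m - 1) * r ^ (n + 1) - (m - 1) * (r - 1) * ((m + 1) * r ^ (n + 1) / r)) / (r ^ (n + 1) * r ^ (n + 1))) (at r)"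
        using \<open>r > 0\<close> by (simp add: m_def add.commute)
      also have "((m - 1) * r ^ (n + 1) - (m - 1) * (r - 1) * ((m + 1) * r ^ (n + 1) / r)) / (r ^ (n + 1) * r ^ (n + 1)) =
          (m - 1) * (m + 1 - m * r) / r ^ (n + 2)"
        using \<open>r > 0\<close> by (simp add: divide_simps) (simp add: algebra_simps)
      finally show ?thesis .
    qed
    have "(H has_real_derivative ((m - 1) * (r - 1) / r ^ (n + 1)) * (?e * (m * (m - 1) * (r - 1) / r ^ (n + 1) * X)) +
      (m - 1) * (m + 1 - m * r) / r ^ (n + 2) * ?e) (at r)"
      unfolding H_def by (rule derivative_eq_intros e p refl)+ (simp add: algebra_simps)
    also have "((m - 1) * (r - 1) / r ^ (n + 1)) * (?e * (m * (m - 1) * (r - 1) / r ^ (n + 1) * X)) +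
      (m - 1) * (m + 1 - m * r) / r ^ (n + 2) * ?e = h r"
    proof -
      \<comment> \<open>The term with \<open>X\<close> comes from differentiating the exponential.
        The prefactor contributes the rest, split by m + 1 - m r = 2 - (m (r - 1) + 1).\<close>
      have 1: "((m - 1) * (r - 1) / r ^ (n + 1)) * (?e * (m * (m - 1) * (r - 1) / r ^ (n + 1) * X)) =
        m * (m - 1)\<^sup>2 * (r - 1)\<^sup>2 * X / r ^ (2 * n + 2) * ?e"
        by (simp add: power2_eq_square mult_2_right power_add mult_ac)
      have 2: "(m - 1) * (m + 1 - m * r) / r ^ (n + 2) = 2 * (m - 1) / r ^ (n + 2) - (m - 1) * (density_rate n r / r\<^sup>2)"
        unfolding density_rate_def m_def[symmetric]
        using r by (simp add: power_add divide_simps) (simp add: algebra_simps power2_eq_square)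
      have 3: "p * e + (q - c * d) * e = (p + q) * e - c * (d * e)" for p e q c d :: real
        by (simp add: algebra_simps)
      have "h r = (m * (m - 1)\<^sup>2 * (r - 1)\<^sup>2 * X / r ^ (2 * n + 2) + 2 * (m - 1) / r ^ (n + 2)) * ?e -
          (m - 1) * (density_rate n r / r\<^sup>2 * ?e)"
        by (simp only: h_def critical_density_integrand_def density_integrand_def m_def)
      also have "\<dots> = m * (m - 1)\<^sup>2 * (r - 1)\<^sup>2 * X / r ^ (2 * n + 2) * ?e +
          (2 * (m - 1) / r ^ (n + 2) - (m - 1) * (density_rate n r / r\<^sup>2)) * ?e"
        by (rule 3[symmetric])
      finally show ?thesis by (simp only: 1 2)
    qed
    finally show ?thesis .
  qed
  have intL: "set_integrable lborel {1..} (critical_density_integrand n X)"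
    by (rule set_integrable_critical_density_integrand[OF X n])
  have intR: "set_integrable lborel {1..} (\<lambda>r. (m - 1) * density_integrand n X r)"
    using set_integrable_density_integrand[OF X] by (rule set_integrable_mult_right)
  have inth: "set_integrable lborel {1..} h" unfolding h_def using intL intR by (rule set_integral_diff)
  \<comment> \<open>Since \<open>h\<close> need not have a fixed sign, the half-line integral is
    taken as a limit over bounded intervals, on which it equals \<open>H b\<close>; the factor r - 1
    makes \<open>H 1\<close> vanish.\<close>
  have "((\<lambda>b. LINT r:{1..b}|lborel. h r) \<longlongrightarrow> (LINT r:{1..}|lborel. h r)) at_top"
    by (rule tendsto_set_lebesgue_integral_at_top[OF _ inth]) simp
  moreover have "\<forall>\<^sub>F b in at_top. (LINT r:{1..b}|lborel. h r) = H b"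
  proof (rule eventually_mono[OF eventually_ge_at_top[of 1]])
    fix b :: real assume b: "1 \<le> b"
    have "(LINT r:{1..b}|lborel. h r) = H b - H 1"
      unfolding set_lebesgue_integral_def
    proof (rule integral_FTC_atLeastAtMost[OF b])
      show "(H has_vector_derivative h r) (at r within {1..b})" if "1 \<le> r" "r \<le> b" for r
        using dH[OF that(1)] by (simp add: has_real_derivative_iff_has_vector_derivative has_vector_derivative_at_within)
      have "continuous_on {1..b} (density_rate n)"
        using dq by (auto intro!: continuous_at_imp_continuous_on DERIV_isCont)
      then show "continuous_on {1..b} h"
        unfolding h_def critical_density_integrand_def density_integrand_def
        by (intro continuous_intros) auto
    qed
    then show "(LINT r:{1..b}|lborel. h r) = H b" by (simp add: H_def)
  qed
  ultimately have lim: "(H \<longlongrightarrow> (LINT r:{1..}|lborel. h r)) at_top"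
    by (rule Lim_transform_eventually)
  have "(H \<longlongrightarrow> 0) at_top"
  proof (rule Lim_null_comparison)
    show "((\<lambda>r. \<bar>m - 1\<bar> * (1 / r)) \<longlongrightarrow> 0) at_top" by real_asymp
    show "\<forall>\<^sub>F r in at_top. norm (H r) \<le> \<bar>m - 1\<bar> * (1 / r)"
    proof (rule eventually_mono[OF eventually_ge_at_top[of 1]])
      fix r :: real assume r: "1 \<le> r"
      have "exp (- density_rate n r * X) \<le> 1" using density_rate_bounds(1)[OF r, of n] X by simp
      moreover have "(r - 1) / r ^ (n + 1) \<le> 1 / r"
      proof -
        have "r - 1 \<le> r ^ n" using r n self_le_power[of r n] by simp
        from divide_right_mono[OF this, of "r ^ (n + 1)"] show ?thesis using r by simp
      qed
      ultimately have "\<bar>m - 1\<bar> * ((r - 1) / r ^ (n + 1)) * exp (- density_rate n r * X) \<le> \<bar>m - 1\<bar> * (1 / r) * 1"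
        using r by (intro mult_mono) auto
      then show "norm (H r) \<le> \<bar>m - 1\<bar> * (1 / r)" using r by (simp add: H_def abs_mult)
    qed
  qed
  then have "(LINT r:{1..}|lborel. h r) = 0"
    using tendsto_unique[OF trivial_limit_at_top_linorder lim] by simp
  moreover have "(LINT r:{1..}|lborel. h r) = (LINT r:{1..}|lborel. critical_density_integrand n X r) -
     (LINT r:{1..}|lborel. (m - 1) * density_integrand n X r)"
    unfolding h_def using intL intR by (rule set_integral_diff)
  ultimately show ?thesis by (simp add: m_def)
qed

text \<open>The map r = 1 + |z|^2 turns planar measure into \<open>pi\<close> times Lebesgue measure
  on r >= 1, which reduces the factor 1/pi^2 to 1/pi.\<close>

lemma nn_integral_critical_density_cmod:
  fixes n :: nat and X :: real
  assumes X: "X \<ge> 0" and n: "n \<ge> 1"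
  shows "(\<integral>\<^sup>+z. ennreal (1 / pi\<^sup>2 * critical_density_integrand n X (1 + (cmod z)\<^sup>2)) \<partial>lborel) =
    ennreal ((real n - 1) / pi * (LINT r:{1..}|lborel. density_integrand n X r))"
proof -
  let ?L = "critical_density_integrand n X"
  have "(\<integral>\<^sup>+z. ennreal (1 / pi\<^sup>2 * ?L (1 + (cmod z)\<^sup>2)) \<partial>lborel) =
    ennreal pi * (\<integral>\<^sup>+t. ennreal (1 / pi\<^sup>2 * ?L (1 + t)) * indicator {0..} t \<partial>lborel)"
    by (rule nn_integral_cmod_power2) measurable
  also have "(\<integral>\<^sup>+t. ennreal (1 / pi\<^sup>2 * ?L (1 + t)) * indicator {0..} t \<partial>lborel) =
    (\<integral>\<^sup>+r. ennreal (1 / pi\<^sup>2 * ?L r) * indicator {1..} r \<partial>lborel)"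
    by (subst (2) nn_integral_real_affine[where c=1 and t=1]) (auto simp: indicator_def)
  also have "\<dots> = (\<integral>\<^sup>+r. ennreal (indicator {1..} r *\<^sub>R (1 / pi\<^sup>2 * ?L r)) \<partial>lborel)"
    by (intro nn_integral_cong) (simp add: indicator_def)
  also have "\<dots> = ennreal (LINT r:{1..}|lborel. 1 / pi\<^sup>2 * ?L r)"
    unfolding set_lebesgue_integral_def
  proof (rule nn_integral_eq_integral)
    show "integrable lborel (\<lambda>r. indicator {1..} r *\<^sub>R (1 / pi\<^sup>2 * ?L r))"
      using set_integrable_mult_right[OF set_integrable_critical_density_integrand[OF X n], of "1 / pi\<^sup>2"]
      by (simp add: set_integrable_def)
    show "AE r in lborel. 0 \<le> indicator {1..} r *\<^sub>R (1 / pi\<^sup>2 * ?L r)"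
      using critical_density_integrand_bound(1)[OF _ X n] by (intro AE_I2) (auto simp: indicator_def)
  qed
  also have "(LINT r:{1..}|lborel. 1 / pi\<^sup>2 * ?L r) = 1 / pi\<^sup>2 * ((real n - 1) * (LINT r:{1..}|lborel. density_integrand n X r))"
    using integral_critical_density_integrand[OF X n] by simp
  also have "ennreal pi * ennreal \<dots> = ennreal (pi * \<dots>)"
    by (rule ennreal_mult'[symmetric]) simp
  also have "pi * (1 / pi\<^sup>2 * ((real n - 1) * (LINT r:{1..}|lborel. density_integrand n X r))) =
     (real n - 1) / pi * (LINT r:{1..}|lborel. density_integrand n X r)"
    by (simp add: power2_eq_square)
  finally show ?thesis .
qed

text \<open>Dominated convergence with the majorant 1/r^2, which does not depend on
  \<open>x\<close>.\<close>

lemma continuous_density_integral: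
  "continuous_on UNIV (\<lambda>x::complex. LINT r:{1..}|lborel. density_integrand n ((cmod x)\<^sup>2) r)"
proof (rule continuous_on_sequentiallyI)
  fix u :: "nat \<Rightarrow> complex" and a assume u: "u \<longlonglongrightarrow> a"
  show "(\<lambda>i. LINT r:{1..}|lborel. density_integrand n ((cmod (u i))\<^sup>2) r) \<longlonglongrightarrow>
     (LINT r:{1..}|lborel. density_integrand n ((cmod a)\<^sup>2) r)"
    unfolding set_lebesgue_integral_def
  proof (rule integral_dominated_convergence[where w="\<lambda>r. indicator {1..} r *\<^sub>R (1 / r\<^sup>2)"])
    show "integrable lborel (\<lambda>r::real. indicator {1..} r *\<^sub>R (1 / r\<^sup>2))"
      using set_integrable_inverse_square by (simp add: set_integrable_def)
    show "AE r in lborel. (\<lambda>i. indicator {1..} r *\<^sub>R density_integrand n ((cmod (u i))\<^sup>2) r) \<longlonglongrightarrow>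
        indicator {1..} r *\<^sub>R density_integrand n ((cmod a)\<^sup>2) r"
      unfolding density_integrand_def by (intro AE_I2 tendsto_intros u)
    show "AE r in lborel. norm (indicator {1..} r *\<^sub>R density_integrand n ((cmod (u i))\<^sup>2) r)
        \<le> indicator {1..} r *\<^sub>R (1 / r\<^sup>2)" for i
      using density_integrand_bound[of _ "(cmod (u i))\<^sup>2" n] by (intro AE_I2) (auto simp: indicator_def)
  qed measurable
qed

section \<open>The expected density\<close>

lemma pderiv_sum: "pderiv (\<Sum>i\<in>A. f i) = (\<Sum>i\<in>A. pderiv (f i))"
  by (induction A rule: infinite_finite_induct) (simp_all add: pderiv_add)

lemma coeff_su2_poly:
  "coeff (su2_poly n a) j = (if j \<le> n then a j * complex_of_real (sqrt (real (n choose j))) else 0)"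
  by (simp add: su2_poly_def coeff_sum)

lemma poly_pderiv_su2_poly:
  "poly (pderiv (su2_poly n a)) z =
    (\<Sum>j\<le>n. a j * complex_of_real (sqrt (real (n choose j))) * of_nat j * z ^ (j - 1))"
  by (simp add: su2_poly_def pderiv_sum pderiv_monom poly_sum poly_monom mult_ac)

lemma pderiv_su2_poly_eq_0_iff:
  "pderiv (su2_poly n a) = 0 \<longleftrightarrow> (\<forall>j\<in>{1..n}. a j = 0)"
proof -
  have "pderiv (su2_poly n a) = 0 \<longleftrightarrow> (\<forall>j. coeff (su2_poly n a) (Suc j) = 0)"
    by (auto simp: poly_eq_iff coeff_pderiv simp del: of_nat_Suc)
  also have "\<dots> \<longleftrightarrow> (\<forall>j\<in>{1..n}. a j = 0)"
    by (auto simp: coeff_su2_poly) (metis Suc_pred' less_eq_Suc_le not_less_eq_eq)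
  finally show ?thesis .
qed

lemma finite_poly_roots_iff:
  fixes p :: "complex poly"
  shows "finite {z. poly p z = 0} \<longleftrightarrow> p \<noteq> 0"
  using poly_roots_finite by (auto simp: infinite_UNIV_char_0)

text \<open>Also applied to continuous functions that are not smooth. For constant \<open>p\<close>
  the index set is the whole plane and the sum is 0 by default.\<close>

definition critical_sum :: "(complex \<Rightarrow> real) \<Rightarrow> complex poly \<Rightarrow> real" where
  "critical_sum \<psi> p = (\<Sum>z | poly (pderiv p) z = 0. \<psi> (poly p z))"

lemma critical_sum_su2_poly_measurable [measurable]:
  assumes \<psi>: "continuous_on UNIV \<psi>"
  shows "(\<lambda>a. critical_sum \<psi> (su2_poly n a)) \<in> borel_measurable (PiM {..n} (\<lambda>_. borel))"
  unfolding critical_sum_def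
proof (rule borel_measurable_sum_zeros)
  note [measurable] = borel_measurable_continuous_onI[OF \<psi>]
  show "continuous_on UNIV (poly (pderiv (su2_poly n a)))" for a by (intro continuous_intros)
  show "(\<lambda>a. poly (pderiv (su2_poly n a)) z) \<in> borel_measurable (PiM {..n} (\<lambda>_. borel))" for z
    unfolding poly_pderiv_su2_poly by measurable
  show "continuous_on UNIV (\<lambda>z. \<psi> (poly (su2_poly n a) z))" for a
    by (rule continuous_on_compose2[OF \<psi>]) (auto intro: continuous_intros)
  have "(\<lambda>a. poly (su2_poly n a) z) \<in> borel_measurable (PiM {..n} (\<lambda>_. borel))" for z
    unfolding poly_su2_poly by measurable
  then show "(\<lambda>a. \<psi> (poly (su2_poly n a) z)) \<in> borel_measurable (PiM {..n} (\<lambda>_. borel))" for z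
    by measurable
  \<comment> \<open>The critical set is infinite exactly when all coefficients from index 1 on
    vanish, which is a measurable condition.\<close>
  have "Measurable.pred (PiM {..n} (\<lambda>_. borel)) (\<lambda>a :: nat \<Rightarrow> complex. \<not> (\<forall>j\<in>{1..n}. a j = 0))"
    by measurable
  then show "Measurable.pred (PiM {..n} (\<lambda>_. borel)) (\<lambda>a. finite {z. poly (pderiv (su2_poly n a)) z = 0})"
    unfolding finite_poly_roots_iff pderiv_su2_poly_eq_0_iff .
qed

text \<open>A nonconstant polynomial has at most as many critical points as its degree. The bound is
  deterministic, so expectations exist without any moment estimate.\<close>

lemma critical_sum_bound:
  assumes "\<And>z. \<bar>\<psi> z\<bar> \<le> B"
  shows "\<bar>critical_sum \<psi> p\<bar> \<le> real (degree p) * B"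
proof (cases "pderiv p = 0")
  case True
  have "B \<ge> 0" using assms[of 0] by linarith
  then show ?thesis
    using True by (simp add: critical_sum_def infinite_UNIV_char_0)
next
  case False
  have "B \<ge> 0" using assms[of 0] by linarith
  have "\<bar>critical_sum \<psi> p\<bar> \<le> (\<Sum>z | poly (pderiv p) z = 0. B)"
    unfolding critical_sum_def using assms by (intro order.trans[OF sum_abs] sum_mono)
  also have "\<dots> = real (card {z. poly (pderiv p) z = 0}) * B" by simp
  also have "\<dots> \<le> real (degree p) * B"
    using card_poly_roots_bound[OF False] degree_pderiv[of p] \<open>B \<ge> 0\<close>
    by (intro mult_right_mono) auto
  finally show ?thesis .
qed

text \<open>An infinite fibre forces \<open>g\<close> to be constant with value
  \<open>coeff g 0\<close>, so removing this single \<open>w\<close> is enough for every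
  \<open>g\<close>.\<close>

lemma AE_finite_fibre:
  fixes g :: "complex poly"
  shows "AE w in lborel. finite {z. poly g z = w}"
proof -
  have "finite {z. poly g z = w}" if "w \<noteq> coeff g 0" for w
  proof -
    have "g - [:w:] \<noteq> 0" using that by (auto simp: poly_eq_iff coeff_pCons split: nat.splits dest: spec[of _ 0])
    then show ?thesis using poly_roots_finite[of "g - [:w:]"] by simp
  qed
  then show ?thesis using AE_lborel_singleton[of "coeff g 0"] by (auto elim: eventually_mono)
qed

text \<open>Since p' z = sqrt n * (a - g z), the critical set is the fibre of \<open>g\<close> over
  the linear coefficient \<open>a\<close>. The area formula trades the integral over
  \<open>a\<close> for one over \<open>z\<close>: the density of \<open>a\<close> is evaluated at
  \<open>g z\<close>, and the Jacobian |g' z|^2 appears.\<close>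

lemma nn_integral_critical_sum_linear_coeff:
  fixes b :: "nat \<Rightarrow> complex" and n :: nat and c :: complex
  assumes n: "n \<ge> 1" and \<psi>: "continuous_on UNIV \<psi>" "\<And>z. \<psi> z \<ge> 0"
  defines "v \<equiv> \<lambda>z j. of_real (sqrt (n choose j)) * of_nat j * z ^ (j - 1) / of_real (sqrt n)"
    and "u \<equiv> \<lambda>z j. of_real (sqrt (n choose j)) * (1 - of_nat j) * z ^ j"
    and "w \<equiv> \<lambda>z j. of_real (sqrt (n choose j)) * of_nat (j * (j - 1)) * z ^ (j - 2) / of_real (sqrt n)"
  shows "(\<integral>\<^sup>+a. ennreal (critical_sum \<psi> (su2_poly n (b(0 := c, 1 := a)))) \<partial>cgauss_measure) =
    (\<integral>\<^sup>+z. ennreal (\<psi> (c + (\<Sum>j=2..n. b j * u z j))) *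
      ennreal (cgauss (- (\<Sum>j=2..n. b j * v z j)) * (cmod (\<Sum>j=2..n. b j * w z j))\<^sup>2) \<partial>lborel)"
proof -
  note [measurable] = borel_measurable_continuous_onI[OF \<psi>(1)]
  define g where "g = - (\<Sum>j=2..n. monom (b j * (of_real (sqrt (n choose j)) * of_nat j / of_real (sqrt n))) (j - 1))"
  have g: "poly g z = - (\<Sum>j=2..n. b j * v z j)" for z
    by (simp add: g_def poly_sum poly_monom v_def mult.assoc)
  have g': "poly (pderiv g) z = - (\<Sum>j=2..n. b j * w z j)" for z
    by (simp add: g_def pderiv_sum pderiv_minus pderiv_monom poly_sum poly_monom w_def mult_ac numeral_2_eq_2)
  let ?a = "\<lambda>a. b(0 := c, 1 := a)"
  let ?p = "\<lambda>a. su2_poly n (?a a)"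
  have n0: "complex_of_real (sqrt n) \<noteq> 0" using n by simp
  have S: "(\<Sum>j\<le>n. f j) = f 0 + f 1 + (\<Sum>j=2..n. f j)" for f :: "nat \<Rightarrow> complex"
  proof -
    have "{..n} = insert 0 (insert 1 {2..n})" using n by auto
    then show ?thesis by (simp add: add.assoc)
  qed
  have crit: "poly (pderiv (?p a)) z = of_real (sqrt n) * (a - poly g z)" for a z
    unfolding poly_pderiv_su2_poly S g using n0
    by (simp add: v_def sum_distrib_left distrib_left mult_ac)
  have val: "poly (?p a) z = c + (\<Sum>j=2..n. b j * u z j)" if "poly g z = a" for a z
  proof -
    \<comment> \<open>At a critical point the linear term of \<open>p\<close> equals minus the sum
      of j times the terms of higher order; this is the origin of the factors 1 - j in
      \<open>u\<close>.\<close>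
    have "a * of_real (sqrt n) * z = - (\<Sum>j=2..n. b j * (of_real (sqrt (n choose j)) * of_nat j * z ^ j))"
    proof -
      have "b j * v z j * of_real (sqrt n) * z = b j * (of_real (sqrt (n choose j)) * of_nat j * z ^ j)" if "j \<in> {2..n}" for j
        using that n0 by (cases j) (simp_all add: v_def mult_ac)
      then have "(\<Sum>j=2..n. b j * v z j * of_real (sqrt n) * z) =
          (\<Sum>j=2..n. b j * (of_real (sqrt (n choose j)) * of_nat j * z ^ j))"
        by (rule sum.cong[OF refl])
      then show ?thesis unfolding that[symmetric] g by (simp add: sum_distrib_right)
    qed
    then have "poly (?p a) z = c + (\<Sum>j=2..n. b j * of_real (sqrt (n choose j)) * z ^ j)
       - (\<Sum>j=2..n. b j * (of_real (sqrt (n choose j)) * of_nat j * z ^ j))"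
      unfolding poly_su2_poly S by simp
    then show ?thesis by (simp add: u_def algebra_simps sum_subtractf)
  qed
  have fib: "{z. poly (pderiv (?p a)) z = 0} = {z. poly g z = a}" for a
    unfolding crit using n0 by auto
  let ?G = "\<lambda>z. ennreal (cgauss (poly g z)) * ennreal (\<psi> (c + (\<Sum>j=2..n. b j * u z j)))"
  have [measurable]: "(\<lambda>z. u z j) \<in> borel_measurable borel" for j unfolding u_def by measurable
  have [measurable]: "poly g \<in> borel_measurable borel"
    by (intro borel_measurable_continuous_onI continuous_intros)
  have eq: "ennreal (cgauss a) * ennreal (critical_sum \<psi> (?p a)) = (\<integral>\<^sup>+z. ?G z \<partial>count_space {z. poly g z = a})"
    if fin: "finite {z. poly g z = a}" for a
  proof -
    have "critical_sum \<psi> (?p a) = (\<Sum>z | poly g z = a. \<psi> (c + (\<Sum>j=2..n. b j * u z j)))"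
      unfolding critical_sum_def fib by (rule sum.cong[OF refl]) (simp only: mem_Collect_eq val)
    then have "ennreal (cgauss a) * ennreal (critical_sum \<psi> (?p a)) =
      (\<Sum>z | poly g z = a. ennreal (cgauss a) * ennreal (\<psi> (c + (\<Sum>j=2..n. b j * u z j))))"
      using \<psi>(2) by (simp flip: sum_distrib_left)
    also have "\<dots> = (\<Sum>z | poly g z = a. ?G z)" by (intro sum.cong) auto
    finally show ?thesis by (simp add: nn_integral_count_space_finite[OF fin])
  qed
  \<comment> \<open>Elements of the product space are extensional on \<open>{..n}\<close>;
    restricting the coefficients accordingly does not change the polynomial.\<close>
  have m: "(\<lambda>a. critical_sum \<psi> (?p a)) \<in> borel_measurable borel"
  proof -
    have "(\<lambda>a. critical_sum \<psi> (su2_poly n (restrict (?a a) {..n}))) \<in> borel_measurable borel"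
      by (rule measurable_compose[OF _ critical_sum_su2_poly_measurable[OF \<psi>(1)]])
        (auto intro!: measurable_restrict)
    moreover have "su2_poly n (restrict (?a a) {..n}) = ?p a" for a
      by (auto simp: su2_poly_def intro!: sum.cong)
    ultimately show ?thesis by simp
  qed
  have "(\<integral>\<^sup>+a. ennreal (critical_sum \<psi> (?p a)) \<partial>cgauss_measure) =
     (\<integral>\<^sup>+a. ennreal (cgauss a) * ennreal (critical_sum \<psi> (?p a)) \<partial>lborel)"
    using m by (intro nn_integral_cgauss_measure) simp
  \<comment> \<open>On an infinite fibre the sum is 0 by default while the counting integral may be
    infinite; such fibres occur only for a null set of \<open>a\<close>.\<close>
  also have "\<dots> = (\<integral>\<^sup>+a. (\<integral>\<^sup>+z. ?G z \<partial>count_space {z. poly g z = a}) \<partial>lborel)"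
    using AE_finite_fibre[of g] by (intro nn_integral_cong_AE, elim eventually_mono) (rule eq)
  also have "\<dots> = (\<integral>\<^sup>+z. ?G z * ennreal ((cmod (poly (pderiv g) z))\<^sup>2) \<partial>lborel)"
    by (rule nn_integral_poly_fibres) measurable
  also have "\<dots> = (\<integral>\<^sup>+z. ennreal (\<psi> (c + (\<Sum>j=2..n. b j * u z j))) *
      ennreal (cgauss (- (\<Sum>j=2..n. b j * v z j)) * (cmod (\<Sum>j=2..n. b j * w z j))\<^sup>2) \<partial>lborel)"
    unfolding g g' by (intro nn_integral_cong) (simp add: ennreal_mult mult_ac)
  finally show ?thesis .
qed

section \<open>Averaging over all coefficients\<close>

definition critical_density :: "nat \<Rightarrow> complex \<Rightarrow> real" where
  "critical_density n x = (real n - 1) / pi * (LINT r:{1..}|lborel. density_integrand n ((cmod x)\<^sup>2) r)"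

lemma critical_density_nonneg: "n \<ge> 1 \<Longrightarrow> critical_density n x \<ge> 0"
  unfolding critical_density_def set_lebesgue_integral_def
  by (intro mult_nonneg_nonneg divide_nonneg_nonneg integral_nonneg_AE AE_I2)
    (auto simp: indicator_def intro: density_integrand_bound)

lemma continuous_critical_density: "continuous_on UNIV (critical_density n)"
  unfolding critical_density_def by (intro continuous_intros continuous_density_integral)

text \<open>\<open>a\<^sub>1\<close> is integrated innermost, so that \<open>z\<close> can take its
  place; \<open>a\<^sub>0\<close> is then exchanged for the critical value \<open>x\<close>. Tonelli
  finally moves the remaining coefficients inside, where \<open>z\<close> and \<open>x\<close> are
  fixed and the Gaussian formula applies.\<close>

lemma nn_integral_critical_sum:
  assumes n: "n \<ge> 1" and \<psi>: "continuous_on UNIV \<psi>" "\<And>z. \<psi> z \<ge> 0"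
  shows "(\<integral>\<^sup>+a. ennreal (critical_sum \<psi> (su2_poly n a)) \<partial>PiM {..n} (\<lambda>_. cgauss_measure)) =
    (\<integral>\<^sup>+x. ennreal (\<psi> x) * ennreal (critical_density n x) \<partial>lborel)"
proof -
  interpret prob_space cgauss_measure by (rule prob_space_cgauss_measure)
  interpret product_sigma_finite "\<lambda>_. cgauss_measure" by unfold_locales
  note [measurable] = borel_measurable_continuous_onI[OF \<psi>(1)]
  define J where "J = {2..n}"
  have J: "finite J" "0 \<notin> J" "1 \<notin> insert 0 J" and nJ: "{..n} = insert 1 (insert 0 J)"
    using n by (auto simp: J_def)
  interpret J: finite_product_sigma_finite "\<lambda>_. cgauss_measure" J by standard (rule J)
  interpret JC: pair_sigma_finite "PiM J (\<lambda>_. cgauss_measure)" "lborel :: complex measure" ..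
  interpret GC: pair_sigma_finite cgauss_measure "lborel :: complex measure" ..
  define v where "v z j = of_real (sqrt (n choose j)) * of_nat j * z ^ (j - 1) / of_real (sqrt n)" for z :: complex and j
  define u where "u z j = of_real (sqrt (n choose j)) * (1 - of_nat j) * z ^ j" for z :: complex and j
  define w where "w z j = of_real (sqrt (n choose j)) * of_nat (j * (j - 1)) * z ^ (j - 2) / of_real (sqrt n)" for z :: complex and j
  have [measurable]: "(\<lambda>z. v z j) \<in> borel_measurable borel" "(\<lambda>z. u z j) \<in> borel_measurable borel"
      "(\<lambda>z. w z j) \<in> borel_measurable borel" for j
    unfolding v_def u_def w_def by measurable
  define A where "A b z = cgauss (- (\<Sum>j\<in>J. b j * v z j)) * (cmod (\<Sum>j\<in>J. b j * w z j))\<^sup>2" for b z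
  define P where "P b z = (\<Sum>j\<in>J. b j * u z j)" for b z
  have A0: "A b z \<ge> 0" for b z by (simp add: A_def)
  have Am [measurable]: "(\<lambda>(b, z). A b z) \<in> borel_measurable (PiM J (\<lambda>_. cgauss_measure) \<Otimes>\<^sub>M borel)"
    unfolding A_def by measurable
  have Pm [measurable]: "(\<lambda>(b, z). P b z) \<in> borel_measurable (PiM J (\<lambda>_. cgauss_measure) \<Otimes>\<^sub>M borel)"
    unfolding P_def by measurable
  have Abm: "(\<lambda>z. A b z) \<in> borel_measurable borel" "(\<lambda>z. P b z) \<in> borel_measurable borel" for b
    unfolding A_def P_def by measurable
  have sets_eq: "sets (PiM I (\<lambda>_. cgauss_measure)) = sets (PiM I (\<lambda>_. borel))" for I :: "nat set"
    by (rule sets_PiM_cong) auto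
  have fm: "(\<lambda>a. ennreal (critical_sum \<psi> (su2_poly n a))) \<in> borel_measurable (PiM (insert 1 (insert 0 J)) (\<lambda>_. cgauss_measure))"
    unfolding nJ[symmetric] using critical_sum_su2_poly_measurable[OF \<psi>(1), of n]
    by (simp add: measurable_cong_sets[OF sets_eq refl])
  \<comment> \<open>Translation frees \<psi> of the other coefficients: they now enter only through
    the Gaussian density of \<open>a\<^sub>0\<close> at \<open>x - q\<close>.\<close>
  have shift: "(\<integral>\<^sup>+c. ennreal (\<psi> (c + q)) \<partial>cgauss_measure) = (\<integral>\<^sup>+x. ennreal (\<psi> x) * ennreal (cgauss (x - q)) \<partial>lborel)" for q
  proof -
    have "(\<integral>\<^sup>+c. ennreal (\<psi> (c + q)) \<partial>cgauss_measure) = (\<integral>\<^sup>+c. ennreal (cgauss c) * ennreal (\<psi> (c + q)) \<partial>lborel)"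
      by (rule nn_integral_cgauss_measure) measurable
    also have "\<dots> = (\<integral>\<^sup>+x. ennreal (\<psi> x) * ennreal (cgauss (x - q)) \<partial>lborel)"
      by (subst (2) nn_integral_complex_translate[where t=q]) (simp_all add: add.commute mult.commute)
    finally show ?thesis .
  qed
  have "(\<integral>\<^sup>+a. ennreal (critical_sum \<psi> (su2_poly n a)) \<partial>PiM {..n} (\<lambda>_. cgauss_measure)) =
    (\<integral>\<^sup>+f. (\<integral>\<^sup>+a. ennreal (critical_sum \<psi> (su2_poly n (f(1 := a)))) \<partial>cgauss_measure) \<partial>PiM (insert 0 J) (\<lambda>_. cgauss_measure))"
    unfolding nJ by (rule product_nn_integral_insert) (use J fm in auto)
  also have "\<dots> = (\<integral>\<^sup>+b. (\<integral>\<^sup>+c. (\<integral>\<^sup>+a. ennreal (critical_sum \<psi> (su2_poly n (b(0 := c, 1 := a)))) \<partial>cgauss_measure)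
      \<partial>cgauss_measure) \<partial>PiM J (\<lambda>_. cgauss_measure))"
  proof (rule product_nn_integral_insert)
    have "(\<lambda>(f, a). f(1 := a)) \<in> PiM (insert 0 J) (\<lambda>_. cgauss_measure) \<Otimes>\<^sub>M cgauss_measure \<rightarrow>\<^sub>M
        PiM (insert 1 (insert 0 J)) (\<lambda>_. cgauss_measure)"
      by (rule measurable_add_dim)
    from measurable_compose[OF this fm]
    have "(\<lambda>(f, a). ennreal (critical_sum \<psi> (su2_poly n (f(1 := a))))) \<in>
      borel_measurable (PiM (insert 0 J) (\<lambda>_. cgauss_measure) \<Otimes>\<^sub>M cgauss_measure)"
      by (simp add: case_prod_beta')
    then show "(\<lambda>f. \<integral>\<^sup>+a. ennreal (critical_sum \<psi> (su2_poly n (f(1 := a)))) \<partial>cgauss_measure) \<in>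
      borel_measurable (PiM (insert 0 J) (\<lambda>_. cgauss_measure))"
      by (rule borel_measurable_nn_integral)
  qed (use J in auto)
  also have "\<dots> = (\<integral>\<^sup>+b. (\<integral>\<^sup>+c. (\<integral>\<^sup>+z. ennreal (\<psi> (c + P b z)) * ennreal (A b z) \<partial>lborel)
      \<partial>cgauss_measure) \<partial>PiM J (\<lambda>_. cgauss_measure))"
    unfolding nn_integral_critical_sum_linear_coeff[OF n \<psi>] A_def P_def u_def v_def w_def J_def ..
  also have "\<dots> = (\<integral>\<^sup>+b. (\<integral>\<^sup>+z. (\<integral>\<^sup>+x. ennreal (\<psi> x) * ennreal (A b z * cgauss (x - P b z)) \<partial>lborel)
      \<partial>lborel) \<partial>PiM J (\<lambda>_. cgauss_measure))"
  proof (rule nn_integral_cong)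
    fix b
    note [measurable] = Abm[of b]
    have "(\<integral>\<^sup>+c. (\<integral>\<^sup>+z. ennreal (\<psi> (c + P b z)) * ennreal (A b z) \<partial>lborel) \<partial>cgauss_measure) =
      (\<integral>\<^sup>+z. (\<integral>\<^sup>+c. ennreal (\<psi> (c + P b z)) * ennreal (A b z) \<partial>cgauss_measure) \<partial>lborel)"
      by (rule GC.Fubini'[symmetric]) measurable
    also have "\<dots> = (\<integral>\<^sup>+z. (\<integral>\<^sup>+x. ennreal (\<psi> x) * ennreal (A b z * cgauss (x - P b z)) \<partial>lborel) \<partial>lborel)"
    proof (rule nn_integral_cong)
      fix z
      have "(\<integral>\<^sup>+c. ennreal (\<psi> (c + P b z)) * ennreal (A b z) \<partial>cgauss_measure) =
        (\<integral>\<^sup>+c. ennreal (\<psi> (c + P b z)) \<partial>cgauss_measure) * ennreal (A b z)"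
        by (rule nn_integral_multc) measurable
      also have "\<dots> = (\<integral>\<^sup>+x. ennreal (\<psi> x) * ennreal (cgauss (x - P b z)) * ennreal (A b z) \<partial>lborel)"
        unfolding shift by (rule nn_integral_multc[symmetric]) measurable
      finally show "(\<integral>\<^sup>+c. ennreal (\<psi> (c + P b z)) * ennreal (A b z) \<partial>cgauss_measure) =
        (\<integral>\<^sup>+x. ennreal (\<psi> x) * ennreal (A b z * cgauss (x - P b z)) \<partial>lborel)"
        by (simp add: ennreal_mult A0 mult_ac)
    qed
    finally show "(\<integral>\<^sup>+c. (\<integral>\<^sup>+z. ennreal (\<psi> (c + P b z)) * ennreal (A b z) \<partial>lborel) \<partial>cgauss_measure) =
      (\<integral>\<^sup>+z. (\<integral>\<^sup>+x. ennreal (\<psi> x) * ennreal (A b z * cgauss (x - P b z)) \<partial>lborel) \<partial>lborel)" .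
  qed
  also have "\<dots> = (\<integral>\<^sup>+z. (\<integral>\<^sup>+b. (\<integral>\<^sup>+x. ennreal (\<psi> x) * ennreal (A b z * cgauss (x - P b z)) \<partial>lborel)
      \<partial>PiM J (\<lambda>_. cgauss_measure)) \<partial>lborel)"
    by (rule JC.Fubini'[symmetric]) measurable
  also have "\<dots> = (\<integral>\<^sup>+z. (\<integral>\<^sup>+x. (\<integral>\<^sup>+b. ennreal (\<psi> x) * ennreal (A b z * cgauss (x - P b z))
      \<partial>PiM J (\<lambda>_. cgauss_measure)) \<partial>lborel) \<partial>lborel)"
    by (intro nn_integral_cong JC.Fubini'[symmetric]) measurable
  also have "\<dots> = (\<integral>\<^sup>+x. (\<integral>\<^sup>+z. (\<integral>\<^sup>+b. ennreal (\<psi> x) * ennreal (A b z * cgauss (x - P b z))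
      \<partial>PiM J (\<lambda>_. cgauss_measure)) \<partial>lborel) \<partial>lborel)"
    by (rule lborel_pair.Fubini'[symmetric]) measurable
  also have "\<dots> = (\<integral>\<^sup>+x. ennreal (\<psi> x) * ennreal (critical_density n x) \<partial>lborel)"
  proof (rule nn_integral_cong)
    fix x
    let ?K = "\<lambda>z. \<integral>\<^sup>+b. ennreal (A b z * cgauss (x - P b z)) \<partial>PiM J (\<lambda>_. cgauss_measure)"
    have K: "?K z = ennreal (1 / pi\<^sup>2 * critical_density_integrand n ((cmod x)\<^sup>2) (1 + (cmod z)\<^sup>2))" if "z \<noteq> 0" for z
    proof -
      have "?K z = (\<integral>\<^sup>+b. ennreal (cgauss (- (\<Sum>j=2..n. b j * v z j)) * cgauss (x - (\<Sum>j=2..n. b j * u z j)) *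
          (cmod (\<Sum>j=2..n. b j * w z j))\<^sup>2) \<partial>PiM {2..n} (\<lambda>_. cgauss_measure))"
        unfolding A_def P_def J_def by (intro nn_integral_cong) (simp add: mult_ac)
      also have "\<dots> = ennreal (1 / pi\<^sup>2 * critical_density_integrand n ((cmod x)\<^sup>2) (1 + (cmod z)\<^sup>2))"
        unfolding u_def v_def w_def nn_integral_critical_density[OF n that]
        by (simp add: critical_density_integrand_def density_rate_def add.commute mult_ac)
      finally show ?thesis .
    qed
    have "(\<integral>\<^sup>+z. (\<integral>\<^sup>+b. ennreal (\<psi> x) * ennreal (A b z * cgauss (x - P b z)) \<partial>PiM J (\<lambda>_. cgauss_measure)) \<partial>lborel) =
      (\<integral>\<^sup>+z. ennreal (\<psi> x) * ?K z \<partial>lborel)"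
      by (intro nn_integral_cong nn_integral_cmult) measurable
    also have "\<dots> = ennreal (\<psi> x) * (\<integral>\<^sup>+z. ?K z \<partial>lborel)"
      by (rule nn_integral_cmult) measurable
    \<comment> \<open>The covariances were computed with division by \<open>z\<close>; the excluded
      point 0 is a null set.\<close>
    also have "(\<integral>\<^sup>+z. ?K z \<partial>lborel) =
      (\<integral>\<^sup>+z. ennreal (1 / pi\<^sup>2 * critical_density_integrand n ((cmod x)\<^sup>2) (1 + (cmod z)\<^sup>2)) \<partial>lborel)"
      using AE_lborel_singleton[of "0::complex"] by (intro nn_integral_cong_AE, elim eventually_mono) (rule K)
    also have "\<dots> = ennreal (critical_density n x)"
      unfolding critical_density_def by (rule nn_integral_critical_density_cmod[OF _ n]) simp
    finally show "(\<integral>\<^sup>+z. (\<integral>\<^sup>+b. ennreal (\<psi> x) * ennreal (A b z * cgauss (x - P b z)) \<partial>PiM J (\<lambda>_. cgauss_measure)) \<partial>lborel) =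
      ennreal (\<psi> x) * ennreal (critical_density n x)" .
  qed
  finally show ?thesis .
qed

text \<open>By independence the joint law of the first n + 1 coefficients is the product measure,
  which transfers the computation to an arbitrary probability space. Signed test functions are then
  handled by linearity.\<close>

lemma has_expected_density_critical_density:
  fixes M :: "'w measure" and a :: "nat \<Rightarrow> 'w \<Rightarrow> complex"
  assumes M: "prob_space M" and ind: "prob_space.indep_vars M (\<lambda>_. borel) a UNIV"
    and dist: "\<And>j. distributed M lborel (a j) (\<lambda>z. ennreal (1 / pi * exp (- (cmod z)\<^sup>2)))"
    and n: "n \<ge> 1"
  shows "has_expected_density M (\<lambda>\<omega>. critical_value_measure (su2_poly n (\<lambda>j. a j \<omega>))) (critical_density n)"
proof -
  interpret prob_space M by (rule M)
  have am [measurable]: "a j \<in> borel_measurable M" for j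
    using distributed_measurable[OF dist[of j]] by simp
  define X where "X \<omega> = (\<lambda>j\<in>{..n}. a j \<omega>)" for \<omega>
  have Xm: "X \<in> M \<rightarrow>\<^sub>M PiM {..n} (\<lambda>_. borel)"
    unfolding X_def by measurable
  have marginal: "distr M borel (a j) = cgauss_measure" for j
    using distributed_distr_eq_density[OF dist[of j]] unfolding cgauss_measure_def cgauss_def[abs_def]
    by (metis distr_cong sets_lborel)
  have law: "distr M (PiM {..n} (\<lambda>_. borel)) X = PiM {..n} (\<lambda>_. cgauss_measure)"
    unfolding X_def using indep_vars_iff_distr_eq_PiM'[of "{..n}" a "\<lambda>_. borel"] indep_vars_subset[OF ind, of "{..n}"]
    by (simp add: marginal)
  have su2: "su2_poly n (X \<omega>) = su2_poly n (\<lambda>j. a j \<omega>)" for \<omega>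
    by (auto simp: su2_poly_def X_def intro!: sum.cong)
  have csm: "(\<lambda>\<omega>. critical_sum \<psi> (su2_poly n (\<lambda>j. a j \<omega>))) \<in> borel_measurable M"
    if "continuous_on UNIV \<psi>" for \<psi>
    using measurable_compose[OF Xm critical_sum_su2_poly_measurable[OF that]] unfolding su2 .
  have nonneg: "(LINT \<omega>|M. critical_sum \<psi> (su2_poly n (\<lambda>j. a j \<omega>))) = (LINT x|lborel. \<psi> x * critical_density n x)"
    if \<psi>: "continuous_on UNIV \<psi>" "\<And>z. \<psi> z \<ge> 0" for \<psi>
  proof -
    have "(\<integral>\<^sup>+\<omega>. ennreal (critical_sum \<psi> (su2_poly n (\<lambda>j. a j \<omega>))) \<partial>M) =
      (\<integral>\<^sup>+f. ennreal (critical_sum \<psi> (su2_poly n f)) \<partial>distr M (PiM {..n} (\<lambda>_. borel)) X)"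
      using critical_sum_su2_poly_measurable[OF \<psi>(1), of n]
      by (subst nn_integral_distr[OF Xm]) (simp_all add: su2)
    also have "\<dots> = (\<integral>\<^sup>+x. ennreal (\<psi> x) * ennreal (critical_density n x) \<partial>lborel)"
      unfolding law by (rule nn_integral_critical_sum[OF n \<psi>])
    also have "\<dots> = (\<integral>\<^sup>+x. ennreal (\<psi> x * critical_density n x) \<partial>lborel)"
      using \<psi>(2) critical_density_nonneg[OF n] by (simp add: ennreal_mult)
    finally show ?thesis
      using csm[OF \<psi>(1)] \<psi> critical_density_nonneg[OF n]
        borel_measurable_continuous_onI[OF continuous_on_mult[OF \<psi>(1) continuous_critical_density[of n]]]
      by (subst (1 2) integral_eq_nn_integral) (auto simp: critical_sum_def sum_nonneg)
  qed
  have degree: "degree (su2_poly n f) \<le> n" for f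
    by (rule degree_le) (simp add: coeff_su2_poly)
  have int: "integrable M (\<lambda>\<omega>. critical_sum \<psi> (su2_poly n (\<lambda>j. a j \<omega>)))"
    if \<psi>: "continuous_on UNIV \<psi>" "\<And>z. \<bar>\<psi> z\<bar> \<le> B" for \<psi> B
  proof (rule integrable_const_bound[where B="real n * B"])
    have "B \<ge> 0" using \<psi>(2)[of 0] by linarith
    have "\<bar>critical_sum \<psi> (su2_poly n f)\<bar> \<le> real n * B" for f
    proof -
      have "\<bar>critical_sum \<psi> (su2_poly n f)\<bar> \<le> real (degree (su2_poly n f)) * B"
        by (rule critical_sum_bound) (rule \<psi>(2))
      also have "\<dots> \<le> real n * B"
        using degree \<open>B \<ge> 0\<close> by (intro mult_right_mono) auto
      finally show ?thesis .
    qed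
    then show "AE \<omega> in M. norm (critical_sum \<psi> (su2_poly n (\<lambda>j. a j \<omega>))) \<le> real n * B"
      by simp
  qed (rule csm[OF \<psi>(1)])
  show ?thesis
    unfolding has_expected_density_def
  proof (intro conjI allI impI)
    show "continuous_on UNIV (critical_density n)" by (rule continuous_critical_density)
    fix \<phi> assume \<phi>: "test_function \<phi>"
    have cont: "continuous_on UNIV \<phi>"
      using \<phi> smooth_imp_continuous by (auto simp: test_function_def)
    obtain B where B: "\<And>z. \<bar>\<phi> z\<bar> \<le> B" using test_function_bounded[OF \<phi>] by blast
    have cvm: "(LINT x|critical_value_measure p. \<phi> x) = critical_sum \<phi> p" for p
      unfolding critical_sum_def by (rule integral_critical_value_measure) (rule borel_measurable_continuous_onI[OF cont])
    show "integrable M (\<lambda>\<omega>. LINT x|critical_value_measure (su2_poly n (\<lambda>j. a j \<omega>)). \<phi> x)"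
      unfolding cvm by (rule int[OF cont B])
    \<comment> \<open>The two parts are continuous and bounded by |\<phi>|, so all four integrals
      are finite and may be subtracted.\<close>
    define \<phi>p where "\<phi>p x = max (\<phi> x) 0" for x
    define \<phi>m where "\<phi>m x = max (- \<phi> x) 0" for x
    have \<phi>_eq: "\<phi> x = \<phi>p x - \<phi>m x" for x by (simp add: \<phi>p_def \<phi>m_def max_def)
    have cont': "continuous_on UNIV \<phi>p" "continuous_on UNIV \<phi>m"
      unfolding \<phi>p_def \<phi>m_def by (intro continuous_intros cont)+
    have pos: "\<phi>p x \<ge> 0" "\<phi>m x \<ge> 0" for x by (simp_all add: \<phi>p_def \<phi>m_def)
    have bnd: "\<bar>\<phi>p x\<bar> \<le> \<bar>\<phi> x\<bar>" "\<bar>\<phi>m x\<bar> \<le> \<bar>\<phi> x\<bar>" for x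
      by (simp_all add: \<phi>p_def \<phi>m_def max_def)
    have B': "\<bar>\<phi>p x\<bar> \<le> B" "\<bar>\<phi>m x\<bar> \<le> B" for x
      using bnd[of x] B[of x] by linarith+
    have I: "integrable lborel (\<lambda>x. \<phi> x * critical_density n x)"
      by (rule integrable_test_function_mult[OF \<phi> continuous_critical_density])
    have I': "integrable lborel (\<lambda>x. \<psi> x * critical_density n x)"
      if "continuous_on UNIV \<psi>" "\<And>x. \<bar>\<psi> x\<bar> \<le> \<bar>\<phi> x\<bar>" for \<psi>
      using that
      by (intro Bochner_Integration.integrable_bound[OF I] AE_I2)
        (auto simp: abs_mult intro!: mult_right_mono borel_measurable_continuous_onI continuous_on_mult continuous_critical_density)
    have "critical_sum \<phi> p = critical_sum \<phi>p p - critical_sum \<phi>m p" for p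
      by (simp add: critical_sum_def \<phi>_eq[abs_def] sum_subtractf)
    then have "(LINT \<omega>|M. critical_sum \<phi> (su2_poly n (\<lambda>j. a j \<omega>))) =
      (LINT \<omega>|M. critical_sum \<phi>p (su2_poly n (\<lambda>j. a j \<omega>))) - (LINT \<omega>|M. critical_sum \<phi>m (su2_poly n (\<lambda>j. a j \<omega>)))"
      using int[OF cont'(1) B'(1)] int[OF cont'(2) B'(2)] by simp
    also have "\<dots> = (LINT x|lborel. \<phi>p x * critical_density n x - \<phi>m x * critical_density n x)"
      unfolding nonneg[OF cont'(1) pos(1)] nonneg[OF cont'(2) pos(2)]
      using I'[OF cont'(1) bnd(1)] I'[OF cont'(2) bnd(2)] by simp
    finally show "(LINT \<omega>|M. LINT x|critical_value_measure (su2_poly n (\<lambda>j. a j \<omega>)). \<phi> x) =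
      (LINT x|lborel. \<phi> x * critical_density n x)"
      unfolding cvm by (simp add: \<phi>_eq[abs_def] left_diff_distrib)
  qed
qed

theorem proposition1:
  fixes M :: "'w measure"
    and a :: "nat \<Rightarrow> 'w \<Rightarrow> complex"
    and n :: nat
  assumes "prob_space M"
    and "prob_space.indep_vars M (\<lambda>_. borel) a UNIV"
    and "\<And>j. distributed M lborel (a j) (\<lambda>z. ennreal (1 / pi * exp (- (cmod z)\<^sup>2)))"
    and "n \<ge> 1"
  shows "(\<forall>x::complex. set_integrable lborel {1..}
            (\<lambda>r::real. (real n * (r - 1) + 1) / r ^ (n + 2)
               * exp (- ((real n * (r - 1) + 1) / r ^ n) * (cmod x)\<^sup>2)))
       \<and> (\<forall>D :: complex \<Rightarrow> real.
            has_expected_density M (\<lambda>\<omega>. critical_value_measure (su2_poly n (\<lambda>j. a j \<omega>))) D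
            \<longleftrightarrow> (\<forall>x. D x = (real n - 1) / pi *
                  (LINT r:{1..}|lborel. (real n * (r - 1) + 1) / r ^ (n + 2)
                     * exp (- ((real n * (r - 1) + 1) / r ^ n) * (cmod x)\<^sup>2))))
       \<and> (\<forall>D :: complex \<Rightarrow> real.
            has_expected_density M (\<lambda>\<omega>. critical_value_measure (su2_poly n (\<lambda>j. a j \<omega>))) D
            \<longrightarrow> (\<exists>f :: real \<Rightarrow> real. \<forall>x. D x = f (cmod x)))"
proof -
  let ?E = "has_expected_density M (\<lambda>\<omega>. critical_value_measure (su2_poly n (\<lambda>j. a j \<omega>)))"
  have E: "?E (critical_density n)"
    by (rule has_expected_density_critical_density[OF assms])
  \<comment> \<open>Uniqueness upgrades the formula to an equivalence, from which the dependence on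
    |x| alone is read off.\<close>
  have iff: "?E D \<longleftrightarrow> (\<forall>x. D x = critical_density n x)" for D
    using E has_expected_density_unique[OF _ E] by (metis ext)
  have "set_integrable lborel {1..} (\<lambda>r. density_integrand n ((cmod x)\<^sup>2) r)" for x
    by (rule set_integrable_density_integrand) simp
  moreover have "\<exists>f. \<forall>x. D x = f (cmod x)" if "?E D" for D
    using that unfolding iff critical_density_def
    by (intro exI[of _ "\<lambda>t. (real n - 1) / pi * (LINT r:{1..}|lborel. density_integrand n (t\<^sup>2) r)"]) simp
  ultimately show ?thesis
    unfolding density_integrand_eq by (auto simp: iff critical_density_def)
qed

end
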